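(* Let $\alpha>0$ and for each $d\ge2$ let $\rho_d$ be a random state on $\mathbb{C}^d\otimes\mathbb{C}^d$ distributed according to $\mu_{d^2,\lfloor\alpha d^2\rfloor}$. Then as $d\to\infty$: (a) for every interval $I\subset\mathbb{R}$, the proportion of eigenvalues (counted with multiplicity, among the $d^2$ eigenvalues) of $\rho_d^\Gamma$ lying in $\frac{1}{d^2}I=\{x/d^2: x\in I\}$ converges in probability to $\mu_{\mathrm{SC}(1,1/\alpha)}(I)$; (b) $\lambda_{\max}(d^2\rho_d^\Gamma)\to 1+2/\sqrt{\alpha}$ and $\lambda_{\min}(d^2\rho_d^\Gamma)\to 1-2/\sqrt{\alpha}$ in probability.
   Context: For integers $n,s\ge1$, $\mu_{n,s}$ denotes the distribution of $\rho=\operatorname{tr}_{\mathbb{C}^s}|\psi\rangle\langle\psi|$, where $\psi$ is uniformly distributed on the unit sphere of $\mathbb{C}^n\otimes\mathbb{C}^s$; here $n=d^2$, $\mathbb{C}^n=\mathbb{C}^d\otimes\mathbb{C}^d$. The partial transpose $\Gamma$ is the linear map determined by $(\tau_1\otimes\tau_2)^\Gamma=\tau_1\otimes\tau_2^T$. For a Hermitian matrix $A$, $\lambda_{\max}(A)$, $\lambda_{\min}(A)$ denote its largest and smallest eigenvalues. For $a\in\mathbb{R}$, $\sigma>0$, the semicircular distribution $\mu_{\mathrm{SC}(a,\sigma^2)}$ is the probability measure supported on $[a-2\sigma,a+2\sigma]$ with density $x\mapsto(2\pi\sigma^2)^{-1}\sqrt{4\sigma^2-(x-a)^2}$. *)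

theory Defs
  imports "HOL-Probability.Probability" "Jordan_Normal_Form.Char_Poly"
begin

text \<open>Index set of the product basis of C^n (x) C^s: pairs (p,k), p < n, k < s.
  A vector psi in C^n (x) C^s is an (extensional) function on this index set.\<close>

definition idx :: "nat \<Rightarrow> nat \<Rightarrow> (nat \<times> nat) set" where
  "idx n s = {..<n} \<times> {..<s}"

definition vec_space :: "nat \<Rightarrow> nat \<Rightarrow> ((nat \<times> nat) \<Rightarrow> complex) measure" where
  "vec_space n s = PiM (idx n s) (\<lambda>_. (lborel :: complex measure))"

definition vnorm :: "nat \<Rightarrow> nat \<Rightarrow> ((nat \<times> nat) \<Rightarrow> complex) \<Rightarrow> real" where
  "vnorm n s psi = sqrt (\<Sum>x\<in>idx n s. (cmod (psi x))\<^sup>2)"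

text \<open>Uniform (normalized surface) measure on the unit sphere of C^n (x) C^s = R^(2ns),
  realised as the radial projection of the normalized Lebesgue measure on the unit ball
  (the cone-measure construction of the rotation-invariant probability on the sphere).\<close>

definition sphere_measure :: "nat \<Rightarrow> nat \<Rightarrow> ((nat \<times> nat) \<Rightarrow> complex) measure" where
  "sphere_measure n s =
     distr (uniform_measure (vec_space n s) {psi \<in> space (vec_space n s). vnorm n s psi \<le> 1})
           (vec_space n s)
           (\<lambda>psi. restrict (\<lambda>x. psi x / complex_of_real (vnorm n s psi)) (idx n s))"

text \<open>rho = tr_{C^s} |psi><psi|, an n x n matrix.\<close>

definition reduced_state :: "nat \<Rightarrow> nat \<Rightarrow> ((nat \<times> nat) \<Rightarrow> complex) \<Rightarrow> complex mat" where
  "reduced_state n s psi = mat n n (\<lambda>(p, q). \<Sum>k<s. psi (p, k) * cnj (psi (q, k)))"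

text \<open>C^(d^2) = C^d (x) C^d via the basis index p = i*d + j (i: first factor, j: second).
  Partial transpose on the second factor: (A^Gamma)_{(i,j),(i',j')} = A_{(i,j'),(i',j)}.\<close>

definition partial_transpose :: "nat \<Rightarrow> complex mat \<Rightarrow> complex mat" where
  "partial_transpose d A = mat (d * d) (d * d)
     (\<lambda>(p, q). A $$ ((p div d) * d + q mod d, (q div d) * d + p mod d))"

definition eig_count :: "complex mat \<Rightarrow> real set \<Rightarrow> nat" where
  "eig_count A S = (\<Sum>a\<in>{a. eigenvalue A a \<and> Im a = 0 \<and> Re a \<in> S}. order a (char_poly A))"

definition lambda_max :: "complex mat \<Rightarrow> real" where
  "lambda_max A = Max {Re a | a. eigenvalue A a}"

definition lambda_min :: "complex mat \<Rightarrow> real" where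
  "lambda_min A = Min {Re a | a. eigenvalue A a}"

definition semicircle_density :: "real \<Rightarrow> real \<Rightarrow> real \<Rightarrow> ennreal" where
  "semicircle_density a v x =
     ennreal (indicator {a - 2 * sqrt v .. a + 2 * sqrt v} x *
              sqrt (4 * v - (x - a)\<^sup>2) / (2 * pi * v))"

definition semicircle :: "real \<Rightarrow> real \<Rightarrow> real measure" where
  "semicircle a v = density lborel (semicircle_density a v)"

text \<open>X d is a random variable on the probability space M d; X d converges in probability to
  the constant c as d \<rightarrow> \<infinity>. Measurability of the relevant events (for d \<ge> 2) is required
  explicitly so that the statement cannot hold vacuously via non-measurable events.\<close>

definition conv_in_prob :: "(nat \<Rightarrow> 'a measure) \<Rightarrow> (nat \<Rightarrow> 'a \<Rightarrow> real) \<Rightarrow> real \<Rightarrow> bool" where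
  "conv_in_prob M X c \<longleftrightarrow>
     (\<forall>d\<ge>2. \<forall>e>0. {w \<in> space (M d). \<bar>X d w - c\<bar> > e} \<in> sets (M d)) \<and>
     (\<forall>e>0. (\<lambda>d. measure (M d) {w \<in> space (M d). \<bar>X d w - c\<bar> > e}) \<longlonglongrightarrow> 0)"

end

theory Submission
  imports Defs "Jordan_Normal_Form.Schur_Decomposition" "HOL-Real_Asymp.Real_Asymp" "HOL-Combinatorics.Permutations"
begin

text \<open>A uniform point of the sphere is a normalized complex Gaussian vector \<open>x\<close>. Let
  \<open>n = d\<^sup>2\<close> and let \<open>A\<close> be the partial transpose built from
  \<open>x\<close>. Up to the factor \<open>ns / |x|\<^sup>2\<close>, which tends to 1 by
  Chebyshev's inequality, \<open>n\<close> times the random matrix of the theorem equals \<open>1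
  + sqrt (n / s) H\<close> with \<open>H = (A - s) / sqrt (n s)\<close>, so it suffices to show
  that the spectrum of \<open>H\<close> approaches the standard semicircular distribution on
  \<open>[-2, 2]\<close>, without outliers.

  Let \<open>U\<^sub>p\<close> be the Chebyshev polynomials orthogonal for that distribution.
  Writing \<open>tr U\<^sub>p(H)\<close> as a sum over closed walks and applying Wick's formula,
  the three-term recursion cancels all pairings that match a step with itself or with a neighbour.
  Every remaining permutation forces so many coincidences among the indices that it contributes a
  factor \<open>d powr (- c)\<close> per defect, where \<open>c > 0\<close> is fixed, and a
  permutation is determined by what happens at its defects; hence \<open>E (tr
  U\<^sub>p(H))\<close> is much smaller than \<open>d\<^sup>2\<close> even for
  \<open>p\<close> of order \<open>ln d\<close>, which excludes outliers by Markov's inequality.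
  The same count on two circles bounds \<open>E (tr U\<^sub>p(H))\<^sup>2\<close> for fixed
  \<open>p\<close>, which gives the convergence of the spectral distribution; as the semicircle
  charges every neighbourhood of its edges, the extreme eigenvalues follow.\<close>

subsection \<open>Counting compatible labelings\<close>

text \<open>Ordinary traces of powers would carry the Catalan many noncrossing pairings as a main
  term that has to be computed; with Chebyshev polynomials no main term is left, so crude upper
  bounds suffice, and these polynomials grow exponentially in the degree only outside [-2, 2]. Let
  \<gamma> be the cyclic successor on the steps of a walk. The partial transposition makes a
  permutation \<sigma> tie the first halves of the vertices along \<gamma>\<sigma>, the second
  halves along \<sigma>\<gamma>^(-1) and the environment indices along \<sigma>. The obstacle is to
  bound the two kinds of halves together. Counting them separately rewards defects, but loses a
  factor for every point in a cycle of \<sigma> longer than 2. Counting them jointly gives d^(p + 2)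
  for every \<sigma>, without loss and without reward. A geometric mean giving the separate count
  only weight 1/8 loses d^(1/8) per long point, less than the d^(-1/4) that the environment gains
  there once s is at least d^(3/2). What remains is d^(-1/8) per circle and d^(-1/48) per free point
  of \<sigma>. Half of the latter exponent is the 1/96 of the final bounds: a free point pays for
  its own code entry and for one announcement of a run.\<close>

lemma card_labelings_le:
  fixes F :: "('t \<Rightarrow> 'b) set"
  assumes S: "finite S" and D: "finite D" "D \<noteq> {}" and F: "F \<subseteq> S \<rightarrow>\<^sub>E D"
    and c: "\<And>t. t \<in> S \<Longrightarrow> \<exists>U. finite U \<and> U \<subseteq> S \<and> (\<forall>u\<in>U. \<forall>f\<in>F. f u = f t) \<and> c t \<le> real (card U)"
    and c0: "\<And>t. t \<in> S \<Longrightarrow> 0 < c t"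
  shows "real (card F) \<le> real (card D) powr (\<Sum>t\<in>S. 1 / c t)"
proof -
  \<comment> \<open>The positions on which all labelings in \<open>F\<close> agree form classes. A
    labeling is determined by one value per class, so it suffices to bound the number of
    classes.\<close>
  define R where "R = {(t, u). t \<in> S \<and> u \<in> S \<and> (\<forall>f\<in>F. f t = f u)}"
  define Q where "Q = (\<lambda>t. R `` {t}) ` S"
  have fQ: "finite Q" unfolding Q_def using S by simp
  have cls: "R `` {t} = {u \<in> S. \<forall>f\<in>F. f u = f t}" if "t \<in> S" for t
    using that unfolding R_def by auto
  have fcls: "finite (R `` {t})" for t
    by (rule finite_subset[OF _ S]) (auto simp: R_def)
  have inC: "t \<in> R `` {t}" if "t \<in> S" for t using that by (auto simp: R_def)
  have eqC: "R `` {t} = R `` {u}" if "u \<in> R `` {t}" for t u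
    using that by (auto simp: R_def) metis
  define rep where "rep C = (SOME t. t \<in> C)" for C :: "'t set"
  have rep: "rep C \<in> C" if "C \<in> Q" for C
    unfolding rep_def by (rule someI_ex) (use that inC in \<open>auto simp: Q_def\<close>)
  have "inj_on (\<lambda>f. restrict (\<lambda>C. f (rep C)) Q) F"
  proof (rule inj_onI)
    fix f g assume f: "f \<in> F" and g: "g \<in> F"
      and eq: "restrict (\<lambda>C. f (rep C)) Q = restrict (\<lambda>C. g (rep C)) Q"
    show "f = g"
    proof (rule PiE_ext)
      show "f \<in> S \<rightarrow>\<^sub>E D" "g \<in> S \<rightarrow>\<^sub>E D" using F f g by auto
      fix t assume t: "t \<in> S"
      let ?C = "R `` {t}"
      have C: "?C \<in> Q" using t by (auto simp: Q_def)
      have "rep ?C \<in> ?C" by (rule rep[OF C])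
      then have "f (rep ?C) = f t" "g (rep ?C) = g t" using f g by (auto simp: R_def)
      moreover have "f (rep ?C) = g (rep ?C)" using fun_cong[OF eq, of ?C] C by simp
      ultimately show "f t = g t" by simp
    qed
  qed
  moreover have "(\<lambda>f. restrict (\<lambda>C. f (rep C)) Q) ` F \<subseteq> Q \<rightarrow>\<^sub>E D"
  proof (rule image_subsetI)
    fix f assume f: "f \<in> F"
    have "f (rep C) \<in> D" if C: "C \<in> Q" for C
    proof -
      have "C \<subseteq> S" using C by (auto simp: Q_def R_def)
      then have "rep C \<in> S" using rep[OF C] by auto
      then show ?thesis using F f by auto
    qed
    then show "restrict (\<lambda>C. f (rep C)) Q \<in> Q \<rightarrow>\<^sub>E D" by (simp add: restrict_PiE_iff)
  qed
  moreover have "finite (Q \<rightarrow>\<^sub>E D)" using fQ D by (simp add: finite_PiE)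
  ultimately have "card F \<le> card (Q \<rightarrow>\<^sub>E D)" by (rule card_inj_on_le)
  also have "\<dots> = card D ^ card Q" using fQ by (simp add: card_PiE)
  finally have 1: "real (card F) \<le> real (card D) ^ card Q"
    by (metis of_nat_le_iff of_nat_power)
  \<comment> \<open>Weighting each position by the reciprocal of the size of its class gives every
    class weight 1. The number of classes thus becomes a sum over positions, to which the pointwise
    bounds \<open>c\<close> apply.\<close>
  have "real (card Q) = (\<Sum>C\<in>Q. \<Sum>t\<in>{t\<in>S. R `` {t} = C}. 1 / real (card (R `` {t})))"
  proof -
    have "(\<Sum>t\<in>{t\<in>S. R `` {t} = C}. 1 / real (card (R `` {t}))) = 1" if C: "C \<in> Q" for C
    proof -
      have "{t\<in>S. R `` {t} = C} = C"
        using C eqC inC by (auto simp: Q_def R_def)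
      moreover have "card C \<noteq> 0"
      proof -
        obtain t where t: "t \<in> S" "C = R `` {t}" using C by (auto simp: Q_def)
        then have "C \<noteq> {}" "finite C" using inC[OF t(1)] fcls by auto
        then show ?thesis by simp
      qed
      moreover have "(\<Sum>t\<in>{t\<in>S. R `` {t} = C}. 1 / real (card (R `` {t})))
           = (\<Sum>t\<in>{t\<in>S. R `` {t} = C}. 1 / real (card C))" by (rule sum.cong) auto
      ultimately show ?thesis by simp
    qed
    then have "(\<Sum>C\<in>Q. \<Sum>t\<in>{t\<in>S. R `` {t} = C}. 1 / real (card (R `` {t}))) = (\<Sum>C\<in>Q. 1)"
      by (rule sum.cong[OF refl])
    then show ?thesis by simp
  qed
  also have "\<dots> = (\<Sum>t\<in>S. 1 / real (card (R `` {t})))"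
    by (rule sum.group) (use S fQ in \<open>auto simp: Q_def\<close>)
  also have "\<dots> \<le> (\<Sum>t\<in>S. 1 / c t)"
  proof (rule sum_mono)
    fix t assume t: "t \<in> S"
    obtain U where U: "finite U" "U \<subseteq> S" "\<forall>u\<in>U. \<forall>f\<in>F. f u = f t" "c t \<le> real (card U)"
      using c[OF t] by blast
    have "U \<subseteq> R `` {t}" using U cls[OF t] by auto
    then have "card U \<le> card (R `` {t})" by (rule card_mono[OF fcls])
    then have "c t \<le> real (card (R `` {t}))" using U by linarith
    then show "1 / real (card (R `` {t})) \<le> 1 / c t" using c0[OF t] by (intro divide_left_mono) auto
  qed
  finally have 2: "real (card Q) \<le> (\<Sum>t\<in>S. 1 / c t)" .
  have D1: "1 \<le> real (card D)" using D by (simp add: Suc_le_eq card_gt_0_iff)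
  have "real (card D) ^ card Q = real (card D) powr real (card Q)"
    using D1 by (simp add: powr_realpow)
  also have "\<dots> \<le> real (card D) powr (\<Sum>t\<in>S. 1 / c t)"
    using 2 D1 by (rule powr_mono)
  finally show ?thesis using 1 by linarith
qed

text \<open>A pair \<open>(i, j)\<close> is encoded by the differences \<open>i (\<gamma> t) - j t\<close> modulo \<open>d\<close> and the values
  \<open>i (\<gamma> t)\<close> for \<open>t \<in> T\<close>: if two pairs have the same code, the constraints make the set where
  they agree invariant under \<open>\<gamma> \<circ> \<gamma>\<close>.\<close>

lemma card_index_pairs_le:
  fixes \<gamma> \<sigma> :: "'t \<Rightarrow> 't"
  assumes S: "finite S" and g: "\<gamma> permutes S" and s: "\<sigma> permutes S" and T: "T \<subseteq> S"
    and gen: "\<And>Z. T \<subseteq> Z \<Longrightarrow> (\<And>t. t \<in> S \<Longrightarrow> t \<in> Z \<longleftrightarrow> \<gamma> (\<gamma> t) \<in> Z) \<Longrightarrow> S \<subseteq> Z"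
  shows "card {(i, j). i \<in> S \<rightarrow>\<^sub>E {..<d::nat} \<and> j \<in> S \<rightarrow>\<^sub>E {..<d} \<and>
            (\<forall>t\<in>S. i t = i (\<gamma> (\<sigma> t)) \<and> j (\<gamma> t) = j (\<sigma> t))} \<le> d ^ (card S + card T)"
    (is "card ?P \<le> _")
proof -
  define F where "F = (\<lambda>(i::'t\<Rightarrow>nat, j::'t\<Rightarrow>nat).
     (restrict (\<lambda>t. (i (\<gamma> t) + (d - j t)) mod d) S, restrict (\<lambda>t. i (\<gamma> t)) T))"
  have gS: "\<gamma> t \<in> S" if "t \<in> S" for t using permutes_in_image[OF g] that by simp
  have sS: "\<sigma> t \<in> S" if "t \<in> S" for t using permutes_in_image[OF s] that by simp
  have finT: "finite T" using S T finite_subset by auto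
  have "inj_on F ?P"
  proof (rule inj_onI, clarify)
    fix i j i' j' assume ij: "i \<in> S \<rightarrow>\<^sub>E {..<d}" "j \<in> S \<rightarrow>\<^sub>E {..<d}" "i' \<in> S \<rightarrow>\<^sub>E {..<d}" "j' \<in> S \<rightarrow>\<^sub>E {..<d}"
      and c: "\<forall>t\<in>S. i t = i (\<gamma> (\<sigma> t)) \<and> j (\<gamma> t) = j (\<sigma> t)"
      and c': "\<forall>t\<in>S. i' t = i' (\<gamma> (\<sigma> t)) \<and> j' (\<gamma> t) = j' (\<sigma> t)"
      and eq: "F (i, j) = F (i', j')"
    define Z where "Z = {t\<in>S. i (\<gamma> t) = i' (\<gamma> t)}"
    have lt: "i t < d" "j t < d" "i' t < d" "j' t < d" if "t \<in> S" for t using ij that by auto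
    have m: "(i (\<gamma> t) + (d - j t)) mod d = (i' (\<gamma> t) + (d - j' t)) mod d" if t: "t \<in> S" for t
    proof -
      have "restrict (\<lambda>t. (i (\<gamma> t) + (d - j t)) mod d) S = restrict (\<lambda>t. (i' (\<gamma> t) + (d - j' t)) mod d) S"
        using eq by (simp add: F_def)
      from fun_cong[OF this, of t] show ?thesis using t by simp
    qed
    \<comment> \<open>Equal codes fix the difference modulo \<open>d\<close>, so agreement of the
      \<open>i\<close> values at \<open>\<gamma> t\<close> is the same as agreement of the
      \<open>j\<close> values at \<open>t\<close>; labels below \<open>d\<close> are determined by
      their residues.\<close>
    have Zj: "t \<in> Z \<longleftrightarrow> j t = j' t" if t: "t \<in> S" for t
    proof -
      have l: "i (\<gamma> t) < d" "i' (\<gamma> t) < d" "j t < d" "j' t < d" using lt gS t by auto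
      have "int ((i (\<gamma> t) + (d - j t)) mod d) = int ((i' (\<gamma> t) + (d - j' t)) mod d)" using m[OF t] by simp
      then have "(int (i (\<gamma> t)) + (int d - int (j t))) mod int d = (int (i' (\<gamma> t)) + (int d - int (j' t))) mod int d"
        using l by (simp add: zmod_int of_nat_diff add_diff_eq)
      then have "int d dvd (int (i (\<gamma> t)) + (int d - int (j t))) - (int (i' (\<gamma> t)) + (int d - int (j' t)))"
        by (simp add: mod_eq_dvd_iff)
      then have dv: "int d dvd (int (i (\<gamma> t)) - int (j t)) - (int (i' (\<gamma> t)) - int (j' t))"
        by (simp add: algebra_simps)
      have small: "x = y" if "int d dvd int x - int y" "x < d" "y < d" for x y
      proof (rule ccontr)
        assume "x \<noteq> y"
        then have "\<bar>int d\<bar> \<le> \<bar>int x - int y\<bar>" using that by (intro dvd_imp_le_int) auto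
        then show False using that by linarith
      qed
      show ?thesis
      proof
        assume "t \<in> Z"
        then have "int d dvd int (j' t) - int (j t)" using dv by (simp add: Z_def)
        then show "j t = j' t" using small l by metis
      next
        assume "j t = j' t"
        then have "int d dvd int (i (\<gamma> t)) - int (i' (\<gamma> t))" using dv by (simp)
        then show "t \<in> Z" using small l t by (auto simp: Z_def)
      qed
    qed
    \<comment> \<open>The \<open>i\<close> constraint carries agreement from \<open>?u\<close> to
      \<open>\<gamma> (\<sigma> ?u)\<close>, \<open>Zj\<close> turns it into agreement of
      \<open>j\<close> at \<open>\<sigma> ?u\<close>, the \<open>j\<close> constraint carries that
      to \<open>\<gamma> ?u\<close>, and \<open>Zj\<close> turns it back. The dependence on \<sigma>
      cancels and a shift by two remains.\<close>
    have cl: "t \<in> Z \<longleftrightarrow> \<gamma> (\<gamma> t) \<in> Z" if t: "t \<in> S" for t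
    proof -
      let ?u = "\<gamma> t"
      have u: "?u \<in> S" using gS t by auto
      have "t \<in> Z \<longleftrightarrow> i ?u = i' ?u" using t by (simp add: Z_def)
      also have "\<dots> \<longleftrightarrow> \<sigma> ?u \<in> Z" using c c' u sS by (auto simp: Z_def)
      also have "\<dots> \<longleftrightarrow> j (\<sigma> ?u) = j' (\<sigma> ?u)" using Zj sS u by auto
      also have "\<dots> \<longleftrightarrow> j (\<gamma> ?u) = j' (\<gamma> ?u)" using c c' u by auto
      also have "\<dots> \<longleftrightarrow> \<gamma> ?u \<in> Z" using Zj gS u by auto
      finally show ?thesis .
    qed
    have TZ: "T \<subseteq> Z"
    proof
      fix t assume t: "t \<in> T"
      have "restrict (\<lambda>t. i (\<gamma> t)) T = restrict (\<lambda>t. i' (\<gamma> t)) T" using eq by (simp add: F_def)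
      from fun_cong[OF this, of t] show "t \<in> Z" using t T by (auto simp: Z_def)
    qed
    have SZ: "S \<subseteq> Z" by (rule gen[OF TZ cl])
    have "j = j'" by (rule PiE_ext[OF ij(2) ij(4)]) (use SZ Zj in auto)
    moreover have "i = i'"
    proof (rule PiE_ext[OF ij(1) ij(3)])
      fix t assume t: "t \<in> S"
      obtain u where "u \<in> S" "t = \<gamma> u" using t permutes_image[OF g] by blast
      then show "i t = i' t" using SZ by (auto simp: Z_def)
    qed
    ultimately show "i = i' \<and> j = j'" by simp
  qed
  moreover have "F ` ?P \<subseteq> (S \<rightarrow>\<^sub>E {..<d}) \<times> (T \<rightarrow>\<^sub>E {..<d})"
  proof (rule image_subsetI, clarify)
    fix i j assume a: "i \<in> S \<rightarrow>\<^sub>E {..<d}" "j \<in> S \<rightarrow>\<^sub>E {..<d}"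
    have "(i (\<gamma> t) + (d - j t)) mod d < d" if "t \<in> S" for t
    proof -
      have "i t < d" using a that by auto
      then show ?thesis by simp
    qed
    moreover have "i (\<gamma> t) < d" if "t \<in> T" for t using a that T gS by auto
    ultimately show "F (i, j) \<in> (S \<rightarrow>\<^sub>E {..<d}) \<times> (T \<rightarrow>\<^sub>E {..<d})"
      by (auto simp: F_def)
  qed
  moreover have "finite ((S \<rightarrow>\<^sub>E {..<d}) \<times> (T \<rightarrow>\<^sub>E {..<d}))" using S finT by (simp add: finite_PiE)
  ultimately have "card ?P \<le> card ((S \<rightarrow>\<^sub>E {..<d}) \<times> (T \<rightarrow>\<^sub>E {..<d}))" by (rule card_inj_on_le)
  also have "\<dots> = d ^ (card S + card T)"
    using S finT by (simp add: card_cartesian_product card_PiE power_add)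
  finally show ?thesis .
qed

lemma card_3: "a \<noteq> b \<Longrightarrow> b \<noteq> c \<Longrightarrow> a \<noteq> c \<Longrightarrow> card {a, b, c} = 3" by simp

text \<open>The two bounds on the number of pairs \<open>(i, j)\<close> are interpolated with weights 7/8 and 1/8.\<close>

lemma card_index_triples_le:
  fixes \<gamma> \<sigma> :: "'t \<Rightarrow> 't" and d s :: nat
  assumes S: "finite S" and g: "\<gamma> permutes S" and s: "\<sigma> permutes S" and T: "T \<subseteq> S"
    and gen: "\<And>Z. T \<subseteq> Z \<Longrightarrow> (\<And>t. t \<in> S \<Longrightarrow> t \<in> Z \<longleftrightarrow> \<gamma> (\<gamma> t) \<in> Z) \<Longrightarrow> S \<subseteq> Z"
    and cT: "card T \<le> 2 * C" and W: "finite W" "card W \<le> C"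
    and nofix: "\<And>t. t \<in> S \<Longrightarrow> \<sigma> t \<noteq> t"
    and noadj: "\<And>t. t \<in> S \<Longrightarrow> t \<notin> W \<Longrightarrow> \<sigma> t = \<gamma> t \<Longrightarrow> \<sigma> (\<gamma> t) \<noteq> t"
    and d1: "1 \<le> d" and ds: "real d powr (3/2) \<le> real s"
  defines "L \<equiv> {t\<in>S. \<sigma> (\<sigma> t) \<noteq> t}"
    and "Q \<equiv> {t\<in>S. \<gamma> (\<sigma> t) \<noteq> t \<and> \<gamma> (\<sigma> (\<gamma> (\<sigma> t))) \<noteq> t}"
  shows "real (card {(i, j, k). i \<in> S \<rightarrow>\<^sub>E {..<d} \<and> j \<in> S \<rightarrow>\<^sub>E {..<d} \<and> k \<in> S \<rightarrow>\<^sub>E {..<s} \<and>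
            (\<forall>t\<in>S. i t = i (\<gamma> (\<sigma> t)) \<and> j (\<gamma> t) = j (\<sigma> t) \<and> k t = k (\<sigma> t))})
     \<le> real s powr (card S / 2) * real d powr (card S + 2 * C - C / 8 - card L / 8 - card Q / 48)"
    (is "real (card ?P) \<le> _")
proof -
  define Is where "Is = {i \<in> S \<rightarrow>\<^sub>E {..<d}. \<forall>t\<in>S. i t = i (\<gamma> (\<sigma> t))}"
  define Js where "Js = {j \<in> S \<rightarrow>\<^sub>E {..<d}. \<forall>t\<in>S. j (\<gamma> t) = j (\<sigma> t)}"
  define Ks where "Ks = {k \<in> S \<rightarrow>\<^sub>E {..<s}. \<forall>t\<in>S. k t = k (\<sigma> t)}"
  have gS: "\<gamma> t \<in> S" if "t \<in> S" for t using permutes_in_image[OF g] that by simp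
  have sS: "\<sigma> t \<in> S" if "t \<in> S" for t using permutes_in_image[OF s] that by simp
  have ginj: "\<gamma> t = \<gamma> u \<longleftrightarrow> t = u" for t u using permutes_inj[OF g] by (auto simp: inj_eq)
  have sinj: "\<sigma> t = \<sigma> u \<longleftrightarrow> t = u" for t u using permutes_inj[OF s] by (auto simp: inj_eq)
  have fin: "finite Is" "finite Js" "finite Ks" unfolding Is_def Js_def Ks_def
    using S by (auto simp: finite_PiE)
  have dd: "1 \<le> real d" using d1 by simp
  have "real d powr (3/2) \<ge> 1" using dd by (simp add: ge_one_powr_ge_zero)
  then have s1: "1 \<le> real s" using ds by linarith
  have LS: "L \<subseteq> S" and QS: "Q \<subseteq> S" by (auto simp: L_def Q_def)
  have finL: "finite L" "finite Q" using LS QS S finite_subset by auto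
  have sumind: "(\<Sum>t\<in>S. (if t \<in> X then c else 0)) = real (card X) * c" if "X \<subseteq> S" for X and c :: real
    using S that by (simp add: sum.If_cases Int_absorb1)
  \<comment> \<open>\<open>k\<close> is constant on the cycles of \<sigma>. Without fixed points
    each has length at least 2, and at least 3 on \<open>L\<close>; the saving 1/6 is 1/2 -
    1/3.\<close>
  have K: "real (card Ks) \<le> real s powr (card S / 2 - card L / 6)"
  proof -
    have "real (card Ks) \<le> real (card {..<s}) powr (\<Sum>t\<in>S. 1 / (if t \<in> L then 3 else 2))"
    proof (rule card_labelings_le)
      fix t assume t: "t \<in> S"
      show "\<exists>U. finite U \<and> U \<subseteq> S \<and> (\<forall>u\<in>U. \<forall>f\<in>Ks. f u = f t) \<and> (if t \<in> L then 3 else 2) \<le> real (card U)"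
      proof (cases "t \<in> L")
        case True
        have "card {t, \<sigma> t, \<sigma> (\<sigma> t)} = 3"
          by (rule card_3) (use True nofix[OF t] nofix[OF sS[OF t]] in \<open>auto simp: L_def\<close>)
        then show ?thesis using True t sS by (intro exI[of _ "{t, \<sigma> t, \<sigma> (\<sigma> t)}"]) (auto simp: Ks_def)
      next
        case False
        then show ?thesis using t sS nofix[OF t] by (intro exI[of _ "{t, \<sigma> t}"]) (auto simp: Ks_def)
      qed
    qed (use S s1 in \<open>auto simp: Ks_def lessThan_empty_iff\<close>)
    also have "(\<Sum>t\<in>S. 1 / (if t \<in> L then 3 else 2)) = (\<Sum>t\<in>S. 1/2 - (if t \<in> L then 1/6 else (0::real)))"
      by (rule sum.cong) auto
    also have "\<dots> = card S / 2 - card L / 6" using sumind[OF LS] by (simp add: sum_subtractf)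
    finally show ?thesis by simp
  qed
  define FA where "FA = {t\<in>S. \<gamma> (\<sigma> t) = t}"
  define FB where "FB = {t\<in>S. \<sigma> t = \<gamma> t}"
  have FS: "FA \<subseteq> S" "FB \<subseteq> S" by (auto simp: FA_def FB_def)
  \<comment> \<open>\<open>i\<close> is constant on the cycles of \<gamma>\<sigma>: its fixed points
    \<open>FA\<close> cost an extra 1/2, while points of \<open>Q\<close> lie in cycles of length at
    least 3 and save 1/6.\<close>
  have I: "real (card Is) \<le> real d powr (card S / 2 + card FA / 2 - card Q / 6)"
  proof -
    have "real (card Is) \<le> real (card {..<d}) powr (\<Sum>t\<in>S. 1 / (if t \<in> FA then 1 else if t \<in> Q then 3 else 2))"
    proof (rule card_labelings_le)
      fix t assume t: "t \<in> S"
      let ?A = "\<lambda>t. \<gamma> (\<sigma> t)"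
      show "\<exists>U. finite U \<and> U \<subseteq> S \<and> (\<forall>u\<in>U. \<forall>f\<in>Is. f u = f t) \<and>
           (if t \<in> FA then 1 else if t \<in> Q then 3 else 2) \<le> real (card U)"
      proof (cases "t \<in> FA")
        case True
        then show ?thesis using t by (intro exI[of _ "{t}"]) auto
      next
        case nA: False
        show ?thesis
        proof (cases "t \<in> Q")
          case True
          have "card {t, ?A t, ?A (?A t)} = 3"
            by (rule card_3) (use True in \<open>auto simp: Q_def ginj sinj\<close>)
          moreover have "?A t \<in> S" "?A (?A t) \<in> S" using t sS gS by auto
          ultimately show ?thesis using True nA t by (intro exI[of _ "{t, ?A t, ?A (?A t)}"]) (auto simp: Is_def)
        next
          case False
          then show ?thesis using nA t sS gS by (intro exI[of _ "{t, ?A t}"]) (auto simp: Is_def FA_def)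
        qed
      qed
    qed (use S d1 in \<open>auto simp: Is_def lessThan_empty_iff\<close>)
    also have "(\<Sum>t\<in>S. 1 / (if t \<in> FA then 1 else if t \<in> Q then 3 else 2)) =
       (\<Sum>t\<in>S. 1/2 + (if t \<in> FA then 1/2 else (0::real)) - (if t \<in> Q then 1/6 else (0::real)))"
      by (rule sum.cong) (auto simp: FA_def Q_def)
    also have "\<dots> = card S / 2 + card FA / 2 - card Q / 6" using sumind[OF QS] sumind[OF FS(1)]
      by (simp add: sum_subtractf sum.distrib)
    finally show ?thesis by simp
  qed
  \<comment> \<open>\<open>\<gamma> t\<close> and \<open>\<sigma> t\<close> carry the same value of
    \<open>j\<close> and are distinct positions unless \<open>t\<close> lies in \<open>FB\<close>;
    the sum over positions is therefore reindexed by \<gamma>.\<close>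
  have J: "real (card Js) \<le> real d powr (card S / 2 + card FB / 2)"
  proof -
    have bij: "bij_betw \<gamma> S S" using g by (rule permutes_imp_bij)
    let ?c = "\<lambda>w. if inv_into UNIV \<gamma> w \<in> FB then 1 else (2::real)"
    have "real (card Js) \<le> real (card {..<d}) powr (\<Sum>t\<in>S. 1 / ?c t)"
    proof (rule card_labelings_le)
      fix w assume w: "w \<in> S"
      obtain t where t: "t \<in> S" "w = \<gamma> t" using w permutes_image[OF g] by blast
      have iv: "inv_into UNIV \<gamma> w = t" using t permutes_inverses[OF g] by simp
      show "\<exists>U. finite U \<and> U \<subseteq> S \<and> (\<forall>u\<in>U. \<forall>f\<in>Js. f u = f w) \<and> ?c w \<le> real (card U)"
      proof (cases "t \<in> FB")
        case True
        then show ?thesis using w iv by (intro exI[of _ "{w}"]) auto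
      next
        case False
        then have "\<sigma> t \<noteq> \<gamma> t" using t by (auto simp: FB_def)
        then show ?thesis using t w iv False sS gS
          by (intro exI[of _ "{\<gamma> t, \<sigma> t}"]) (auto simp: Js_def)
      qed
    qed (use S d1 in \<open>auto simp: Js_def lessThan_empty_iff\<close>)
    also have "(\<Sum>w\<in>S. 1 / ?c w) = (\<Sum>t\<in>S. 1 / ?c (\<gamma> t))"
      by (rule sum.reindex_bij_betw[OF bij, symmetric])
    also have "\<dots> = (\<Sum>t\<in>S. 1/2 + (if t \<in> FB then 1/2 else (0::real)))"
      by (rule sum.cong) (auto simp: permutes_inverses[OF g])
    also have "\<dots> = card S / 2 + card FB / 2" using sumind[OF FS(2)]
      by (simp add: sum.distrib)
    finally show ?thesis by simp
  qed
  \<comment> \<open>On a 2-cycle of \<sigma>, a fixed point of \<gamma>\<sigma> or a coincidence of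
    \<sigma> with \<gamma> means that the 2-cycle joins two neighbours. By \<open>noadj\<close> this
    happens only at \<open>W\<close>; all other such points belong to \<open>L\<close>.\<close>
  have FAB: "card FA + card FB \<le> 2 * card L + 2 * C"
  proof -
    have "FB \<subseteq> L \<union> W" using noadj by (auto simp: FB_def L_def)
    then have "card FB \<le> card L + C"
      by (meson W(1,2) card_Un_le card_mono finL(1) finite_UnI le_trans nat_add_left_cancel_le)
    moreover have "FA \<subseteq> L \<union> \<gamma> ` W"
    proof
      fix t assume t: "t \<in> FA"
      show "t \<in> L \<union> \<gamma> ` W"
      proof (cases "t \<in> L")
        case False
        let ?v = "\<sigma> t"
        have "?v \<in> S" "\<gamma> ?v = t" "\<sigma> ?v = t" using t False sS by (auto simp: FA_def L_def)
        then have "?v \<in> W" using noadj[of ?v] by auto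
        then show ?thesis using \<open>\<gamma> ?v = t\<close> by (metis UnI2 imageI)
      qed auto
    qed
    then have "card FA \<le> card L + C"
      by (meson W(1,2) card_Un_le card_image_le card_mono finL(1) finite_UnI finite_imageI le_trans nat_add_left_cancel_le)
    ultimately show ?thesis by simp
  qed
  define IJ where "IJ = {(i, j). i \<in> S \<rightarrow>\<^sub>E {..<d::nat} \<and> j \<in> S \<rightarrow>\<^sub>E {..<d} \<and>
            (\<forall>t\<in>S. i t = i (\<gamma> (\<sigma> t)) \<and> j (\<gamma> t) = j (\<sigma> t))}"
  have IJsub: "IJ \<subseteq> Is \<times> Js" by (auto simp: IJ_def Is_def Js_def)
  have finIJ: "finite IJ" using IJsub fin finite_subset by blast
  have "?P \<subseteq> (\<lambda>((i, j), k). (i, j, k)) ` (IJ \<times> Ks)"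
    by (auto simp: IJ_def Ks_def image_iff)
  then have "card ?P \<le> card (IJ \<times> Ks)"
    by (meson card_image_le card_mono finIJ fin(3) finite_SigmaI finite_imageI le_trans)
  also have "\<dots> = card IJ * card Ks" by (simp add: card_cartesian_product)
  finally have P: "real (card ?P) \<le> real (card IJ) * real (card Ks)"
    by (simp flip: of_nat_mult)
  \<comment> \<open>The exponents of \<open>d\<close> in the joint and in the separate count: the
    first ignores \<open>L\<close> and \<open>Q\<close>, the second gets worse with \<open>L\<close>
    and better with \<open>Q\<close>.\<close>
  define E1 where "E1 = real (card S) + 2 * real C"
  define E2 where "E2 = real (card S) + real (card L) + real C - card Q / 6"
  have "card IJ \<le> d ^ (card S + card T)" unfolding IJ_def
    by (rule card_index_pairs_le[OF S g s T gen])
  also have "\<dots> \<le> d ^ (card S + 2 * C)" using d1 cT by (intro power_increasing) auto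
  finally have "real (card IJ) \<le> real d ^ (card S + 2 * C)"
    by (metis of_nat_le_iff of_nat_power)
  also have "\<dots> = real d powr E1" using d1 by (simp add: powr_realpow[symmetric] E1_def)
  finally have IJ1: "real (card IJ) \<le> real d powr E1" .
  have "card IJ \<le> card (Is \<times> Js)" using IJsub fin by (intro card_mono) auto
  then have "real (card IJ) \<le> real (card Is) * real (card Js)"
    by (metis card_cartesian_product of_nat_le_iff of_nat_mult)
  also have "\<dots> \<le> real d powr (card S / 2 + card FA / 2 - card Q / 6) * real d powr (card S / 2 + card FB / 2)"
    by (intro mult_mono I J) auto
  also have "\<dots> = real d powr (card S + (card FA + card FB) / 2 - card Q / 6)"
    unfolding powr_add[symmetric] by (rule arg_cong[of _ _ "\<lambda>x. real d powr x"]) (simp add: field_simps)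
  also have "\<dots> \<le> real d powr E2"
    using FAB dd by (intro powr_mono) (auto simp: E2_def)
  finally have IJ2: "real (card IJ) \<le> real d powr E2" .
  have "real (card IJ) \<le> real d powr (7/8 * E1 + 1/8 * E2)"
  proof (cases "E1 \<le> E2")
    case True
    then have "real d powr E1 \<le> real d powr (7/8 * E1 + 1/8 * E2)" using dd by (intro powr_mono) auto
    then show ?thesis using IJ1 by linarith
  next
    case False
    then have "real d powr E2 \<le> real d powr (7/8 * E1 + 1/8 * E2)" using dd by (intro powr_mono) auto
    then show ?thesis using IJ2 by linarith
  qed
  \<comment> \<open>The lower bound on \<open>s\<close> enters here: s^(-1/6) per point of
    \<open>L\<close> becomes d^(-1/4), twice what the interpolation loses there.\<close>
  moreover have "real (card Ks) \<le> real s powr (card S / 2) * real d powr (- card L / 4)"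
  proof -
    have "real s powr (- (card L / 6)) \<le> (real d powr (3/2)) powr (- (card L / 6))"
      using ds dd by (intro powr_mono2') auto
    also have "\<dots> = real d powr (- card L / 4)" by (simp add: powr_powr)
    finally have "real s powr (card S / 2) * real s powr (- (card L / 6)) \<le> real s powr (card S / 2) * real d powr (- card L / 4)"
      by (intro mult_left_mono) auto
    moreover have "real s powr (card S / 2) * real s powr (- (card L / 6)) = real s powr (card S / 2 - card L / 6)"
      by (simp add: powr_add[symmetric])
    ultimately show ?thesis using K by linarith
  qed
  ultimately have "real (card IJ) * real (card Ks) \<le>
     real d powr (7/8 * E1 + 1/8 * E2) * (real s powr (card S / 2) * real d powr (- card L / 4))"
    by (intro mult_mono) auto
  also have "\<dots> = real s powr (card S / 2) * (real d powr (7/8 * E1 + 1/8 * E2) * real d powr (- card L / 4))"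
    by (simp add: mult_ac)
  \<comment> \<open>Balance of exponents: a point of \<open>L\<close> counts 1/8 - 1/4, a point of
    \<open>Q\<close> counts -1/6 * 1/8, and the coefficient of \<open>C\<close> is 7/8 * 2 + 1/8 = 2
    - 1/8.\<close>
  also have "real d powr (7/8 * E1 + 1/8 * E2) * real d powr (- card L / 4) =
     real d powr (card S + 2 * C - C / 8 - card L / 8 - card Q / 48)"
    unfolding powr_add[symmetric] by (rule arg_cong[of _ _ "\<lambda>x. real d powr x"]) (simp add: E1_def E2_def field_simps)
  finally show ?thesis using P by linarith
qed

subsection \<open>Reduced permutations of a circle\<close>

text \<open>\<open>i\<close> and \<open>j\<close> are the two tensor components of the vertex at
  which a step starts, \<open>k\<close> is its environment index. The partial transposition is
  visible in the position of \<gamma>: without it the condition on \<open>j\<close> would read like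
  the one on \<open>i\<close>.\<close>

definition index_triples :: "'t set \<Rightarrow> ('t \<Rightarrow> 't) \<Rightarrow> ('t \<Rightarrow> 't) \<Rightarrow> nat \<Rightarrow> nat \<Rightarrow> (('t \<Rightarrow> nat) \<times> ('t \<Rightarrow> nat) \<times> ('t \<Rightarrow> nat)) set" where
  "index_triples S \<gamma> \<sigma> d s = {(i, j, k). i \<in> S \<rightarrow>\<^sub>E {..<d} \<and> j \<in> S \<rightarrow>\<^sub>E {..<d} \<and> k \<in> S \<rightarrow>\<^sub>E {..<s} \<and>
            (\<forall>t\<in>S. i t = i (\<gamma> (\<sigma> t)) \<and> j (\<gamma> t) = j (\<sigma> t) \<and> k t = k (\<sigma> t))}"

definition csucc :: "nat \<Rightarrow> nat \<Rightarrow> nat" where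
  "csucc p t = (if t < p then Suc t mod p else t)"

lemma csucc_permutes: "csucc p permutes {..<p}"
proof (rule bij_imp_permutes)
  have "inj_on (csucc p) {..<p}"
    by (rule inj_onI) (auto simp: csucc_def mod_Suc split: if_splits)
  moreover have "csucc p ` {..<p} \<subseteq> {..<p}" by (auto simp: csucc_def)
  ultimately show "bij_betw (csucc p) {..<p} {..<p}"
    by (simp add: bij_betw_def endo_inj_surj)
qed (auto simp: csucc_def)

lemma csucc_Suc: "Suc t < p \<Longrightarrow> csucc p t = Suc t"
  by (simp add: csucc_def)

text \<open>Neighbours are taken in the linear order: the last and the first position may be swapped
  with each other, because the recursion builds an open path that is closed only afterwards. The
  embedding \<open>e\<close> places several circles in one index type.\<close>

definition reduced_on :: "(nat \<Rightarrow> 't) \<Rightarrow> nat \<Rightarrow> ('t \<Rightarrow> 't) \<Rightarrow> bool" where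
  "reduced_on e p \<sigma> \<longleftrightarrow> (\<forall>t<p. \<sigma> (e t) \<noteq> e t) \<and> (\<forall>t. Suc t < p \<longrightarrow> \<not> (\<sigma> (e t) = e (Suc t) \<and> \<sigma> (e (Suc t)) = e t))"

definition long_pts :: "nat \<Rightarrow> (nat \<Rightarrow> nat) \<Rightarrow> nat set" where
  "long_pts p \<sigma> = {t. t < p \<and> \<sigma> (\<sigma> t) \<noteq> t}"

definition openers :: "nat \<Rightarrow> (nat \<Rightarrow> nat) \<Rightarrow> nat set" where
  "openers p \<sigma> = {t. t < p \<and> \<sigma> (\<sigma> t) = t \<and> t < \<sigma> t}"

text \<open>If \<open>t\<close> closes a 2-cycle and \<open>t - 1\<close> closes the one directly
  nested inside it, the partner of \<open>t\<close> is forced. The free points are the points of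
  long cycles and the closing points that do not continue such a nest.\<close>

definition free_pts :: "nat \<Rightarrow> (nat \<Rightarrow> nat) \<Rightarrow> nat set" where
  "free_pts p \<sigma> = {t. t < p \<and> (\<sigma> (\<sigma> t) \<noteq> t \<or>
      (\<sigma> t < t \<and> \<not> (\<sigma> (t - 1) = Suc (\<sigma> t) \<and> \<sigma> (\<sigma> (t - 1)) = t - 1)))}"

definition opener_starts :: "nat \<Rightarrow> (nat \<Rightarrow> nat) \<Rightarrow> nat set" where
  "opener_starts p \<sigma> = {t \<in> openers p \<sigma>. t = 0 \<or> t - 1 \<notin> openers p \<sigma>}"

context
  fixes p :: nat and \<sigma> :: "nat \<Rightarrow> nat"
  assumes perm: "\<sigma> permutes {..<p}" and red: "reduced_on (\<lambda>t. t) p \<sigma>"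
begin

lemma red_lt: "t < p \<Longrightarrow> \<sigma> t < p"
  using permutes_in_image[OF perm, of t] by simp

lemma red_nofix: "t < p \<Longrightarrow> \<sigma> t \<noteq> t"
  using red by (simp add: reduced_on_def)

lemma red_noadj: "Suc t < p \<Longrightarrow> \<sigma> t = Suc t \<Longrightarrow> \<sigma> (Suc t) = t \<Longrightarrow> False"
  using red by (auto simp: reduced_on_def)

lemma red_inj: "\<sigma> t = \<sigma> u \<longleftrightarrow> t = u"
  using permutes_inj[OF perm] by (auto simp: inj_eq)

text \<open>The point of the third case is that a continuing point never follows an opener:
  otherwise the predecessor would be matched with \<open>t\<close> itself, a swapped pair of
  neighbours. So its value can be read off from a value already known.\<close>

lemma point_cases:
  assumes "t < p"
  obtains (free) "t \<in> free_pts p \<sigma>" "t \<notin> openers p \<sigma>"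
  | (opn) "t \<in> openers p \<sigma>" "t \<notin> free_pts p \<sigma>"
  | (cont) "t \<notin> openers p \<sigma>" "t \<notin> free_pts p \<sigma>" "0 < t" "t - 1 \<notin> openers p \<sigma>"
      "\<sigma> (t - 1) = Suc (\<sigma> t)"
proof (cases "t \<in> free_pts p \<sigma>")
  case True
  then have "t \<notin> openers p \<sigma>" by (auto simp: free_pts_def openers_def)
  then show ?thesis using True free by blast
next
  case nf: False
  show ?thesis
  proof (cases "t \<in> openers p \<sigma>")
    case True then show ?thesis using nf opn by blast
  next
    case False
    have i: "\<sigma> (\<sigma> t) = t" using nf assms by (auto simp: free_pts_def)
    have lt: "\<sigma> t < t" using False i assms red_nofix[OF assms] by (auto simp: openers_def)
    then have c: "\<sigma> (t - 1) = Suc (\<sigma> t)" "\<sigma> (\<sigma> (t - 1)) = t - 1" using nf assms i by (auto simp: free_pts_def)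
    have "t - 1 \<notin> openers p \<sigma>"
    proof
      assume "t - 1 \<in> openers p \<sigma>"
      then have "t - 1 < \<sigma> (t - 1)" by (simp add: openers_def)
      then have "\<sigma> t = t - 1" "\<sigma> (t - 1) = t" using c lt by auto
      then show False using red_noadj[of "t - 1"] lt assms by simp
    qed
    then show ?thesis using cont False nf lt c by auto
  qed
qed

text \<open>A run of openers can only end at a free point or at the end of the circle, since
  continuing points do not follow openers; hence two runs are separated by a free point.\<close>

lemma card_opener_starts: "card (opener_starts p \<sigma>) \<le> card (free_pts p \<sigma>) + 1"
proof -
  \<comment> \<open>The extra term in this claim about prefixes pays for a run of openers that is
    still open at the end of the prefix.\<close>
  have "card (opener_starts p \<sigma> \<inter> {..<m}) \<le> card (free_pts p \<sigma> \<inter> {..<m}) + of_bool (0 < m \<and> m - 1 \<in> openers p \<sigma>)"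
    if "m \<le> p" for m
    using that
  proof (induction m)
    case (Suc m)
    have IH: "card (opener_starts p \<sigma> \<inter> {..<m}) \<le> card (free_pts p \<sigma> \<inter> {..<m}) + of_bool (0 < m \<and> m - 1 \<in> openers p \<sigma>)"
      using Suc by simp
    have ins: "card (X \<inter> {..<Suc m}) = card (X \<inter> {..<m}) + of_bool (m \<in> X)" for X :: "nat set"
      by (simp add: lessThan_Suc)
    have mp: "m < p" using Suc.prems by simp
    from mp show ?case
    proof (cases rule: point_cases)
      case free
      then have "m \<notin> opener_starts p \<sigma>" by (simp add: opener_starts_def)
      then show ?thesis using IH free unfolding ins by (simp add: of_bool_def split: if_splits)
    next
      case opn
      then have "m \<in> opener_starts p \<sigma> \<longleftrightarrow> \<not> (0 < m \<and> m - 1 \<in> openers p \<sigma>)" by (auto simp: opener_starts_def)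
      then show ?thesis using IH opn unfolding ins by (simp add: of_bool_def split: if_splits)
    next
      case cont
      then have "m \<notin> opener_starts p \<sigma>" by (simp add: opener_starts_def)
      then show ?thesis using IH cont unfolding ins by (simp add: of_bool_def split: if_splits)
    qed
  qed simp
  from this[OF order_refl] have "card (opener_starts p \<sigma> \<inter> {..<p}) \<le> card (free_pts p \<sigma> \<inter> {..<p}) + 1"
    by (simp add: of_bool_def split: if_splits)
  moreover have "opener_starts p \<sigma> \<inter> {..<p} = opener_starts p \<sigma>" "free_pts p \<sigma> \<inter> {..<p} = free_pts p \<sigma>"
    by (auto simp: opener_starts_def openers_def free_pts_def)
  ultimately show ?thesis by simp
qed

text \<open>Free points outside \<open>long_pts\<close> and outside the last set are charged
  injectively to long points. For such \<open>t\<close> the successor of \<open>\<sigma> t\<close>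
  is sent to \<open>t - 1\<close>; were it on a 2-cycle, \<open>t\<close> would continue a nest.
  Together with the free points that are long themselves this gives the factor 2.\<close>

lemma card_free_pts:
  "card (free_pts p \<sigma>) \<le> 2 * card (long_pts p \<sigma>) +
     card {t\<in>{..<p}. csucc p (\<sigma> t) \<noteq> t \<and> csucc p (\<sigma> (csucc p (\<sigma> t))) \<noteq> t}"
    (is "_ \<le> _ + card ?Q")
proof -
  let ?A = "\<lambda>t. csucc p (\<sigma> t)"
  define X where "X = {t \<in> free_pts p \<sigma>. t \<notin> long_pts p \<sigma> \<and> t \<notin> ?Q}"
  have fL: "finite (long_pts p \<sigma>)" by (simp add: long_pts_def)
  have "inj_on ?A X"
    by (rule inj_onI) (use permutes_inj[OF csucc_permutes] in \<open>auto simp: inj_eq red_inj\<close>)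
  moreover have "?A ` X \<subseteq> long_pts p \<sigma>"
  proof (rule image_subsetI)
    fix t assume t: "t \<in> X"
    have tp: "t < p" and i: "\<sigma> (\<sigma> t) = t" and lt: "\<sigma> t < t"
      and nc: "\<not> (\<sigma> (t - 1) = Suc (\<sigma> t) \<and> \<sigma> (\<sigma> (t - 1)) = t - 1)"
      using t by (auto simp: X_def free_pts_def long_pts_def)
    have u: "?A t = Suc (\<sigma> t)" using lt tp by (simp add: csucc_Suc)
    have "Suc (\<sigma> t) \<noteq> t"
    proof
      assume "Suc (\<sigma> t) = t"
      then show False using red_noadj[of "\<sigma> t"] i tp by simp
    qed
    then have "?A (?A t) = t" using t u tp by (auto simp: X_def)
    then have a: "csucc p (\<sigma> (Suc (\<sigma> t))) = t" using u by simp
    have l: "\<sigma> (Suc (\<sigma> t)) < p" using red_lt lt tp by simp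
    have su: "\<sigma> (Suc (\<sigma> t)) = t - 1"
      using a l lt by (auto simp: csucc_def mod_Suc split: if_splits)
    have "\<sigma> (\<sigma> (Suc (\<sigma> t))) \<noteq> Suc (\<sigma> t)" using nc su by auto
    then show "?A t \<in> long_pts p \<sigma>" using u lt tp by (simp add: long_pts_def)
  qed
  ultimately have X: "card X \<le> card (long_pts p \<sigma>)" using fL by (rule card_inj_on_le)
  have "free_pts p \<sigma> \<subseteq> long_pts p \<sigma> \<union> ?Q \<union> X" by (auto simp: X_def)
  then have "card (free_pts p \<sigma>) \<le> card (long_pts p \<sigma> \<union> ?Q \<union> X)"
    by (intro card_mono) (auto simp: fL X_def free_pts_def)
  also have "\<dots> \<le> card (long_pts p \<sigma>) + card ?Q + card X"
    by (meson add_le_mono1 card_Un_le le_trans)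
  finally show ?thesis using X by simp
qed

end

text \<open>A reduced permutation is reconstructed from left to right: at a free point its value is
  recorded, a run of openers is announced at its start, and at every remaining point the value is
  one less than the value at the preceding point.\<close>

definition perm_code :: "nat \<Rightarrow> (nat \<Rightarrow> nat) \<Rightarrow> nat \<Rightarrow> nat" where
  "perm_code p \<sigma> = (\<lambda>t\<in>{..<p}. if t \<in> free_pts p \<sigma> then Suc (Suc (\<sigma> t)) else of_bool (t \<in> opener_starts p \<sigma>))"

lemma perm_code_inj:
  assumes s: "\<sigma> permutes {..<p}" "reduced_on (\<lambda>t. t) p \<sigma>" and t: "\<tau> permutes {..<p}" "reduced_on (\<lambda>t. t) p \<tau>"
    and eq: "perm_code p \<sigma> = perm_code p \<tau>"
  shows "\<sigma> = \<tau>"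
proof -
  have code: "(if t \<in> free_pts p \<sigma> then Suc (Suc (\<sigma> t)) else of_bool (t \<in> opener_starts p \<sigma>)) =
     (if t \<in> free_pts p \<tau> then Suc (Suc (\<tau> t)) else of_bool (t \<in> opener_starts p \<tau>))" if "t < p" for t
    using fun_cong[OF eq, of t] that by (simp add: perm_code_def)
  have free: "t \<in> free_pts p \<sigma> \<longleftrightarrow> t \<in> free_pts p \<tau>" and
    start: "t \<notin> free_pts p \<sigma> \<Longrightarrow> t \<in> opener_starts p \<sigma> \<longleftrightarrow> t \<in> opener_starts p \<tau>" and
    val: "t \<in> free_pts p \<sigma> \<Longrightarrow> \<sigma> t = \<tau> t" if "t < p" for t
    using code[OF that] by (auto simp: of_bool_def split: if_splits)
  \<comment> \<open>Reading from the left determines which points are openers and the values at all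
    other points. The value at an opener is unknown until its closing point is reached.\<close>
  have main: "(t \<in> openers p \<sigma> \<longleftrightarrow> t \<in> openers p \<tau>) \<and> (t \<notin> openers p \<sigma> \<longrightarrow> \<sigma> t = \<tau> t)" if "t < p" for t
    using that
  proof (induction t)
    case 0
    show ?case
    proof (rule point_cases[OF s 0])
      assume a: "0 \<in> free_pts p \<sigma>" "0 \<notin> openers p \<sigma>"
      then have "0 \<notin> openers p \<tau>" using free[OF 0] by (auto simp: free_pts_def openers_def)
      then show ?thesis using a val[OF 0] by auto
    next
      assume a: "0 \<in> openers p \<sigma>" "0 \<notin> free_pts p \<sigma>"
      then show ?thesis using start[OF 0] by (auto simp: opener_starts_def)
    qed auto
  next
    case (Suc t)
    then have IH: "(t \<in> openers p \<sigma> \<longleftrightarrow> t \<in> openers p \<tau>)" "(t \<notin> openers p \<sigma> \<longrightarrow> \<sigma> t = \<tau> t)" by auto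
    note c\<sigma> = point_cases[OF s Suc.prems] and c\<tau> = point_cases[OF t Suc.prems]
    note f = free[OF Suc.prems] and st = start[OF Suc.prems] and v = val[OF Suc.prems]
    show ?case
    proof (rule c\<sigma>)
      assume a: "Suc t \<in> free_pts p \<sigma>" "Suc t \<notin> openers p \<sigma>"
      then have "Suc t \<notin> openers p \<tau>" using f by (auto simp: free_pts_def openers_def)
      then show ?thesis using a v by auto
    next
      assume a: "Suc t \<in> openers p \<sigma>" "Suc t \<notin> free_pts p \<sigma>"
      have "Suc t \<in> openers p \<tau>"
      proof (rule c\<tau>)
        assume b: "Suc t \<notin> openers p \<tau>" "Suc t - 1 \<notin> openers p \<tau>"
        then have "Suc t \<in> opener_starts p \<sigma>" using a IH by (auto simp: opener_starts_def)
        then show ?thesis using st a by (auto simp: opener_starts_def)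
      qed (use a f in auto)
      then show ?thesis using a by auto
    next
      assume a: "Suc t \<notin> openers p \<sigma>" "Suc t \<notin> free_pts p \<sigma>" "Suc t - 1 \<notin> openers p \<sigma>"
        "\<sigma> (Suc t - 1) = Suc (\<sigma> (Suc t))"
      show ?thesis
      proof (rule c\<tau>)
        assume b: "Suc t \<in> openers p \<tau>"
        then have "Suc t \<in> opener_starts p \<tau>" using a IH by (auto simp: opener_starts_def)
        then show ?thesis using st a by (auto simp: opener_starts_def)
      next
        assume b: "Suc t \<notin> openers p \<tau>" "\<tau> (Suc t - 1) = Suc (\<tau> (Suc t))"
        then show ?thesis using a IH by auto
      qed (use a f in auto)
    qed
  qed
  show ?thesis
  proof
    fix t
    show "\<sigma> t = \<tau> t"
    proof (cases "t < p")
      case False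
      then show ?thesis using s(1) t(1) by (simp add: permutes_def)
    next
      case True
      show ?thesis
      proof (cases "t \<in> openers p \<sigma>")
        case False then show ?thesis using main[OF True] by simp
      next
        \<comment> \<open>At an opener the value is recovered from the other end of its 2-cycle,
          where both permutations are already known to agree.\<close>
        case o: True
        let ?u = "\<sigma> t"
        have u: "?u < p" "\<sigma> ?u = t" "t < ?u" using o permutes_in_image[OF s(1), of t] by (auto simp: openers_def)
        then have "?u \<notin> openers p \<sigma>" by (auto simp: openers_def)
        then have "\<tau> ?u = t" using main[OF u(1)] u by simp
        moreover have "\<tau> (\<tau> t) = t" using main[OF True] o by (auto simp: openers_def)
        ultimately show ?thesis using permutes_inj[OF t(1)] by (metis injD)
      qed
    qed
  qed
qed

text \<open>Each nonzero code entry gets weight \<open>y\<close>. There are at most twice as many of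
  them as free points, plus one, which is the division by \<open>y\<close>. Enlarging the sum to all
  words over \<open>p + 2\<close> letters makes it factor into \<open>p\<close> equal sums.\<close>

lemma sum_reduced_free_pts:
  fixes y :: real
  assumes y: "0 < y" "y \<le> 1"
  shows "(\<Sum>\<sigma> | \<sigma> permutes {..<p} \<and> reduced_on (\<lambda>t. t) p \<sigma>. y ^ (2 * card (free_pts p \<sigma>)))
     \<le> (1 + (real p + 1) * y) ^ p / y"
proof -
  define Rd where "Rd = {\<sigma>. \<sigma> permutes {..<p} \<and> reduced_on (\<lambda>t. t) p \<sigma>}"
  define w where "w c = (if c = 0 then 1 else y)" for c :: nat
  have fin: "finite Rd" unfolding Rd_def by (rule finite_subset[OF _ finite_permutations[of "{..<p}"]]) auto
  have trm: "y ^ (2 * card (free_pts p \<sigma>)) \<le> (\<Prod>t<p. w (perm_code p \<sigma> t)) / y" if "\<sigma> \<in> Rd" for \<sigma>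
  proof -
    have s: "\<sigma> permutes {..<p}" "reduced_on (\<lambda>t. t) p \<sigma>" using that by (auto simp: Rd_def)
    let ?N = "free_pts p \<sigma> \<union> opener_starts p \<sigma>"
    have sub: "?N \<subseteq> {..<p}" and disj: "free_pts p \<sigma> \<inter> opener_starts p \<sigma> = {}"
      by (auto simp: free_pts_def opener_starts_def openers_def)
    have fin2: "finite (free_pts p \<sigma>)" "finite (opener_starts p \<sigma>)"
      using sub finite_subset by auto
    have "(\<Prod>t<p. w (perm_code p \<sigma> t)) = (\<Prod>t<p. if t \<in> ?N then y else 1)"
      by (rule prod.cong) (auto simp: w_def perm_code_def)
    also have "\<dots> = y ^ card ?N" using sub by (simp only: prod.If_cases[OF finite_lessThan] prod_constant Int_absorb1 prod.neutral_const power_one mult_1_right Collect_mem_eq)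
    also have "card ?N = card (free_pts p \<sigma>) + card (opener_starts p \<sigma>)"
      using fin2 disj by (rule card_Un_disjoint)
    finally have pr: "(\<Prod>t<p. w (perm_code p \<sigma> t)) = y ^ (card (free_pts p \<sigma>) + card (opener_starts p \<sigma>))" .
    \<comment> \<open>Since \<open>y\<close> is at most 1, the upper bound on the number of runs
      becomes a lower bound on the weight of the code.\<close>
    have "y ^ (2 * card (free_pts p \<sigma>) + 1) \<le> y ^ (card (free_pts p \<sigma>) + card (opener_starts p \<sigma>))"
      using card_opener_starts[OF s] y by (intro power_decreasing) auto
    then show ?thesis unfolding pr using y by (simp add: field_simps)
  qed
  have inj: "inj_on (perm_code p) Rd"
    by (rule inj_onI) (use perm_code_inj in \<open>auto simp: Rd_def\<close>)
  have img: "perm_code p ` Rd \<subseteq> {..<p} \<rightarrow>\<^sub>E {..<p+2}"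
  proof (rule image_subsetI)
    fix \<sigma> assume "\<sigma> \<in> Rd"
    then have s: "\<sigma> permutes {..<p}" by (auto simp: Rd_def)
    have "\<sigma> t < p" if "t < p" for t using permutes_in_image[OF s, of t] that by simp
    then show "perm_code p \<sigma> \<in> {..<p} \<rightarrow>\<^sub>E {..<p+2}" by (auto simp: perm_code_def)
  qed
  have w0: "0 \<le> w c" for c using y by (simp add: w_def)
  have "(\<Sum>\<sigma>\<in>Rd. y ^ (2 * card (free_pts p \<sigma>))) \<le> (\<Sum>\<sigma>\<in>Rd. (\<Prod>t<p. w (perm_code p \<sigma> t)) / y)"
    by (rule sum_mono) (rule trm)
  also have "\<dots> = (\<Sum>g\<in>perm_code p ` Rd. \<Prod>t<p. w (g t)) / y"
    by (simp add: sum_divide_distrib sum.reindex[OF inj])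
  also have "\<dots> \<le> (\<Sum>g\<in>{..<p} \<rightarrow>\<^sub>E {..<p+2}. \<Prod>t<p. w (g t)) / y"
    using y img w0 by (intro divide_right_mono sum_mono2) (auto intro: prod_nonneg simp: finite_PiE)
  also have "(\<Sum>g\<in>{..<p} \<rightarrow>\<^sub>E {..<p+2}. \<Prod>t<p. w (g t)) = (\<Prod>t<p. \<Sum>c<p+2. w c)"
    by (subst prod_sum_PiE) auto
  also have "(\<Sum>c<p+2. w c) = 1 + (real p + 1) * y"
    using sum.lessThan_Suc_shift[of w "Suc p"] by (simp add: w_def algebra_simps)
  finally show ?thesis by (simp add: Rd_def)
qed

text \<open>One circle means \<open>C = 1\<close>. The choice of \<open>y\<close> makes y^2 the gain
  d^(-1/48) per free point, and the division by \<open>y\<close> reduces the gain of the circle from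
  12/96 to 11/96.\<close>

theorem sum_reduced_index_triples:
  assumes p: "1 \<le> p" and d1: "1 \<le> d" and ds: "real d powr (3/2) \<le> real s"
  shows "(\<Sum>\<sigma> | \<sigma> permutes {..<p} \<and> reduced_on (\<lambda>t. t) p \<sigma>. real (card (index_triples {..<p} (csucc p) \<sigma> d s)))
    \<le> real s powr (p / 2) * real d powr (p + 2 - 11/96) * (1 + (real p + 1) * real d powr (-1/96)) ^ p"
proof -
  define y where "y = real d powr (-1/96)"
  have dd: "1 \<le> real d" using d1 by simp
  have y: "0 < y" "y \<le> 1" using dd d1 powr_mono[of "-1/96" 0 "real d"] by (auto simp: y_def)
  have trm: "real (card (index_triples {..<p} (csucc p) \<sigma> d s)) \<le>
     real s powr (p / 2) * real d powr (p + 2 - 1/8) * y ^ (2 * card (free_pts p \<sigma>))"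
    if s: "\<sigma> permutes {..<p}" "reduced_on (\<lambda>t. t) p \<sigma>" for \<sigma>
  proof -
    let ?S = "{..<p}"
    let ?T = "{0, 1} \<inter> ?S"
    let ?L = "{t\<in>?S. \<sigma> (\<sigma> t) \<noteq> t}"
    let ?Q = "{t\<in>?S. csucc p (\<sigma> t) \<noteq> t \<and> csucc p (\<sigma> (csucc p (\<sigma> t))) \<noteq> t}"
    \<comment> \<open>Steps of two starting at 0 and 1 reach every position without passing the seam
      of the circle, whatever the parity of \<open>p\<close>.\<close>
    have gen: "?S \<subseteq> Z" if T: "?T \<subseteq> Z" and cl: "\<And>t. t \<in> ?S \<Longrightarrow> t \<in> Z \<longleftrightarrow> csucc p (csucc p t) \<in> Z" for Z
    proof
      fix t assume "t \<in> ?S"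
      then show "t \<in> Z"
      proof (induction t rule: less_induct)
        case (less t)
        show ?case
        proof (cases "t < 2")
          case True
          then show ?thesis using T less.prems by (cases t) (auto simp: less_2_cases_iff)
        next
          case False
          then obtain u where u: "t = Suc (Suc u)" by (metis One_nat_def add_2_eq_Suc le_add_diff_inverse not_less)
          then have "u \<in> Z" using less by simp
          then show ?thesis using cl[of u] u less.prems by (simp add: csucc_Suc)
        qed
      qed
    qed
    have cT: "card ?T \<le> 2 * 1"
      using card_mono[of "{0,1::nat}" ?T] by auto
    have yF: "real d powr (- real (card (free_pts p \<sigma>)) / 48) = y ^ (2 * card (free_pts p \<sigma>))"
      using y d1 by (simp add: y_def powr_realpow[symmetric] powr_powr)
    have "real (card (index_triples ?S (csucc p) \<sigma> d s)) \<le>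
       real s powr (card ?S / 2) * real d powr (card ?S + 2 * (1::nat) - (1::nat) / 8 - card ?L / 8 - card ?Q / 48)"
      unfolding index_triples_def
    \<comment> \<open>The exceptional position is the last one, whose successor is 0: this is the
      only pair of neighbours that a reduced permutation may swap.\<close>
    proof (rule card_index_triples_le[OF _ csucc_permutes s(1) _ gen cT, where W = "{p - 1}"])
      fix t assume t: "t \<in> ?S" "t \<notin> {p - 1}" "\<sigma> t = csucc p t"
      then have "Suc t < p" by auto
      then show "\<sigma> (csucc p t) \<noteq> t" using t red_noadj[OF s, of t] by (auto simp: csucc_Suc)
    qed (use d1 ds red_nofix[OF s] in auto)
    also have "\<dots> \<le> real s powr (p / 2) * real d powr ((p + 2 - 1/8) + - real (card (free_pts p \<sigma>)) / 48)"
      unfolding card_lessThan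
    proof (intro mult_left_mono powr_mono)
      have "card (free_pts p \<sigma>) \<le> 2 * card ?L + card ?Q" using card_free_pts[OF s]
        by (simp add: long_pts_def)
      then show "real (p + 2 * 1) - real 1 / 8 - card ?L / 8 - card ?Q / 48
          \<le> (p + 2 - 1/8) + - real (card (free_pts p \<sigma>)) / 48" by (simp add: field_simps)
    qed (use dd in auto)
    also have "real d powr ((p + 2 - 1/8) + - real (card (free_pts p \<sigma>)) / 48) =
        real d powr (p + 2 - 1/8) * y ^ (2 * card (free_pts p \<sigma>))"
      by (simp only: powr_add yF)
    finally show ?thesis by (simp add: mult.assoc)
  qed
  let ?R = "{\<sigma>. \<sigma> permutes {..<p} \<and> reduced_on (\<lambda>t. t) p \<sigma>}"
  have "(\<Sum>\<sigma>\<in>?R. real (card (index_triples {..<p} (csucc p) \<sigma> d s)))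
    \<le> (\<Sum>\<sigma>\<in>?R. real s powr (p / 2) * real d powr (p + 2 - 1/8) * y ^ (2 * card (free_pts p \<sigma>)))"
    by (rule sum_mono) (use trm in auto)
  also have "\<dots> = real s powr (p / 2) * real d powr (p + 2 - 1/8) * (\<Sum>\<sigma>\<in>?R. y ^ (2 * card (free_pts p \<sigma>)))"
    by (simp add: sum_distrib_left)
  also have "\<dots> \<le> real s powr (p / 2) * real d powr (p + 2 - 1/8) * ((1 + (real p + 1) * y) ^ p / y)"
    by (intro mult_left_mono sum_reduced_free_pts y) auto
  also have "\<dots> = real s powr (p / 2) * (real d powr (p + 2 - 1/8) / y) * (1 + (real p + 1) * y) ^ p" by simp
  also have "real d powr (p + 2 - 1/8) / y = real d powr (p + 2 - 11/96)"
    by (simp add: y_def powr_diff[symmetric])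
  finally show ?thesis by (simp add: y_def)
qed

text \<open>On two circles there is no need for an injection: for fixed \<open>p\<close> every single term is small.\<close>

definition csucc2 :: "nat \<Rightarrow> nat + nat \<Rightarrow> nat + nat" where
  "csucc2 p = map_sum (csucc p) (csucc p)"

lemma csucc2_permutes: "csucc2 p permutes ({..<p} <+> {..<p})"
proof (rule bij_imp_permutes)
  have "inj (csucc2 p)" unfolding csucc2_def
    by (intro sum.inj_map permutes_inj[OF csucc_permutes])
  then have i: "inj_on (csucc2 p) ({..<p} <+> {..<p})" by (rule inj_on_subset) simp
  have sub: "csucc2 p ` ({..<p} <+> {..<p}) \<subseteq> {..<p} <+> {..<p}"
    by (auto simp: csucc2_def csucc_def)
  have "finite ({..<p} <+> {..<p})" by (intro finite_Plus) simp_all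
  from i endo_inj_surj[OF this sub i] show "bij_betw (csucc2 p) ({..<p} <+> {..<p}) ({..<p} <+> {..<p})"
    by (rule bij_betw_imageI)
  fix x assume "x \<notin> ({..<p} <+> {..<p})"
  then show "csucc2 p x = x" by (cases x) (auto simp: csucc2_def csucc_def)
qed

text \<open>Now \<open>C = 2\<close>, with two seeds and one exceptional position on each circle.
  Only the gain 1/8 per circle is kept. It holds also for permutations that do not connect the
  circles, so the second moment itself is small and no variance has to be split off.\<close>

lemma card_index_triples2:
  assumes p: "1 \<le> p" and d1: "1 \<le> d" and ds: "real d powr (3/2) \<le> real s"
    and s: "\<sigma> permutes ({..<p} <+> {..<p})" "reduced_on Inl p \<sigma>" "reduced_on Inr p \<sigma>"
  shows "real (card (index_triples ({..<p} <+> {..<p}) (csucc2 p) \<sigma> d s)) \<le>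
     real s powr p * real d powr (real (2 * p + 4) - 1/4)"
proof -
  let ?S = "{..<p} <+> {..<p}"
  let ?T = "{Inl 0, Inl 1, Inr 0, Inr 1} \<inter> ?S"
  let ?L = "{t\<in>?S. \<sigma> (\<sigma> t) \<noteq> t}"
  let ?Q = "{t\<in>?S. csucc2 p (\<sigma> t) \<noteq> t \<and> csucc2 p (\<sigma> (csucc2 p (\<sigma> t))) \<noteq> t}"
  have cS: "card ?S = 2 * p" by (simp add: card_Plus)
  have gen: "?S \<subseteq> Z" if T: "?T \<subseteq> Z" and cl: "\<And>t. t \<in> ?S \<Longrightarrow> t \<in> Z \<longleftrightarrow> csucc2 p (csucc2 p t) \<in> Z" for Z
  proof -
    have "t < p \<Longrightarrow> Inl t \<in> Z \<and> Inr t \<in> Z" for t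
    proof (induction t rule: less_induct)
      case (less t)
      show ?case
      proof (cases "t < 2")
        case True
        then show ?thesis using T less.prems by (cases t) (auto simp: less_2_cases_iff)
      next
        case False
        then obtain u where u: "t = Suc (Suc u)" by (metis One_nat_def add_2_eq_Suc le_add_diff_inverse not_less)
        then have "Inl u \<in> Z" "Inr u \<in> Z" using less by simp_all
        moreover have "Inl u \<in> ?S" "Inr u \<in> ?S" using u less.prems by auto
        ultimately show ?thesis using cl[of "Inl u"] cl[of "Inr u"] u less.prems by (simp add: csucc_Suc csucc2_def)
      qed
    qed
    then show ?thesis by auto
  qed
  have cT: "card ?T \<le> 2 * 2"
  proof -
    have "card ?T \<le> card {Inl 0, Inl 1, Inr 0, Inr 1 :: nat + nat}" by (rule card_mono) auto
    then show ?thesis by simp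
  qed
  define X where "X = real (card ?S + 2 * (2::nat)) - real (2::nat) / 8 - real (card ?L) / 8 - real (card ?Q) / 48"
  have h: "real (card (index_triples ?S (csucc2 p) \<sigma> d s)) \<le>
     real s powr (card ?S / 2) * real d powr (card ?S + 2 * (2::nat) - (2::nat) / 8 - card ?L / 8 - card ?Q / 48)"
    unfolding index_triples_def
  proof (rule card_index_triples_le[OF _ csucc2_permutes s(1) _ gen cT, where W = "{Inl (p - 1), Inr (p - 1)}"])
    fix t assume t: "t \<in> ?S" "t \<notin> {Inl (p - 1), Inr (p - 1)}" "\<sigma> t = csucc2 p t"
    show "\<sigma> (csucc2 p t) \<noteq> t"
    proof (cases t)
      case (Inl u)
      then have "Suc u < p" using t by auto
      then show ?thesis using t Inl s(2) by (auto simp: reduced_on_def csucc2_def csucc_Suc)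
    next
      case (Inr u)
      then have "Suc u < p" using t by auto
      then show ?thesis using t Inr s(3) by (auto simp: reduced_on_def csucc2_def csucc_Suc)
    qed
  next
    fix t assume "t \<in> ?S"
    then show "\<sigma> t \<noteq> t" using s(2,3) by (auto simp: reduced_on_def)
  qed (use d1 ds in \<open>auto simp: card_insert_if\<close>)
  have e: "real (card ?S) / 2 = real p" by (simp add: cS)
  have "X \<le> real (card ?S + 2 * (2::nat)) - real (2::nat) / 8"
    unfolding X_def by linarith
  then have f: "X \<le> real (2 * p + 4) - 1/4" unfolding cS by simp
  have d: "1 \<le> real d" using d1 by simp
  have "real s powr real p * real d powr X \<le> real s powr real p * real d powr (real (2 * p + 4) - 1/4)"
    by (rule mult_left_mono[OF powr_mono[OF f d]]) simp
  with h[folded X_def, unfolded e] show ?thesis by (rule order_trans)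
qed

subsection \<open>Complex Gaussian moments and Wick calculus\<close>

text \<open>The real and imaginary parts have variance 1/2, so that E |z|^2 = 1 and E z^2 = 0: only
  pairings of a variable with a conjugate survive.\<close>

definition cgauss :: "complex measure" where
  "cgauss = density lborel (\<lambda>z. ennreal (exp (- (cmod z)\<^sup>2) / pi))"

lemma sets_cgauss [simp, measurable_cong]: "sets cgauss = sets borel"
  by (simp add: cgauss_def)

lemma space_cgauss [simp]: "space cgauss = UNIV"
  by (simp add: cgauss_def)

lemma normal_density_half: "normal_density 0 (1 / sqrt 2) x = exp (- x\<^sup>2) / sqrt pi"
  by (simp add: normal_density_def power_divide)

lemma lborel_complex_eq:
  "(lborel :: complex measure) = distr (PiM Basis (\<lambda>_. lborel :: real measure)) borel (\<lambda>f. \<Sum>b\<in>Basis. f b *\<^sub>R b)"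
  by (simp add: lborel_def[where 'a = complex] lborel_eq_real)

definition gauss_mom :: "nat \<Rightarrow> real" where
  "gauss_mom m = (\<integral>x. normal_density 0 (1 / sqrt 2) x * x ^ m \<partial>lborel)"

lemma gauss_mom_even: "gauss_mom (2 * k) = fact (2 * k) / (4 ^ k * fact k)"
  using integral_normal_moment_even[of "1 / sqrt 2" 0 k] by (simp add: gauss_mom_def power_divide)

lemma gauss_mom_odd: "gauss_mom (Suc (2 * k)) = 0"
  using integral_normal_moment_odd[of "1 / sqrt 2" 0 k] by (simp add: gauss_mom_def)

text \<open>Integration by parts, E (x f(x)) = E (f'(x)) / 2 with f(x) = x^m, read off from the
  explicit moments. At \<open>m = 0\<close> the truncated \<open>m - 1\<close> is harmless because
  its coefficient vanishes.\<close>

lemma gauss_mom_rec: "gauss_mom (Suc m) = (real m / 2) * gauss_mom (m - 1)"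
proof (cases "even m")
  case True
  then obtain k where k: "m = 2 * k" by (elim evenE)
  show ?thesis
  proof (cases k)
    case (Suc l)
    have "m - 1 = Suc (2 * l)" using k Suc by simp
    then show ?thesis using k gauss_mom_odd[of k] gauss_mom_odd[of l] by simp
  qed (use k gauss_mom_odd[of 0] in simp)
next
  case False
  then obtain k where k: "m = Suc (2 * k)" by (metis oddE Suc_eq_plus1)
  then have "gauss_mom (Suc m) = gauss_mom (2 * Suc k)" by simp
  also have "\<dots> = fact (2 * Suc k) / (4 ^ Suc k * fact (Suc k))" by (rule gauss_mom_even)
  also have "\<dots> = ((2 * real k + 1) / 2) * (fact (2 * k) / (4 ^ k * fact k))"
  proof -
    have "fact (2 * Suc k) = (2 * real k + 2) * ((2 * real k + 1) * fact (2 * k))" by (simp add: algebra_simps)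
    moreover have "real k + 1 \<noteq> 0" by simp
    ultimately show ?thesis by (simp add: divide_simps) (simp add: algebra_simps)
  qed
  also have "\<dots> = (real m / 2) * gauss_mom (m - 1)"
    using gauss_mom_even[of k] k by simp
  finally show ?thesis .
qed

lemma cgauss_re_im:
  "has_bochner_integral cgauss (\<lambda>z. complex_of_real (Re z) ^ m * complex_of_real (Im z) ^ l)
     (complex_of_real (gauss_mom m * gauss_mom l))"
proof -
  interpret product_sigma_finite "\<lambda>_::complex. lborel :: real measure" by standard
  define h :: "complex \<Rightarrow> real \<Rightarrow> real" where
    "h b x = normal_density 0 (1 / sqrt 2) x * x ^ (if b = 1 then m else l)" for b x
  have hi: "integrable lborel (h b)" for b
    using integrable_normal_moment[of "1 / sqrt 2" 0 "if b = 1 then m else l"] by (simp add: h_def[abs_def])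
  have B: "(Basis :: complex set) = {1, \<i>}" by (simp add: Basis_complex_def)
  let ?P = "PiM (Basis :: complex set) (\<lambda>_. lborel :: real measure)"
  let ?\<phi> = "\<lambda>f::complex\<Rightarrow>real. \<Sum>b\<in>Basis. f b *\<^sub>R b"
  have int: "integrable ?P (\<lambda>f. \<Prod>b\<in>Basis. h b (f b))"
    by (rule product_integrable_prod) (auto simp: hi)
  have "integral\<^sup>L ?P (\<lambda>f. \<Prod>b\<in>Basis. h b (f b)) = (\<Prod>b\<in>(Basis::complex set). integral\<^sup>L lborel (h b))"
    by (rule product_integral_prod) (auto simp: hi)
  also have "\<dots> = gauss_mom m * gauss_mom l"
    by (simp add: B h_def[abs_def] gauss_mom_def)
  finally have val: "integral\<^sup>L ?P (\<lambda>f. \<Prod>b\<in>Basis. h b (f b)) = gauss_mom m * gauss_mom l" .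
  have "has_bochner_integral ?P (\<lambda>f. \<Prod>b\<in>Basis. h b (f b)) (gauss_mom m * gauss_mom l)"
    using int val by (simp add: has_bochner_integral_iff)
  moreover have "(\<Prod>b\<in>Basis. h b (f b)) = exp (- (cmod (?\<phi> f))\<^sup>2) / pi * (Re (?\<phi> f) ^ m * Im (?\<phi> f) ^ l)" for f
    by (simp add: B h_def normal_density_half cmod_power2 exp_add[symmetric] mult_exp_exp field_simps)
  ultimately have "has_bochner_integral ?P (\<lambda>f. exp (- (cmod (?\<phi> f))\<^sup>2) / pi * (Re (?\<phi> f) ^ m * Im (?\<phi> f) ^ l)) (gauss_mom m * gauss_mom l)"
    by simp
  then have "has_bochner_integral (distr ?P borel ?\<phi>) (\<lambda>z. exp (- (cmod z)\<^sup>2) / pi * (Re z ^ m * Im z ^ l)) (gauss_mom m * gauss_mom l)"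
    by (intro has_bochner_integral_distr) auto
  then have "has_bochner_integral lborel (\<lambda>z. (exp (- (cmod z)\<^sup>2) / pi) *\<^sub>R (Re z ^ m * Im z ^ l)) (gauss_mom m * gauss_mom l)"
    by (simp add: lborel_complex_eq)
  then have "has_bochner_integral cgauss (\<lambda>z. Re z ^ m * Im z ^ l) (gauss_mom m * gauss_mom l)"
    unfolding cgauss_def by (intro has_bochner_integral_density) auto
  from has_bochner_integral_of_real[OF this] show ?thesis by simp
qed

text \<open>The exponents \<open>m\<close>, \<open>l\<close> of the real and the imaginary part keep the family closed under
  Gaussian integration by parts in either direction.\<close>

definition cmon :: "nat \<Rightarrow> nat \<Rightarrow> nat \<Rightarrow> nat \<Rightarrow> complex \<Rightarrow> complex" where
  "cmon m l a b z = complex_of_real (Re z) ^ m * complex_of_real (Im z) ^ l * z ^ a * cnj z ^ b"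

definition cmom :: "nat \<Rightarrow> nat \<Rightarrow> nat \<Rightarrow> nat \<Rightarrow> complex" where
  "cmom m l a b = integral\<^sup>L cgauss (cmon m l a b)"

lemma cmon_Suc_a: "cmon m l (Suc a) b = (\<lambda>z. cmon (Suc m) l a b z + \<i> * cmon m (Suc l) a b z)"
proof
  fix z
  have "cmon m l (Suc a) b z = (complex_of_real (Re z) + \<i> * complex_of_real (Im z)) * cmon m l a b z"
    by (subst complex_eq[symmetric]) (simp add: cmon_def mult_ac)
  then show "cmon m l (Suc a) b z = cmon (Suc m) l a b z + \<i> * cmon m (Suc l) a b z"
    by (simp add: cmon_def algebra_simps)
qed

lemma cmon_Suc_b: "cmon m l a (Suc b) = (\<lambda>z. cmon (Suc m) l a b z - \<i> * cmon m (Suc l) a b z)"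
proof
  fix z
  have c: "cnj z = complex_of_real (Re z) - \<i> * complex_of_real (Im z)"
    by (simp add: complex_eq_iff)
  have "cmon m l a (Suc b) z = cnj z * cmon m l a b z"
    by (simp add: cmon_def mult_ac)
  then show "cmon m l a (Suc b) z = cmon (Suc m) l a b z - \<i> * cmon m (Suc l) a b z"
    unfolding c by (simp add: cmon_def algebra_simps)
qed

lemma cmon_integrable: "integrable cgauss (cmon m l a b)"
proof (induction b arbitrary: m l)
  case 0
  show ?case
  proof (induction a arbitrary: m l)
    case 0
    show ?case using cgauss_re_im[of m l] by (simp add: cmon_def[abs_def] has_bochner_integral_iff)
  qed (simp add: cmon_Suc_a)
qed (simp add: cmon_Suc_b)

lemma cmom_0: "cmom m l 0 0 = complex_of_real (gauss_mom m * gauss_mom l)"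
  using cgauss_re_im[of m l] by (simp add: cmom_def cmon_def[abs_def] has_bochner_integral_iff)

lemma cmom_Suc_a: "cmom m l (Suc a) b = cmom (Suc m) l a b + \<i> * cmom m (Suc l) a b"
  by (simp add: cmom_def cmon_Suc_a cmon_integrable)

lemma cmom_Suc_b: "cmom m l a (Suc b) = cmom (Suc m) l a b - \<i> * cmom m (Suc l) a b"
  by (simp add: cmom_def cmon_Suc_b cmon_integrable)

text \<open>Integration by parts in the real direction, where z and its conjugate both have
  derivative 1. The induction splits factors z and cnj z into real and imaginary parts until only
  \<open>gauss_mom_rec\<close> is left.\<close>

lemma cmom_parts_re:
  "cmom (Suc m) l a b = (of_nat m * cmom (m - 1) l a b + of_nat a * cmom m l (a - 1) b + of_nat b * cmom m l a (b - 1)) / 2"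
proof (induction b arbitrary: m l)
  case 0
  show ?case
  proof (induction a arbitrary: m l)
    case 0
    show ?case by (simp add: cmom_0 gauss_mom_rec)
  next
    case (Suc a)
    show ?case
      unfolding cmom_Suc_a Suc.IH[of "Suc m" l] Suc.IH[of m "Suc l"]
      by (cases a; cases m) (auto simp: cmom_Suc_a algebra_simps add_divide_distrib)
  qed
next
  case (Suc b)
  show ?case
    unfolding cmom_Suc_b Suc.IH[of "Suc m" l] Suc.IH[of m "Suc l"]
    by (cases a; cases b; cases m) (auto simp: cmom_Suc_b field_simps)
qed

text \<open>In the imaginary direction z and its conjugate have derivatives i and -i, hence the
  signs.\<close>

lemma cmom_parts_im:
  "cmom m (Suc l) a b = (of_nat l * cmom m (l - 1) a b + \<i> * of_nat a * cmom m l (a - 1) b - \<i> * of_nat b * cmom m l a (b - 1)) / 2"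
proof (induction b arbitrary: m l)
  case 0
  show ?case
  proof (induction a arbitrary: m l)
    case 0
    show ?case by (simp add: cmom_0 gauss_mom_rec)
  next
    case (Suc a)
    show ?case
      unfolding cmom_Suc_a Suc.IH[of "Suc m" l] Suc.IH[of m "Suc l"]
      by (cases a; cases l) (auto simp: cmom_Suc_a algebra_simps add_divide_distrib)
  qed
next
  case (Suc b)
  show ?case
    unfolding cmom_Suc_b Suc.IH[of "Suc m" l] Suc.IH[of m "Suc l"]
    by (cases a; cases b; cases l) (auto simp: cmom_Suc_b field_simps)
qed

text \<open>In the combination Re z - i Im z the derivatives of the conjugate cancel and those of z
  add up: integration by parts pairs a conjugate only with factors z.\<close>

lemma cmom_rec: "cmom 0 0 a (Suc b) = of_nat a * cmom 0 0 (a - 1) b"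
  by (simp add: cmom_Suc_b cmom_parts_re[of 0] cmom_parts_im[of 0 0] algebra_simps add_divide_distrib diff_divide_distrib)

lemma cmom_rec': "cmom 0 0 (Suc a) b = of_nat b * cmom 0 0 a (b - 1)"
  by (simp add: cmom_Suc_a cmom_parts_re[of 0] cmom_parts_im[of 0 0] algebra_simps add_divide_distrib diff_divide_distrib)

lemma cmom_eq: "cmom 0 0 a b = of_bool (a = b) * fact a"
proof (induction b arbitrary: a)
  case 0
  have g: "gauss_mom 0 = 1" using gauss_mom_even[of 0] by simp
  show ?case
  proof (cases a)
    case 0
    then show ?thesis by (simp add: cmom_0 g)
  next
    case (Suc c)
    then show ?thesis by (simp add: cmom_rec')
  qed
next
  case (Suc b)
  show ?case by (cases a) (auto simp: cmom_rec Suc.IH)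
qed

lemma cgauss_integrable: "integrable cgauss (\<lambda>z. z ^ a * cnj z ^ b)"
  using cmon_integrable[of 0 0 a b] by (simp add: cmon_def[abs_def])

lemma cgauss_integral: "(\<integral>z. z ^ a * cnj z ^ b \<partial>cgauss) = of_bool (a = b) * fact a"
  using cmom_eq[of a b] by (simp add: cmom_def cmon_def[abs_def])

lemma prob_space_cgauss: "prob_space cgauss"
proof
  have "integrable cgauss (indicator UNIV :: complex \<Rightarrow> real)"
    using cgauss_re_im[of 0 0] integrable_norm[of cgauss "\<lambda>_. 1::complex"]
    by (auto simp: has_bochner_integral_iff indicator_def[abs_def])
  then have fin: "emeasure cgauss (space cgauss) \<noteq> \<infinity>"
    unfolding integrable_indicator_iff by auto
  have "complex_of_real (measure cgauss UNIV) = 1"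
    using cgauss_integral[of 0 0] by (simp add: complex_eq_iff)
  then have "measure cgauss (space cgauss) = 1" by (metis of_real_eq_1_iff space_cgauss)
  then show "emeasure cgauss (space cgauss) = 1"
    using emeasure_eq_ennreal_measure[of cgauss "space cgauss"] fin by simp
qed

section \<open>Wick's formula for finitely many independent complex Gaussian variables\<close>

definition gauss_space :: "'v set \<Rightarrow> ('v \<Rightarrow> complex) measure" where
  "gauss_space V = PiM V (\<lambda>_. cgauss)"

lemma prob_space_gauss_space: "prob_space (gauss_space V)"
  unfolding gauss_space_def by (intro prob_space_PiM prob_space_cgauss)

lemma prod_fibers:
  fixes h :: "'v \<Rightarrow> complex"
  assumes "finite V" "finite S" "a \<in> S \<rightarrow> V"
  shows "(\<Prod>t\<in>S. h (a t)) = (\<Prod>v\<in>V. h v ^ card {t\<in>S. a t = v})"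
proof -
  have "(\<Prod>t\<in>S. h (a t)) = (\<Prod>v\<in>V. \<Prod>t\<in>{t\<in>S. a t = v}. h (a t))"
    by (rule prod.group[symmetric]) (use assms in auto)
  also have "\<dots> = (\<Prod>v\<in>V. \<Prod>t\<in>{t\<in>S. a t = v}. h v)" by (intro prod.cong) auto
  finally show ?thesis by simp
qed

definition fiber_mom :: "'v set \<Rightarrow> 't set \<Rightarrow> ('t \<Rightarrow> 'v) \<Rightarrow> ('t \<Rightarrow> 'v) \<Rightarrow> complex" where
  "fiber_mom V S a b = (\<Prod>v\<in>V. of_bool (card {t\<in>S. a t = v} = card {t\<in>S. b t = v}) * fact (card {t\<in>S. a t = v}))"

lemma gauss_monomial:
  fixes V :: "'v set"
  assumes V: "finite V" and S: "finite S" and a: "a \<in> S \<rightarrow> V" and b: "b \<in> S \<rightarrow> V"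
  shows "has_bochner_integral (gauss_space V) (\<lambda>x. \<Prod>t\<in>S. x (a t) * cnj (x (b t))) (fiber_mom V S a b)"
proof -
  interpret cg: prob_space cgauss by (rule prob_space_cgauss)
  interpret product_sigma_finite "\<lambda>_::'v. cgauss" by standard
  define h where "h v z = z ^ card {t\<in>S. a t = v} * cnj z ^ card {t\<in>S. b t = v}" for v and z :: complex
  have eq: "(\<Prod>t\<in>S. x (a t) * cnj (x (b t))) = (\<Prod>v\<in>V. h v (x v))" for x :: "'v \<Rightarrow> complex"
    unfolding prod.distrib prod_fibers[OF V S a, of x] prod_fibers[OF V S b, of "\<lambda>v. cnj (x v)"] h_def ..
  have "integrable (PiM V (\<lambda>_. cgauss)) (\<lambda>x. \<Prod>v\<in>V. h v (x v))"
    by (rule product_integrable_prod[OF V]) (simp add: h_def[abs_def] cgauss_integrable)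
  moreover have "integral\<^sup>L (PiM V (\<lambda>_. cgauss)) (\<lambda>x. \<Prod>v\<in>V. h v (x v)) = (\<Prod>v\<in>V. integral\<^sup>L cgauss (h v))"
    by (rule product_integral_prod[OF V]) (simp add: h_def[abs_def] cgauss_integrable)
  moreover have "(\<Prod>v\<in>V. integral\<^sup>L cgauss (h v)) = fiber_mom V S a b"
    unfolding fiber_mom_def h_def[abs_def] cgauss_integral ..
  ultimately show ?thesis by (simp add: has_bochner_integral_iff gauss_space_def eq)
qed

text \<open>Expansion along \<open>t0\<close>, which is paired with some \<open>u\<close> carrying
  the same variable. Exchanging \<open>t0\<close> and \<open>u\<close> in \<open>b\<close> takes the
  label of \<open>u\<close> out of play, and the identity reduces to (k + 1)! = (k + 1) k! in the
  variable \<open>a t0\<close>.\<close>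

lemma fiber_mom_insert:
  assumes V: "finite V" and F: "finite F" "t0 \<notin> F" and a: "a t0 \<in> V"
  shows "fiber_mom V (insert t0 F) a b =
    (\<Sum>u\<in>insert t0 F. of_bool (a t0 = b u) * fiber_mom V F a (b \<circ> Transposition.transpose t0 u))"
proof -
  let ?S = "insert t0 F"
  let ?v0 = "a t0"
  define \<alpha> where "\<alpha> v = card {t\<in>F. a t = v}" for v
  define \<beta> where "\<beta> v = card {t\<in>?S. b t = v}" for v
  define m where "m k l = of_bool (k = l) * (fact k :: complex)" for k l :: nat
  have m_Suc: "m (Suc k) l = of_nat l * m k (l - 1)" for k l
    by (cases l) (auto simp: m_def)
  have A: "card {t\<in>?S. a t = v} = \<alpha> v + of_bool (v = ?v0)" for v
  proof (cases "v = ?v0")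
    case True
    have "{t\<in>?S. a t = v} = insert t0 {t\<in>F. a t = v}" using True by auto
    then show ?thesis using F True by (simp add: \<alpha>_def)
  next
    case False
    then have "{t\<in>?S. a t = v} = {t\<in>F. a t = v}" by auto
    then show ?thesis using False by (simp add: \<alpha>_def)
  qed
  \<comment> \<open>Restricted to \<open>F\<close>, the exchanged labeling takes the same values as
    \<open>b\<close> on the whole set with the position \<open>u\<close> removed.\<close>
  have B: "card {t\<in>F. (b \<circ> Transposition.transpose t0 u) t = v} = \<beta> v - of_bool (v = b u)" if u: "u \<in> ?S" for u v
  proof -
    have "bij_betw (Transposition.transpose t0 u) {t\<in>F. (b \<circ> Transposition.transpose t0 u) t = v} ({t\<in>?S. b t = v} - {u})"
    proof (rule bij_betw_byWitness[where f' = "Transposition.transpose t0 u"])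
      show "Transposition.transpose t0 u ` {t\<in>F. (b \<circ> Transposition.transpose t0 u) t = v} \<subseteq> {t\<in>?S. b t = v} - {u}"
      proof (rule image_subsetI)
        fix t assume t: "t \<in> {t\<in>F. (b \<circ> Transposition.transpose t0 u) t = v}"
        then have "t \<noteq> t0" using F by auto
        then have "Transposition.transpose t0 u t \<noteq> u" "Transposition.transpose t0 u t \<in> ?S"
          using t by (cases "t = u"; simp add: transpose_eq_iff)+
        then show "Transposition.transpose t0 u t \<in> {t\<in>?S. b t = v} - {u}" using t by simp
      qed
      show "Transposition.transpose t0 u ` ({t\<in>?S. b t = v} - {u}) \<subseteq> {t\<in>F. (b \<circ> Transposition.transpose t0 u) t = v}"
      proof (rule image_subsetI)
        fix t assume t: "t \<in> {t\<in>?S. b t = v} - {u}"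
        then have "Transposition.transpose t0 u t \<in> F" using u by (cases "t = t0") auto
        then show "Transposition.transpose t0 u t \<in> {t\<in>F. (b \<circ> Transposition.transpose t0 u) t = v}"
          using t by simp
      qed
    qed simp_all
    then have "card {t\<in>F. (b \<circ> Transposition.transpose t0 u) t = v} = card ({t\<in>?S. b t = v} - {u})"
      by (rule bij_betw_same_card)
    also have "\<dots> = \<beta> v - of_bool (v = b u)"
      using u F by (auto simp: \<beta>_def card_Diff_singleton_if)
    finally show ?thesis .
  qed
  \<comment> \<open>The summands depend on \<open>u\<close> only through the condition
    \<open>b u = ?v0\<close>; those that do not vanish are all equal to \<open>?R\<close>.\<close>
  let ?R = "\<Prod>v\<in>V. m (\<alpha> v) (\<beta> v - of_bool (v = ?v0))"
  have "(\<Sum>u\<in>?S. of_bool (?v0 = b u) * fiber_mom V F a (b \<circ> Transposition.transpose t0 u)) =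
        (\<Sum>u\<in>?S. of_bool (b u = ?v0) * ?R)"
  proof (rule sum.cong[OF refl])
    fix u assume u: "u \<in> ?S"
    show "of_bool (?v0 = b u) * fiber_mom V F a (b \<circ> Transposition.transpose t0 u) = of_bool (b u = ?v0) * ?R"
      unfolding fiber_mom_def B[OF u] by (auto simp: m_def \<alpha>_def intro!: prod.cong)
  qed
  also have "\<dots> = of_nat (\<beta> ?v0) * ?R"
  proof -
    have "(\<Sum>u\<in>?S. of_bool (b u = ?v0)) = (of_nat (\<beta> ?v0) :: complex)"
      unfolding \<beta>_def using F by (simp add: sum_of_bool_eq Int_def)
    then show ?thesis by (simp add: sum_distrib_right[symmetric])
  qed
  also have "\<dots> = (\<Prod>v\<in>V. m (\<alpha> v + of_bool (v = ?v0)) (\<beta> v))"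
  proof -
    have "(\<Prod>v\<in>V - {?v0}. m (\<alpha> v) (\<beta> v - of_bool (v = ?v0))) = (\<Prod>v\<in>V - {?v0}. m (\<alpha> v + of_bool (v = ?v0)) (\<beta> v))"
      by (rule prod.cong) auto
    then show ?thesis
      by (simp add: prod.remove[OF V a] m_Suc)
  qed
  also have "\<dots> = fiber_mom V ?S a b"
    unfolding fiber_mom_def A m_def \<beta>_def ..
  finally show ?thesis ..
qed

text \<open>A permutation contributes iff it maps each fibre of \<open>a\<close> into the
  corresponding fibre of \<open>b\<close>, so the product of factorials counts them; the insertion
  formulas for both sides coincide.\<close>

lemma fiber_mom_permutes:
  assumes "finite V" "finite S" "a \<in> S \<rightarrow> V"
  shows "fiber_mom V S a b = (\<Sum>\<sigma> | \<sigma> permutes S. \<Prod>t\<in>S. of_bool (a t = b (\<sigma> t)))"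
  using assms(2,3)
proof (induction S arbitrary: b rule: finite_induct)
  case empty
  show ?case by (simp add: fiber_mom_def)
next
  case (insert t0 F)
  have "(\<Sum>\<sigma> | \<sigma> permutes insert t0 F. \<Prod>t\<in>insert t0 F. of_bool (a t = b (\<sigma> t)) :: complex) =
    (\<Sum>u\<in>insert t0 F. \<Sum>q | q permutes F. \<Prod>t\<in>insert t0 F. of_bool (a t = b ((Transposition.transpose t0 u \<circ> q) t)))"
    by (rule sum_over_permutations_insert[OF insert.hyps])
  also have "\<dots> = (\<Sum>u\<in>insert t0 F. of_bool (a t0 = b u) * fiber_mom V F a (b \<circ> Transposition.transpose t0 u))"
  proof (rule sum.cong[OF refl])
    fix u
    have "(\<Sum>q | q permutes F. \<Prod>t\<in>insert t0 F. of_bool (a t = b ((Transposition.transpose t0 u \<circ> q) t)) :: complex)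
      = (\<Sum>q | q permutes F. of_bool (a t0 = b u) * (\<Prod>t\<in>F. of_bool (a t = (b \<circ> Transposition.transpose t0 u) (q t))))"
    proof (rule sum.cong[OF refl])
      fix q assume "q \<in> {q. q permutes F}"
      then have "q t0 = t0" using insert.hyps by (simp add: permutes_def)
      then show "(\<Prod>t\<in>insert t0 F. of_bool (a t = b ((Transposition.transpose t0 u \<circ> q) t)) :: complex) =
         of_bool (a t0 = b u) * (\<Prod>t\<in>F. of_bool (a t = (b \<circ> Transposition.transpose t0 u) (q t)))"
        using insert.hyps by (simp add: o_def)
    qed
    also have "\<dots> = of_bool (a t0 = b u) * fiber_mom V F a (b \<circ> Transposition.transpose t0 u)"
    proof -
      have "a \<in> F \<rightarrow> V" using insert.prems by auto
      then show ?thesis unfolding insert.IH[OF \<open>a \<in> F \<rightarrow> V\<close>] by (simp only: sum_distrib_left)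
    qed
    finally show "(\<Sum>q | q permutes F. \<Prod>t\<in>insert t0 F. of_bool (a t = b ((Transposition.transpose t0 u \<circ> q) t)) :: complex)
      = of_bool (a t0 = b u) * fiber_mom V F a (b \<circ> Transposition.transpose t0 u)" .
  qed
  also have "\<dots> = fiber_mom V (insert t0 F) a b"
    by (rule fiber_mom_insert[symmetric]) (use assms insert in auto)
  finally show ?case ..
qed

definition wick_sum :: "('t \<Rightarrow> 'v) \<Rightarrow> ('t \<Rightarrow> 'v) \<Rightarrow> 't set \<Rightarrow> (('t \<Rightarrow> 't) \<Rightarrow> bool) \<Rightarrow> complex" where
  "wick_sum a b S P = (\<Sum>\<sigma> | \<sigma> permutes S \<and> P \<sigma>. \<Prod>t\<in>S. of_bool (a t = b (\<sigma> t)))"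

lemma wick:
  assumes "finite V" "finite S" "a \<in> S \<rightarrow> V" "b \<in> S \<rightarrow> V"
  shows "has_bochner_integral (gauss_space V) (\<lambda>x. \<Prod>t\<in>S. x (a t) * cnj (x (b t))) (wick_sum a b S (\<lambda>_. True))"
  using gauss_monomial[OF assms] fiber_mom_permutes[OF assms(1-3), of b] by (simp add: wick_sum_def)

lemma wick_sum_fixed:
  assumes "finite S" "w \<notin> S"
  shows "wick_sum a b (insert w S) (\<lambda>\<sigma>. P \<sigma> \<and> \<sigma> w = w) = wick_sum a b S P * of_bool (a w = b w)"
proof -
  have "{\<sigma>. \<sigma> permutes insert w S \<and> P \<sigma> \<and> \<sigma> w = w} = {\<sigma>. \<sigma> permutes S \<and> P \<sigma>}"
  proof (intro subset_antisym subsetI)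
    fix \<sigma> assume s: "\<sigma> \<in> {\<sigma>. \<sigma> permutes insert w S \<and> P \<sigma> \<and> \<sigma> w = w}"
    have "\<sigma> permutes S" by (rule permutes_superset[of \<sigma> "insert w S"]) (use s in auto)
    then show "\<sigma> \<in> {\<sigma>. \<sigma> permutes S \<and> P \<sigma>}" using s by simp
  next
    fix \<sigma> assume s: "\<sigma> \<in> {\<sigma>. \<sigma> permutes S \<and> P \<sigma>}"
    then show "\<sigma> \<in> {\<sigma>. \<sigma> permutes insert w S \<and> P \<sigma> \<and> \<sigma> w = w}"
      using assms by (auto intro: permutes_subset permutes_not_in)
  qed
  moreover have "(\<Prod>t\<in>insert w S. of_bool (a t = b (\<sigma> t)) :: complex) = (\<Prod>t\<in>S. of_bool (a t = b (\<sigma> t))) * of_bool (a w = b w)"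
    if "\<sigma> permutes S" for \<sigma>
    using assms permutes_not_in[OF that] by simp
  ultimately show ?thesis unfolding wick_sum_def
    by (simp add: sum_distrib_right)
qed

text \<open>Composing with the transposition adds the 2-cycle of \<open>v\<close> and
  \<open>w\<close> to a permutation of \<open>S\<close>. There are two predicates because
  \<open>reduced_on\<close> at length \<open>Suc p\<close> has to be matched with
  \<open>reduced_on\<close> at length \<open>p\<close>.\<close>

lemma wick_sum_swap:
  assumes S: "finite S" "v \<notin> S" "w \<notin> S" "v \<noteq> w"
    and P: "\<And>\<sigma>. \<sigma> permutes S \<Longrightarrow> P' (Transposition.transpose v w \<circ> \<sigma>) \<longleftrightarrow> P \<sigma>"
  shows "wick_sum a b (insert v (insert w S)) (\<lambda>\<sigma>. P' \<sigma> \<and> \<sigma> v = w \<and> \<sigma> w = v) =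
    wick_sum a b S P * (of_bool (a v = b w) * of_bool (a w = b v))"
proof -
  let ?A = "{\<sigma>. \<sigma> permutes insert v (insert w S) \<and> P' \<sigma> \<and> \<sigma> v = w \<and> \<sigma> w = v}"
  let ?B = "{\<sigma>. \<sigma> permutes S \<and> P \<sigma>}"
  have tt: "Transposition.transpose v w \<circ> (Transposition.transpose v w \<circ> \<sigma>) = \<sigma>" for \<sigma>
    by (simp add: fun_eq_iff)
  have bij: "bij_betw ((\<circ>) (Transposition.transpose v w)) ?B ?A"
  proof (rule bij_betw_byWitness[where f' = "(\<circ>) (Transposition.transpose v w)"])
    show "(\<circ>) (Transposition.transpose v w) ` ?B \<subseteq> ?A"
    proof (rule image_subsetI)
      fix \<sigma> assume s: "\<sigma> \<in> ?B"
      then have sp: "\<sigma> permutes S" by simp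
      have "\<sigma> permutes insert v (insert w S)" using sp by (rule permutes_subset) auto
      moreover have "Transposition.transpose v w permutes insert v (insert w S)"
        by (rule permutes_swap_id) auto
      ultimately have "(Transposition.transpose v w \<circ> \<sigma>) permutes insert v (insert w S)" by (rule permutes_compose)
      then show "Transposition.transpose v w \<circ> \<sigma> \<in> ?A" using s P[OF sp] permutes_not_in[OF sp] S by auto
    qed
    show "(\<circ>) (Transposition.transpose v w) ` ?A \<subseteq> ?B"
    proof (rule image_subsetI)
      fix \<sigma> assume s: "\<sigma> \<in> ?A"
      have "(Transposition.transpose v w \<circ> \<sigma>) permutes insert v (insert w S)"
        by (rule permutes_compose) (use s in \<open>auto intro: permutes_swap_id\<close>)
      then have sp: "(Transposition.transpose v w \<circ> \<sigma>) permutes S"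
        by (rule permutes_superset) (use s in auto)
      then show "Transposition.transpose v w \<circ> \<sigma> \<in> ?B" using s P[OF sp] by (simp add: tt)
    qed
  qed (simp_all add: tt)
  have "wick_sum a b (insert v (insert w S)) (\<lambda>\<sigma>. P' \<sigma> \<and> \<sigma> v = w \<and> \<sigma> w = v) =
     (\<Sum>\<sigma>\<in>?B. \<Prod>t\<in>insert v (insert w S). of_bool (a t = b ((Transposition.transpose v w \<circ> \<sigma>) t)))"
    unfolding wick_sum_def by (rule sum.reindex_bij_betw[OF bij, symmetric])
  also have "\<dots> = (\<Sum>\<sigma>\<in>?B. (\<Prod>t\<in>S. of_bool (a t = b (\<sigma> t))) * (of_bool (a v = b w) * of_bool (a w = b v)))"
  proof (rule sum.cong[OF refl])
    fix \<sigma> assume "\<sigma> \<in> ?B"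
    then have sp: "\<sigma> permutes S" by simp
    have "(Transposition.transpose v w \<circ> \<sigma>) t = \<sigma> t" if "t \<in> S" for t
    proof -
      have "\<sigma> t \<in> S" using permutes_in_image[OF sp] that by simp
      then show ?thesis using S by (auto simp: Transposition.transpose_def)
    qed
    moreover have "\<sigma> v = v" "\<sigma> w = w" using permutes_not_in[OF sp] S by auto
    ultimately show "(\<Prod>t\<in>insert v (insert w S). of_bool (a t = b ((Transposition.transpose v w \<circ> \<sigma>) t)) :: complex) =
       (\<Prod>t\<in>S. of_bool (a t = b (\<sigma> t))) * (of_bool (a v = b w) * of_bool (a w = b v))"
      using S by simp
  qed
  finally show ?thesis by (simp add: wick_sum_def sum_distrib_right)
qed

lemma wick_sum_split:
  assumes "finite S"
  shows "wick_sum a b S P = wick_sum a b S (\<lambda>\<sigma>. P \<sigma> \<and> \<not> Q \<sigma>) + wick_sum a b S (\<lambda>\<sigma>. P \<sigma> \<and> Q \<sigma>)"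
proof -
  have f: "finite {\<sigma>. \<sigma> permutes S \<and> X \<sigma>}" for X
    by (rule finite_subset[OF _ finite_permutations[OF assms]]) auto
  show ?thesis unfolding wick_sum_def
    by (subst sum.union_disjoint[symmetric]) (auto simp: f intro!: sum.cong)
qed

lemma reduced_on_Suc:
  "reduced_on e (Suc (Suc p)) \<sigma> \<longleftrightarrow> reduced_on e (Suc p) \<sigma> \<and> \<sigma> (e (Suc p)) \<noteq> e (Suc p) \<and>
     \<not> (\<sigma> (e p) = e (Suc p) \<and> \<sigma> (e (Suc p)) = e p)"
  unfolding reduced_on_def Suc_less_eq All_less_Suc by blast

text \<open>The correction terms of this Chebyshev recursion cancel exactly those Wick pairings that fix a
  slot or match two neighbouring slots with each other, so only \<open>reduced_on\<close> permutations survive.\<close>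

fun rprod :: "('t \<Rightarrow> 'v) \<Rightarrow> ('t \<Rightarrow> 'v) \<Rightarrow> (nat \<Rightarrow> 't) \<Rightarrow> nat \<Rightarrow> ('v \<Rightarrow> complex) \<Rightarrow> complex" where
  "rprod a b e 0 x = 1"
| "rprod a b e (Suc 0) x = x (a (e 0)) * cnj (x (b (e 0))) - of_bool (a (e 0) = b (e 0))"
| "rprod a b e (Suc (Suc p)) x =
     rprod a b e (Suc p) x * (x (a (e (Suc p))) * cnj (x (b (e (Suc p)))) - of_bool (a (e (Suc p)) = b (e (Suc p))))
     - rprod a b e p x * (of_bool (a (e p) = b (e (Suc p))) * of_bool (a (e (Suc p)) = b (e p)))"

text \<open>The slots \<open>T\<close>, left as plain products, strengthen the induction: the newest
  slot can be moved among them. \<open>R\<close> is a factor on the slots \<open>S0\<close> that has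
  been treated before, which allows one circle to be processed after another; \<open>Pswap\<close>
  says that its predicate does not notice 2-cycles outside \<open>S0\<close>.\<close>

lemma rprod_wick:
  fixes R :: "('v \<Rightarrow> complex) \<Rightarrow> complex"
  assumes fin: "finite U" "finite S0" and e: "inj e" and eS: "range e \<inter> S0 = {}" and eU: "e ` {..<p} \<subseteq> U"
    and Pswap: "\<And>\<sigma> v w. v \<notin> S0 \<Longrightarrow> w \<notin> S0 \<Longrightarrow> \<sigma> v = v \<Longrightarrow> \<sigma> w = w \<Longrightarrow> inj \<sigma> \<Longrightarrow> P (Transposition.transpose v w \<circ> \<sigma>) \<longleftrightarrow> P \<sigma>"
    and R: "\<And>T. T \<subseteq> U \<Longrightarrow> T \<inter> S0 = {} \<Longrightarrow>
        has_bochner_integral M (\<lambda>x. R x * (\<Prod>t\<in>T. x (a t) * cnj (x (b t)))) (wick_sum a b (S0 \<union> T) P)"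
    and T: "T \<subseteq> U" "T \<inter> S0 = {}" "T \<inter> e ` {..<p} = {}"
  shows "has_bochner_integral M (\<lambda>x. R x * rprod a b e p x * (\<Prod>t\<in>T. x (a t) * cnj (x (b t))))
     (wick_sum a b (S0 \<union> e ` {..<p} \<union> T) (\<lambda>\<sigma>. P \<sigma> \<and> reduced_on e p \<sigma>))"
proof -
  have eS': "e i \<notin> S0" for i using eS by auto
  show ?thesis
  using eU T
proof (induction p arbitrary: T rule: induct_nat_012)
  case 0
  then show ?case using R[of T] by (simp add: reduced_on_def)
next
  case 1
  let ?w = "e 0"
  let ?S = "S0 \<union> T"
  have w: "?w \<in> U" "?w \<notin> ?S" "?w \<notin> T" "?w \<notin> S0" using 1 eS' by auto
  have fT: "finite T" "finite ?S" using 1 fin finite_subset by auto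
  have h1: "has_bochner_integral M (\<lambda>x. R x * (\<Prod>t\<in>insert ?w T. x (a t) * cnj (x (b t)))) (wick_sum a b (insert ?w ?S) P)"
    using R[of "insert ?w T"] 1 w by (simp add: insert_commute)
  have h2: "has_bochner_integral M (\<lambda>x. R x * (\<Prod>t\<in>T. x (a t) * cnj (x (b t)))) (wick_sum a b ?S P)"
    using R[of T] 1 by simp
  have "has_bochner_integral M (\<lambda>x. R x * (\<Prod>t\<in>insert ?w T. x (a t) * cnj (x (b t))) -
       (R x * (\<Prod>t\<in>T. x (a t) * cnj (x (b t)))) * of_bool (a ?w = b ?w))
     (wick_sum a b (insert ?w ?S) P - wick_sum a b ?S P * of_bool (a ?w = b ?w))"
    by (intro has_bochner_integral_diff has_bochner_integral_mult_left h1 h2)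
  moreover have "wick_sum a b (insert ?w ?S) P - wick_sum a b ?S P * of_bool (a ?w = b ?w) =
      wick_sum a b (insert ?w ?S) (\<lambda>\<sigma>. P \<sigma> \<and> \<sigma> ?w \<noteq> ?w)"
    using wick_sum_split[of "insert ?w ?S" a b P "\<lambda>\<sigma>. \<sigma> ?w = ?w"] wick_sum_fixed[OF fT(2) w(2), of a b P] fT
    by simp
  moreover have "S0 \<union> e ` {..<Suc 0} \<union> T = insert ?w ?S" by auto
  ultimately show ?case using fT w by (simp add: reduced_on_def algebra_simps)
next
  case (ge2 p)
  let ?w = "e (Suc p)"
  let ?v = "e p"
  let ?S1 = "S0 \<union> e ` {..<Suc p} \<union> T"
  let ?S2 = "S0 \<union> e ` {..<p} \<union> T"
  let ?\<pi> = "\<lambda>T x. \<Prod>t\<in>T. x (a t) * cnj (x (b t))"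
  let ?P1 = "\<lambda>\<sigma>. P \<sigma> \<and> reduced_on e (Suc p) \<sigma>"
  let ?P2 = "\<lambda>\<sigma>. P \<sigma> \<and> reduced_on e p \<sigma>"
  have ei: "e i = e j \<longleftrightarrow> i = j" for i j using e by (auto simp: inj_eq)
  have w: "?w \<in> U" "?w \<notin> ?S1" "?w \<notin> T" "?w \<notin> S0" "?w \<notin> ?S2" using ge2(3-) eS' by (auto simp: ei)
  have v: "?v \<notin> S0" "?v \<notin> ?S2" "?v \<noteq> ?w" using ge2(3-) eS' by (auto simp: ei)
  have fT: "finite T" "finite ?S1" "finite ?S2" using ge2(3-) fin finite_subset by auto
  have S12: "?S1 = insert ?v ?S2" by (auto simp: lessThan_Suc)
  have S0': "S0 \<union> e ` {..<Suc (Suc p)} \<union> T = insert ?w ?S1" by (auto simp: lessThan_Suc)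
  have S0'': "insert ?w ?S1 = insert ?v (insert ?w ?S2)" using S12 by auto
  have sub: "e ` {..<Suc p} \<subseteq> U" "e ` {..<p} \<subseteq> U" "insert ?w T \<subseteq> U" using ge2(3,4) w(1) by auto
  have dis: "insert ?w T \<inter> S0 = {}" "insert ?w T \<inter> e ` {..<Suc p} = {}" "T \<inter> e ` {..<Suc p} = {}" "T \<inter> e ` {..<p} = {}"
    using ge2(5,6) w by (auto simp: ei)
  have ins: "S0 \<union> e ` {..<Suc p} \<union> insert ?w T = insert ?w ?S1" by simp
  \<comment> \<open>The leading term of the recursion is covered by the hypothesis for
    \<open>Suc p\<close> with \<open>?w\<close> as an additional plain slot.\<close>
  have h1: "has_bochner_integral M (\<lambda>x. R x * rprod a b e (Suc p) x * ?\<pi> (insert ?w T) x) (wick_sum a b (insert ?w ?S1) ?P1)"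
    using ge2(2)[OF sub(1) sub(3) dis(1,2)] unfolding ins .
  have h2: "has_bochner_integral M (\<lambda>x. R x * rprod a b e (Suc p) x * ?\<pi> T x) (wick_sum a b ?S1 ?P1)"
    by (rule ge2(2)[OF sub(1) ge2(4,5) dis(3)])
  have h3: "has_bochner_integral M (\<lambda>x. R x * rprod a b e p x * ?\<pi> T x) (wick_sum a b ?S2 ?P2)"
    by (rule ge2(1)[OF sub(2) ge2(4,5) dis(4)])
  let ?c = "of_bool (a ?v = b ?w) * of_bool (a ?w = b ?v) :: complex"
  have f1: "has_bochner_integral M (\<lambda>x. R x * rprod a b e (Suc p) x * ?\<pi> (insert ?w T) x -
       (R x * rprod a b e (Suc p) x * ?\<pi> T x) * of_bool (a ?w = b ?w) -
       (R x * rprod a b e p x * ?\<pi> T x) * ?c)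
     (wick_sum a b (insert ?w ?S1) ?P1 - wick_sum a b ?S1 ?P1 * of_bool (a ?w = b ?w) - wick_sum a b ?S2 ?P2 * ?c)"
    by (intro has_bochner_integral_diff has_bochner_integral_mult_left h1 h2 h3)
  have f2: "(\<lambda>x. R x * rprod a b e (Suc p) x * ?\<pi> (insert ?w T) x -
       (R x * rprod a b e (Suc p) x * ?\<pi> T x) * of_bool (a ?w = b ?w) -
       (R x * rprod a b e p x * ?\<pi> T x) * ?c) = (\<lambda>x. R x * rprod a b e (Suc (Suc p)) x * ?\<pi> T x)"
    using fT w by (intro ext) (simp add: algebra_simps)
  \<comment> \<open>Among the permutations reduced up to \<open>?v\<close>, the first correction
    removes those that fix \<open>?w\<close>, the second those that swap \<open>?v\<close> and
    \<open>?w\<close>. The two sets are disjoint, and what remains is reduced one slot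
    further.\<close>
  have f3: "wick_sum a b (insert ?w ?S1) ?P1 - wick_sum a b ?S1 ?P1 * of_bool (a ?w = b ?w) - wick_sum a b ?S2 ?P2 * ?c
     = wick_sum a b (insert ?w ?S1) (\<lambda>\<sigma>. P \<sigma> \<and> reduced_on e (Suc (Suc p)) \<sigma>)"
  proof -
    have sw: "(?P1 (Transposition.transpose ?v ?w \<circ> \<sigma>)) \<longleftrightarrow> ?P2 \<sigma>" if s: "\<sigma> permutes ?S2" for \<sigma>
    proof -
      have fx: "\<sigma> ?v = ?v" "\<sigma> ?w = ?w" using permutes_not_in[OF s] v w by auto
      have "P (Transposition.transpose ?v ?w \<circ> \<sigma>) \<longleftrightarrow> P \<sigma>"
        by (rule Pswap) (use fx v w permutes_inj[OF s] in auto)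
      moreover have "reduced_on e (Suc p) (Transposition.transpose ?v ?w \<circ> \<sigma>) \<longleftrightarrow> reduced_on e p \<sigma>"
      proof -
        have eq: "(Transposition.transpose ?v ?w \<circ> \<sigma>) (e t) = \<sigma> (e t)" if "t < p" for t
        proof -
          have "\<sigma> (e t) \<in> ?S2" using permutes_in_image[OF s] that by auto
          then have "\<sigma> (e t) \<noteq> ?v" "\<sigma> (e t) \<noteq> ?w" using v w by metis+
          then show ?thesis by (simp add: Transposition.transpose_def)
        qed
        \<comment> \<open>After the composition \<open>?v\<close> is sent to \<open>?w\<close>,
          beyond the first \<open>Suc p\<close> slots, so it neither is fixed nor forms a swapped
          pair with its predecessor.\<close>
        have pv: "(Transposition.transpose ?v ?w \<circ> \<sigma>) ?v = ?w" using fx by simp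
        have sv: "\<sigma> (e t) \<noteq> ?v" if "t < p" for t
        proof -
          have "\<sigma> (e t) \<in> ?S2" using permutes_in_image[OF s] that by auto
          then show ?thesis using v by metis
        qed
        show ?thesis
        proof
          assume r: "reduced_on e (Suc p) (Transposition.transpose ?v ?w \<circ> \<sigma>)"
          show "reduced_on e p \<sigma>" unfolding reduced_on_def
          proof (intro conjI allI impI)
            fix t assume t: "t < p"
            then have "(Transposition.transpose ?v ?w \<circ> \<sigma>) (e t) \<noteq> e t" using r less_SucI unfolding reduced_on_def by blast
            then show "\<sigma> (e t) \<noteq> e t" using eq[OF t] by simp
          next
            fix t assume t: "Suc t < p"
            have "\<not> ((Transposition.transpose ?v ?w \<circ> \<sigma>) (e t) = e (Suc t) \<and> (Transposition.transpose ?v ?w \<circ> \<sigma>) (e (Suc t)) = e t)"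
              using r t less_SucI unfolding reduced_on_def by blast
            then show "\<not> (\<sigma> (e t) = e (Suc t) \<and> \<sigma> (e (Suc t)) = e t)"
              using eq[of t] eq[of "Suc t"] t by simp
          qed
        next
          assume r: "reduced_on e p \<sigma>"
          show "reduced_on e (Suc p) (Transposition.transpose ?v ?w \<circ> \<sigma>)" unfolding reduced_on_def
          proof (intro conjI allI impI)
            fix t assume "t < Suc p"
            then consider "t < p" | "t = p" by linarith
            then show "(Transposition.transpose ?v ?w \<circ> \<sigma>) (e t) \<noteq> e t"
            proof cases
              case 1
              then show ?thesis using r eq[of t] by (simp add: reduced_on_def)
            next
              case 2
              then show ?thesis using pv v by auto
            qed
          next
            fix t assume t: "Suc t < Suc p"
            show "\<not> ((Transposition.transpose ?v ?w \<circ> \<sigma>) (e t) = e (Suc t) \<and> (Transposition.transpose ?v ?w \<circ> \<sigma>) (e (Suc t)) = e t)"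
            proof (cases "Suc t = p")
              case True
              then show ?thesis using eq[of t] sv[of t] t by auto
            next
              case False
              then have "Suc t < p" using t by simp
              then show ?thesis using eq[of t] eq[of "Suc t"] r by (simp add: reduced_on_def)
            qed
          qed
        qed
      qed
      ultimately show ?thesis by simp
    qed
    have e1: "wick_sum a b (insert ?w ?S1) ?P1 = wick_sum a b (insert ?w ?S1) (\<lambda>\<sigma>. ?P1 \<sigma> \<and> \<sigma> ?w \<noteq> ?w) + wick_sum a b ?S1 ?P1 * of_bool (a ?w = b ?w)"
      using wick_sum_split[of "insert ?w ?S1" a b ?P1 "\<lambda>\<sigma>. \<sigma> ?w = ?w"] wick_sum_fixed[OF fT(2) w(2), of a b ?P1] fT
      by simp
    have e2: "wick_sum a b (insert ?w ?S1) (\<lambda>\<sigma>. ?P1 \<sigma> \<and> \<sigma> ?w \<noteq> ?w) =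
       wick_sum a b (insert ?w ?S1) (\<lambda>\<sigma>. (?P1 \<sigma> \<and> \<sigma> ?w \<noteq> ?w) \<and> \<not> (\<sigma> ?v = ?w \<and> \<sigma> ?w = ?v)) +
       wick_sum a b (insert ?w ?S1) (\<lambda>\<sigma>. (?P1 \<sigma> \<and> \<sigma> ?w \<noteq> ?w) \<and> (\<sigma> ?v = ?w \<and> \<sigma> ?w = ?v))"
      by (rule wick_sum_split) (use fT in simp)
    have e3: "(\<lambda>\<sigma>. (?P1 \<sigma> \<and> \<sigma> ?w \<noteq> ?w) \<and> (\<sigma> ?v = ?w \<and> \<sigma> ?w = ?v)) = (\<lambda>\<sigma>. ?P1 \<sigma> \<and> \<sigma> ?v = ?w \<and> \<sigma> ?w = ?v)"
      using v(3) by (intro ext) metis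
    have e4: "wick_sum a b (insert ?w ?S1) (\<lambda>\<sigma>. ?P1 \<sigma> \<and> \<sigma> ?v = ?w \<and> \<sigma> ?w = ?v) = wick_sum a b ?S2 ?P2 * ?c"
      unfolding S0'' by (rule wick_sum_swap[OF fT(3) v(2) w(5) v(3), where P = ?P2 and P' = ?P1]) (rule sw)
    have e5: "(\<lambda>\<sigma>. (?P1 \<sigma> \<and> \<sigma> ?w \<noteq> ?w) \<and> \<not> (\<sigma> ?v = ?w \<and> \<sigma> ?w = ?v)) = (\<lambda>\<sigma>. P \<sigma> \<and> reduced_on e (Suc (Suc p)) \<sigma>)"
      unfolding reduced_on_Suc by (rule ext) blast
    show ?thesis using e1 e2 unfolding e3 e4 e5 by simp
  qed
  from f1 show ?case unfolding S0' f2 f3 .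
qed
qed

subsection \<open>Chebyshev traces as sums over closed walks\<close>

definition mix :: "nat \<Rightarrow> nat \<Rightarrow> nat \<Rightarrow> nat" where
  "mix d p q = (p div d) * d + q mod d"

lemma mix_lt: assumes "p < d * d" shows "mix d p q < d * d"
proof -
  have d: "0 < d" using assms by (cases d) auto
  have "p div d < d" using assms by (simp add: less_mult_imp_div_less)
  then have "(p div d) * d + q mod d < (p div d) * d + d" "(p div d) * d + d \<le> d * d"
    using d mult_le_mono1[of "Suc (p div d)" d d] by simp_all
  then show ?thesis by (simp add: mix_def)
qed

lemma mix_eq_iff: assumes "0 < d" shows "mix d p q = mix d p' q' \<longleftrightarrow> p div d = p' div d \<and> q mod d = q' mod d"
proof
  assume "mix d p q = mix d p' q'"
  then have "mix d p q div d = mix d p' q' div d" "mix d p q mod d = mix d p' q' mod d" by simp_all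
  then show "p div d = p' div d \<and> q mod d = q' mod d" using assms by (simp add: mix_def)
qed (simp add: mix_def)

lemma div_mod_eq_iff: "(p div d = q div d \<and> p mod d = q mod d) \<longleftrightarrow> p = (q::nat)"
  by (metis div_mult_mod_eq)

text \<open>The entry of the partial transpose minus \<open>s\<close> times the identity. The shift
  is distributed over \<open>k\<close>, so that each summand is one factor of \<open>rprod\<close>
  with its own self-pairing subtracted.\<close>

definition centered_entry :: "nat \<Rightarrow> nat \<Rightarrow> (nat \<times> nat \<Rightarrow> complex) \<Rightarrow> nat \<Rightarrow> nat \<Rightarrow> complex" where
  "centered_entry d s x p q = (\<Sum>k<s. x (mix d p q, k) * cnj (x (mix d q p, k)) - of_bool (p = q))"

text \<open>With \<open>c = n * s\<close> this is (ns)^(p/2) times the Chebyshev polynomial of the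
  matrix divided by sqrt (ns); the homogeneous form avoids square roots.\<close>

fun cheb_entry :: "(nat \<Rightarrow> nat \<Rightarrow> complex) \<Rightarrow> nat \<Rightarrow> complex \<Rightarrow> nat \<Rightarrow> nat \<Rightarrow> nat \<Rightarrow> complex" where
  "cheb_entry B n c 0 y z = of_bool (y = z)"
| "cheb_entry B n c (Suc 0) y z = B y z"
| "cheb_entry B n c (Suc (Suc p)) y z = (\<Sum>w<n. cheb_entry B n c (Suc p) y w * B w z) - c * cheb_entry B n c p y z"

lemma sum_PiE_Suc:
  "(\<Sum>f\<in>{..<Suc p} \<rightarrow>\<^sub>E A. F f) = (\<Sum>w\<in>A. \<Sum>f\<in>{..<p} \<rightarrow>\<^sub>E A. F (f(p := w)))"
proof -
  let ?u = "\<lambda>x. (snd x)(p := fst x)"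
  have eq: "{..<Suc p} \<rightarrow>\<^sub>E A = ?u ` (A \<times> ({..<p} \<rightarrow>\<^sub>E A))"
    unfolding lessThan_Suc by (subst PiE_insert_eq) (simp only: case_prod_unfold)
  have inj: "inj_on ?u (A \<times> ({..<p} \<rightarrow>\<^sub>E A))"
    using inj_combinator[of p "{..<p}" "\<lambda>_. A"] by (simp add: case_prod_unfold)
  have "(\<Sum>f\<in>{..<Suc p} \<rightarrow>\<^sub>E A. F f) = (\<Sum>x\<in>A \<times> ({..<p} \<rightarrow>\<^sub>E A). F (?u x))"
    unfolding eq sum.reindex[OF inj] o_def ..
  then show ?thesis by (simp only: sum.cartesian_product case_prod_unfold)
qed

lemma rprod_cong:
  assumes "\<And>t. t < p \<Longrightarrow> a (e t) = a' (e' t)" "\<And>t. t < p \<Longrightarrow> b (e t) = b' (e' t)"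
  shows "rprod a b e p x = rprod a' b' e' p x"
  using assms by (induction p rule: induct_nat_012) auto

text \<open>Step \<open>t\<close> of a walk leads from the vertex \<open>vert y v t\<close> to the vertex \<open>v t\<close> and carries an
  environment index \<open>k t\<close>; a vertex is a basis index \<open>i * d + j\<close> of the bipartite system.\<close>

definition vert :: "nat \<Rightarrow> (nat \<Rightarrow> nat) \<Rightarrow> nat \<Rightarrow> nat" where
  "vert y v t = (case t of 0 \<Rightarrow> y | Suc u \<Rightarrow> v u)"

lemma vert_simps [simp]: "vert y v 0 = y" "vert y v (Suc u) = v u"
  by (simp_all add: vert_def)

definition path_a :: "nat \<Rightarrow> nat \<Rightarrow> (nat \<Rightarrow> nat) \<Rightarrow> (nat \<Rightarrow> nat) \<Rightarrow> nat \<Rightarrow> nat \<times> nat" where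
  "path_a d y v k t = (mix d (vert y v t) (v t), k t)"

definition path_b :: "nat \<Rightarrow> nat \<Rightarrow> (nat \<Rightarrow> nat) \<Rightarrow> (nat \<Rightarrow> nat) \<Rightarrow> nat \<Rightarrow> nat \<times> nat" where
  "path_b d y v k t = (mix d (v t) (vert y v t), k t)"

definition path_prod :: "nat \<Rightarrow> nat \<Rightarrow> (nat \<Rightarrow> nat) \<Rightarrow> (nat \<Rightarrow> nat) \<Rightarrow> nat \<Rightarrow> (nat \<times> nat \<Rightarrow> complex) \<Rightarrow> complex" where
  "path_prod d y v k p x = rprod (path_a d y v k) (path_b d y v k) (\<lambda>t. t) p x"

lemma vert_upd: "t \<le> p \<Longrightarrow> vert y (v(p := w)) t = vert y v t"
  by (cases t) auto

lemma path_prod_upd: "p \<le> q \<Longrightarrow> path_prod d y (v(q := w)) (k(q := l)) p x = path_prod d y v k p x"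
  unfolding path_prod_def by (rule rprod_cong) (auto simp: path_a_def path_b_def vert_upd)

lemma mix_swap_iff:
  assumes "0 < d" shows "mix d p q = mix d q p \<longleftrightarrow> p = q"
  using mix_eq_iff[OF assms, of p q q p] div_mod_eq_iff[of p d q] by auto

text \<open>The neighbour correction is active exactly when the last step retraces the previous one
  with the same environment index: one equation compares the \<open>div\<close> halves of the end
  vertices, the other the \<open>mod\<close> halves.\<close>

lemma path_prod_Suc_Suc:
  assumes d: "0 < d"
  shows "path_prod d y (v(p := w, Suc p := z)) (k(p := l', Suc p := l)) (Suc (Suc p)) x =
     path_prod d y (v(p := w)) (k(p := l')) (Suc p) x * (x (mix d w z, l) * cnj (x (mix d z w, l)) - of_bool (w = z))
     - path_prod d y v k p x * of_bool (z = vert y v p \<and> l = l')"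
proof -
  let ?v = "v(p := w, Suc p := z)" and ?k = "k(p := l', Suc p := l)"
  have 1: "path_prod d y ?v ?k (Suc p) x = path_prod d y (v(p := w)) (k(p := l')) (Suc p) x"
    by (rule path_prod_upd) simp
  have 2: "path_prod d y ?v ?k p x = path_prod d y v k p x"
    by (simp add: path_prod_upd)
  have vp: "vert y ?v p = vert y v p" by (simp add: vert_upd)
  have ab: "path_a d y ?v ?k (Suc p) = (mix d w z, l)" "path_b d y ?v ?k (Suc p) = (mix d z w, l)"
     "path_a d y ?v ?k p = (mix d (vert y v p) w, l')" "path_b d y ?v ?k p = (mix d w (vert y v p), l')"
    by (simp_all add: path_a_def path_b_def vp del: fun_upd_apply) simp_all
  have eq: "(mix d w z, l) = (mix d z w, l) \<longleftrightarrow> w = z" using mix_swap_iff[OF d] by simp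
  have eq2: "(mix d (vert y v p) w, l') = (mix d z w, l) \<and> (mix d w z, l) = (mix d w (vert y v p), l') \<longleftrightarrow> z = vert y v p \<and> l = l'"
    using div_mod_eq_iff[of z d "vert y v p"] by (auto simp: mix_eq_iff[OF d])
  have "path_prod d y ?v ?k (Suc (Suc p)) x =
     path_prod d y ?v ?k (Suc p) x * (x (mix d w z, l) * cnj (x (mix d z w, l)) - of_bool (w = z))
     - path_prod d y ?v ?k p x * of_bool (z = vert y v p \<and> l = l')"
    unfolding path_prod_def rprod.simps ab eq of_bool_conj[symmetric] eq2 ..
  then show ?thesis unfolding 1 2 .
qed

lemma path_prod_1:
  assumes d: "0 < d"
  shows "path_prod d y (v(0 := z)) (k(0 := l)) (Suc 0) x = x (mix d y z, l) * cnj (x (mix d z y, l)) - of_bool (y = z)"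
  using mix_swap_iff[OF d] by (simp add: path_prod_def path_a_def path_b_def)

text \<open>The arbitrary function \<open>h\<close> of the end vertex makes the induction work: the
  last matrix factor is absorbed into \<open>h\<close>, which leaves a shorter walk with a new end
  function.\<close>

lemma path_sum:
  fixes d s :: nat and h :: "nat \<Rightarrow> complex"
  defines "n \<equiv> d * d"
  assumes d: "0 < d" and y: "y < n"
  shows "(\<Sum>v\<in>{..<p} \<rightarrow>\<^sub>E {..<n}. \<Sum>k\<in>{..<p} \<rightarrow>\<^sub>E {..<s}. h (vert y v p) * path_prod d y v k p x)
    = (\<Sum>z<n. h z * cheb_entry (centered_entry d s x) n (of_nat (n * s)) p y z)"
proof (induction p arbitrary: h rule: induct_nat_012)
  case 0
  then show ?case using y by (simp add: path_prod_def sum.delta' if_distrib[of "\<lambda>c. _ * c"] of_bool_def cong: if_cong)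
next
  case 1
  have "(\<Sum>v\<in>{..<Suc 0} \<rightarrow>\<^sub>E {..<n}. \<Sum>k\<in>{..<Suc 0} \<rightarrow>\<^sub>E {..<s}. h (vert y v (Suc 0)) * path_prod d y v k (Suc 0) x)
     = (\<Sum>z<n. \<Sum>l<s. h z * (x (mix d y z, l) * cnj (x (mix d z y, l)) - of_bool (y = z)))"
    unfolding sum_PiE_Suc by (simp add: path_prod_1[OF d])
  then show ?case by (simp add: centered_entry_def sum_distrib_left)
next
  case (ge2 p)
  let ?V = "{..<p} \<rightarrow>\<^sub>E {..<n}" and ?K = "{..<p} \<rightarrow>\<^sub>E {..<s}"
  let ?B = "centered_entry d s x"
  let ?m = "\<lambda>w z l. x (mix d w z, l) * cnj (x (mix d z w, l)) - of_bool (w = z)"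
  let ?U = "cheb_entry ?B n (of_nat (n * s))"
  have "(\<Sum>v\<in>{..<Suc (Suc p)} \<rightarrow>\<^sub>E {..<n}. \<Sum>k\<in>{..<Suc (Suc p)} \<rightarrow>\<^sub>E {..<s}. h (vert y v (Suc (Suc p))) * path_prod d y v k (Suc (Suc p)) x)
    = (\<Sum>z<n. \<Sum>w<n. \<Sum>v\<in>?V. \<Sum>l<s. \<Sum>l'<s. \<Sum>k\<in>?K. h z * (path_prod d y (v(p := w)) (k(p := l')) (Suc p) x * ?m w z l
     - path_prod d y v k p x * of_bool (z = vert y v p \<and> l = l')))"
    unfolding sum_PiE_Suc path_prod_Suc_Suc[OF d] by simp
  also have "\<dots> = (\<Sum>z<n. \<Sum>w<n. \<Sum>v\<in>?V. \<Sum>l<s. \<Sum>l'<s. \<Sum>k\<in>?K. h z * ?m w z l * path_prod d y (v(p := w)) (k(p := l')) (Suc p) x)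
    - (\<Sum>z<n. \<Sum>w<n. \<Sum>v\<in>?V. \<Sum>l<s. \<Sum>l'<s. \<Sum>k\<in>?K. h z * (path_prod d y v k p x * of_bool (z = vert y v p \<and> l = l')))"
    (is "_ = ?X - ?Y")
    by (simp only: right_diff_distrib sum_subtractf mult_ac)
  also have "?X = (\<Sum>w<n. \<Sum>v\<in>?V. \<Sum>l'<s. \<Sum>k\<in>?K. (\<Sum>z<n. h z * ?B w z) * path_prod d y (v(p := w)) (k(p := l')) (Suc p) x)"
  proof -
    define P where "P w v = (\<Sum>l'<s. \<Sum>k\<in>?K. path_prod d y (v(p := w)) (k(p := l')) (Suc p) x)" for w v
    have 1: "(\<Sum>l<s. \<Sum>l'<s. \<Sum>k\<in>?K. h z * ?m w z l * path_prod d y (v(p := w)) (k(p := l')) (Suc p) x)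
        = h z * ?B w z * P w v" for z w v
      unfolding P_def centered_entry_def by (simp only: sum_distrib_left[symmetric] sum_distrib_right[symmetric])
    have 2: "(\<Sum>l'<s. \<Sum>k\<in>?K. (\<Sum>z<n. h z * ?B w z) * path_prod d y (v(p := w)) (k(p := l')) (Suc p) x)
        = (\<Sum>z<n. h z * ?B w z) * P w v" for w v
      unfolding P_def by (simp only: sum_distrib_left[symmetric])
    have "(\<Sum>z<n. \<Sum>w<n. \<Sum>v\<in>?V. h z * ?B w z * P w v) = (\<Sum>w<n. \<Sum>z<n. \<Sum>v\<in>?V. h z * ?B w z * P w v)"
      by (rule sum.swap)
    also have "\<dots> = (\<Sum>w<n. \<Sum>v\<in>?V. (\<Sum>z<n. h z * ?B w z) * P w v)"
      unfolding sum_distrib_right by (intro sum.cong refl sum.swap)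
    finally show ?thesis unfolding 1 2 .
  qed
  also have "\<dots> = (\<Sum>v\<in>{..<Suc p} \<rightarrow>\<^sub>E {..<n}. \<Sum>k\<in>{..<Suc p} \<rightarrow>\<^sub>E {..<s}. (\<Sum>z<n. h z * ?B (vert y v (Suc p)) z) * path_prod d y v k (Suc p) x)"
    unfolding sum_PiE_Suc by simp
  also have "\<dots> = (\<Sum>w<n. (\<Sum>z<n. h z * ?B w z) * ?U (Suc p) y w)"
    by (rule ge2(2))
  also have "\<dots> = (\<Sum>z<n. h z * (\<Sum>w<n. ?U (Suc p) y w * ?B w z))"
    unfolding sum_distrib_left sum_distrib_right by (subst sum.swap) (simp only: mult_ac)
  \<comment> \<open>A retraced step returns to the vertex \<open>p\<close> but leaves its
    intermediate vertex and its environment index free. This is where the constant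
    \<open>n * s\<close> of the Chebyshev recursion comes from.\<close>
  also have "?Y = (\<Sum>v\<in>?V. \<Sum>k\<in>?K. of_nat (n * s) * (h (vert y v p) * path_prod d y v k p x))"
  proof -
    have inner: "(\<Sum>z<n. \<Sum>w<n. \<Sum>l<s. \<Sum>l'<s. h z * (path_prod d y v k p x * of_bool (z = vert y v p \<and> l = l')))
       = of_nat (n * s) * (h (vert y v p) * path_prod d y v k p x)" if v: "v \<in> ?V" for v k
    proof -
      have vn: "vert y v p < n" using v y by (cases p) auto
      have z: "(\<Sum>l<s. \<Sum>l'<s. h z * (path_prod d y v k p x * of_bool (z = vert y v p \<and> l = l')))
         = (if z = vert y v p then of_nat s * (h z * path_prod d y v k p x) else 0)" for z
      proof -
        have "(\<Sum>l'<s. h z * (path_prod d y v k p x * of_bool (z = vert y v p \<and> l = l')))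
          = (if z = vert y v p then h z * path_prod d y v k p x else 0)" if "l < s" for l
        proof -
          have "(\<Sum>l'<s. h z * (path_prod d y v k p x * of_bool (z = vert y v p \<and> l = l')))
            = (\<Sum>l'<s. if l = l' then (if z = vert y v p then h z * path_prod d y v k p x else 0) else 0)"
            by (rule sum.cong) auto
          then show ?thesis using that by (simp only: sum.delta'[OF finite_lessThan]) simp
        qed
        then have "(\<Sum>l<s. \<Sum>l'<s. h z * (path_prod d y v k p x * of_bool (z = vert y v p \<and> l = l')))
          = (\<Sum>l<s. if z = vert y v p then h z * path_prod d y v k p x else 0)" by (intro sum.cong refl) simp
        then show ?thesis by (simp only: sum_constant card_lessThan) simp
      qed
      have "(\<Sum>z<n. \<Sum>w<n. \<Sum>l<s. \<Sum>l'<s. h z * (path_prod d y v k p x * of_bool (z = vert y v p \<and> l = l')))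
         = (\<Sum>z<n. if z = vert y v p then of_nat n * (of_nat s * (h z * path_prod d y v k p x)) else 0)"
        unfolding z by (intro sum.cong refl) simp
      also have "\<dots> = of_nat n * (of_nat s * (h (vert y v p) * path_prod d y v k p x))"
        using vn by simp
      finally show ?thesis by simp
    qed
    have "?Y = (\<Sum>v\<in>?V. \<Sum>k\<in>?K. \<Sum>z<n. \<Sum>w<n. \<Sum>l<s. \<Sum>l'<s. h z * (path_prod d y v k p x * of_bool (z = vert y v p \<and> l = l')))"
      by (simp only: sum.swap[of _ "{..<n}" ?V] sum.swap[of _ "{..<s}" ?K] sum.swap[of _ "{..<n}" ?K])
    also have "\<dots> = (\<Sum>v\<in>?V. \<Sum>k\<in>?K. of_nat (n * s) * (h (vert y v p) * path_prod d y v k p x))"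
      by (intro sum.cong refl inner)
    finally show ?thesis .
  qed
  also have "\<dots> = of_nat (n * s) * (\<Sum>v\<in>?V. \<Sum>k\<in>?K. h (vert y v p) * path_prod d y v k p x)"
    by (simp only: sum_distrib_left)
  also have "\<dots> = of_nat (n * s) * (\<Sum>z<n. h z * ?U p y z)"
    unfolding ge2(1) ..
  finally show ?case
    by (simp only: cheb_entry.simps right_diff_distrib sum_subtractf sum_distrib_left mult_ac)
qed

text \<open>Step \<open>t\<close> starts at the vertex \<open>v (\<delta> t)\<close>; splitting it
  into quotient and remainder modulo \<open>d\<close> gives \<open>i t\<close> and
  \<open>j t\<close>. By \<open>mix_eq_iff\<close> the equality of the two mixed indices then
  becomes the constraints on \<open>i\<close> and on \<open>j\<close> separately.\<close>

lemma card_compat_le: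
  fixes \<gamma> \<sigma> :: "'t \<Rightarrow> 't"
  assumes S: "finite S" and g: "\<gamma> permutes S" and s: "\<sigma> permutes S" and d: "0 < d"
  defines "\<delta> \<equiv> inv_into UNIV \<gamma>"
  shows "card {(v, k). v \<in> S \<rightarrow>\<^sub>E {..<d * d} \<and> k \<in> S \<rightarrow>\<^sub>E {..<s::nat} \<and>
      (\<forall>t\<in>S. (mix d (v (\<delta> t)) (v t), k t) = (mix d (v (\<sigma> t)) (v (\<delta> (\<sigma> t))), k (\<sigma> t)))}
    \<le> card (index_triples S \<gamma> \<sigma> d s)" (is "card ?C \<le> _")
proof -
  have dg: "\<delta> (\<gamma> t) = t" "\<gamma> (\<delta> t) = t" for t
    using permutes_inverses[OF g] by (simp_all add: \<delta>_def)
  have gS: "\<gamma> t \<in> S \<longleftrightarrow> t \<in> S" for t by (rule permutes_in_image[OF g])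
  have dS: "\<delta> t \<in> S \<longleftrightarrow> t \<in> S" for t using gS[of "\<delta> t"] dg by simp
  have sS: "\<sigma> t \<in> S \<longleftrightarrow> t \<in> S" for t by (rule permutes_in_image[OF s])
  define F where "F = (\<lambda>(v::'t \<Rightarrow> nat, k::'t \<Rightarrow> nat). (restrict (\<lambda>t. v (\<delta> t) div d) S, restrict (\<lambda>t. v (\<delta> t) mod d) S, k))"
  have "inj_on F ?C"
  proof (rule inj_onI, clarify)
    fix v k v' k' assume v: "v \<in> S \<rightarrow>\<^sub>E {..<d * d}" and v': "v' \<in> S \<rightarrow>\<^sub>E {..<d * d}" and eq: "F (v, k) = F (v', k')"
    have e1: "restrict (\<lambda>t. v (\<delta> t) div d) S = restrict (\<lambda>t. v' (\<delta> t) div d) S"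
      and e2: "restrict (\<lambda>t. v (\<delta> t) mod d) S = restrict (\<lambda>t. v' (\<delta> t) mod d) S" and "k = k'"
      using eq by (auto simp: F_def)
    have "v = v'"
    proof (rule PiE_ext[OF v v'])
      fix t assume t: "t \<in> S"
      then show "v t = v' t"
        using fun_cong[OF e1, of "\<gamma> t"] fun_cong[OF e2, of "\<gamma> t"] div_mod_eq_iff[of "v t" d "v' t"]
        by (simp add: gS dg)
    qed
    then show "v = v' \<and> k = k'" using \<open>k = k'\<close> by simp
  qed
  moreover have "F ` ?C \<subseteq> index_triples S \<gamma> \<sigma> d s"
  proof (rule image_subsetI, clarify)
    fix v k assume v: "v \<in> S \<rightarrow>\<^sub>E {..<d * d}" and k: "k \<in> S \<rightarrow>\<^sub>E {..<s}"
      and c: "\<forall>t\<in>S. (mix d (v (\<delta> t)) (v t), k t) = (mix d (v (\<sigma> t)) (v (\<delta> (\<sigma> t))), k (\<sigma> t))"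
    have vlt: "v t < d * d" if "t \<in> S" for t using PiE_mem[OF v that] by simp
    have lt: "v (\<delta> t) div d < d" if "t \<in> S" for t
      using vlt[of "\<delta> t"] that dS by (simp add: less_mult_imp_div_less)
    have eqs: "v (\<delta> t) div d = v (\<sigma> t) div d" "v t mod d = v (\<delta> (\<sigma> t)) mod d" "k t = k (\<sigma> t)" if "t \<in> S" for t
      using bspec[OF c that] by (simp_all only: mix_eq_iff[OF d] prod.inject)
    show "F (v, k) \<in> index_triples S \<gamma> \<sigma> d s"
      unfolding F_def index_triples_def prod.case mem_Collect_eq
    proof (intro conjI ballI)
      show "restrict (\<lambda>t. v (\<delta> t) div d) S \<in> S \<rightarrow>\<^sub>E {..<d}" using lt by (simp add: restrict_PiE_iff)
      show "restrict (\<lambda>t. v (\<delta> t) mod d) S \<in> S \<rightarrow>\<^sub>E {..<d}" using d by (simp add: restrict_PiE_iff)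
      show "k \<in> S \<rightarrow>\<^sub>E {..<s}" by (rule k)
      fix t assume t: "t \<in> S"
      show "restrict (\<lambda>t. v (\<delta> t) div d) S t = restrict (\<lambda>t. v (\<delta> t) div d) S (\<gamma> (\<sigma> t))"
        using t eqs(1)[OF t] by (simp only: restrict_apply gS sS dg if_True)
      show "restrict (\<lambda>t. v (\<delta> t) mod d) S (\<gamma> t) = restrict (\<lambda>t. v (\<delta> t) mod d) S (\<sigma> t)"
        using t eqs(2)[OF t] by (simp only: restrict_apply gS sS dg if_True)
      show "k t = k (\<sigma> t)" by (rule eqs(3)[OF t])
    qed
  qed
  moreover have "finite (index_triples S \<gamma> \<sigma> d s)"
  proof (rule finite_subset)
    show "index_triples S \<gamma> \<sigma> d s \<subseteq> (S \<rightarrow>\<^sub>E {..<d}) \<times> (S \<rightarrow>\<^sub>E {..<d}) \<times> (S \<rightarrow>\<^sub>E {..<s})"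
      by (auto simp: index_triples_def)
  qed (use S in \<open>simp add: finite_PiE\<close>)
  ultimately show ?thesis by (rule card_inj_on_le)
qed

lemma inv_csucc: "t < p \<Longrightarrow> vert (v (p - 1)) v t = v (inv_into UNIV (csucc p) t)"
proof -
  assume t: "t < p"
  have "csucc p (if t = 0 then p - 1 else t - 1) = t" using t by (auto simp: csucc_def)
  then have "inv_into UNIV (csucc p) t = (if t = 0 then p - 1 else t - 1)"
    using permutes_inverses(2)[OF csucc_permutes[of p]] by metis
  then show ?thesis by (cases t) auto
qed

definition cheb_trace :: "nat \<Rightarrow> nat \<Rightarrow> nat \<Rightarrow> (nat \<times> nat \<Rightarrow> complex) \<Rightarrow> complex" where
  "cheb_trace d s p x = (\<Sum>y<d * d. cheb_entry (centered_entry d s x) (d * d) (of_nat (d * d * s)) p y y)"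

text \<open>On a closed walk the base point equals the last vertex \<open>v (p - 1)\<close>, so it
  is eliminated by taking its indicator as the end function in \<open>path_sum\<close>.\<close>

lemma cheb_trace_path:
  assumes d: "0 < d" and p: "0 < p"
  shows "cheb_trace d s p x =
    (\<Sum>v\<in>{..<p} \<rightarrow>\<^sub>E {..<d * d}. \<Sum>k\<in>{..<p} \<rightarrow>\<^sub>E {..<s}. path_prod d (v (p - 1)) v k p x)"
proof -
  let ?U = "cheb_entry (centered_entry d s x) (d * d) (of_nat (d * d * s)) p"
  let ?V = "{..<p} \<rightarrow>\<^sub>E {..<d * d}" and ?K = "{..<p} \<rightarrow>\<^sub>E {..<s}"
  have vp: "vert y v p = v (p - 1)" for y v using p by (cases p) auto
  have U: "?U y y = (\<Sum>v\<in>?V. \<Sum>k\<in>?K. of_bool (v (p - 1) = y) * path_prod d y v k p x)" if y: "y < d * d" for y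
  proof -
    have "(\<Sum>v\<in>?V. \<Sum>k\<in>?K. of_bool (v (p - 1) = y) * path_prod d y v k p x) = (\<Sum>z<d * d. of_bool (z = y) * ?U y z)"
      using path_sum[OF d y, where h = "\<lambda>z. of_bool (z = y)" and p = p and s = s and x = x] unfolding vp .
    also have "\<dots> = (\<Sum>z<d * d. if z = y then ?U y z else 0)"
    proof (rule sum.cong[OF refl])
      show "of_bool (z = y) * ?U y z = (if z = y then ?U y z else 0)" for z by (cases "z = y") simp_all
    qed
    also have "\<dots> = ?U y y" using y by (simp only: sum.delta[OF finite_lessThan] lessThan_iff if_True)
    finally show ?thesis ..
  qed
  have "cheb_trace d s p x = (\<Sum>y<d * d. \<Sum>v\<in>?V. \<Sum>k\<in>?K. of_bool (v (p - 1) = y) * path_prod d y v k p x)"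
    unfolding cheb_trace_def by (rule sum.cong[OF refl]) (simp only: lessThan_iff U)
  also have "\<dots> = (\<Sum>v\<in>?V. \<Sum>k\<in>?K. \<Sum>y<d * d. of_bool (v (p - 1) = y) * path_prod d y v k p x)"
    by (subst sum.swap) (intro sum.cong refl sum.swap)
  also have "\<dots> = (\<Sum>v\<in>?V. \<Sum>k\<in>?K. path_prod d (v (p - 1)) v k p x)"
  proof (intro sum.cong refl)
    fix v k assume v: "v \<in> ?V"
    then have "v (p - 1) < d * d" using PiE_mem[of v "{..<p}" "\<lambda>_. {..<d * d}" "p - 1"] p by simp
    moreover have "(\<Sum>y<d * d. of_bool (v (p - 1) = y) * path_prod d y v k p x) = (\<Sum>y<d * d. if v (p - 1) = y then path_prod d y v k p x else 0)"
    proof (rule sum.cong[OF refl])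
      show "of_bool (v (p - 1) = y) * path_prod d y v k p x = (if v (p - 1) = y then path_prod d y v k p x else 0)" for y
        by (cases "v (p - 1) = y") simp_all
    qed
    ultimately show "(\<Sum>y<d * d. of_bool (v (p - 1) = y) * path_prod d y v k p x) = path_prod d (v (p - 1)) v k p x"
      by (simp only: sum.delta'[OF finite_lessThan] lessThan_iff if_True)
  qed
  finally show ?thesis .
qed

lemma path_idx:
  assumes "v \<in> {..<p} \<rightarrow>\<^sub>E {..<d * d}" "k \<in> {..<p} \<rightarrow>\<^sub>E {..<s}" "y < d * d" "t < p"
  shows "path_a d y v k t \<in> idx (d * d) s" "path_b d y v k t \<in> idx (d * d) s"
proof -
  have v: "v u < d * d" if "u < p" for u using PiE_mem[OF assms(1), of u] that by simp
  have k: "k t < s" using PiE_mem[OF assms(2), of t] assms(4) by simp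
  have "vert y v t < d * d" using assms(3,4) v by (cases t) simp_all
  then show "path_a d y v k t \<in> idx (d * d) s" "path_b d y v k t \<in> idx (d * d) s"
    unfolding path_a_def path_b_def idx_def using v[OF assms(4)] k mix_lt by simp_all
qed

lemma finite_idx: "finite (idx n s)" by (simp add: idx_def)

lemma wick_sum_eq_card:
  assumes S: "finite S" and X: "finite X"
  shows "(\<Sum>f\<in>X. wick_sum (a f) (b f) S P) =
     (\<Sum>\<sigma> | \<sigma> permutes S \<and> P \<sigma>. of_nat (card {f\<in>X. \<forall>t\<in>S. a f t = b f (\<sigma> t)}))"
proof -
  have pr: "(\<Prod>t\<in>S. of_bool (Q t)) = (of_bool (\<forall>t\<in>S. Q t) :: complex)" for Q
    using S by (induction S rule: finite_induct) auto
  have "(\<Sum>f\<in>X. wick_sum (a f) (b f) S P) = (\<Sum>\<sigma> | \<sigma> permutes S \<and> P \<sigma>. \<Sum>f\<in>X. of_bool (\<forall>t\<in>S. a f t = b f (\<sigma> t)))"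
    unfolding wick_sum_def pr by (rule sum.swap)
  also have "\<dots> = (\<Sum>\<sigma> | \<sigma> permutes S \<and> P \<sigma>. of_nat (card {f\<in>X. \<forall>t\<in>S. a f t = b f (\<sigma> t)}))"
  proof (rule sum.cong[OF refl])
    fix \<sigma>
    have eq: "{f\<in>X. \<forall>t\<in>S. a f t = b f (\<sigma> t)} = X \<inter> {f. \<forall>t\<in>S. a f t = b f (\<sigma> t)}" by blast
    show "(\<Sum>f\<in>X. of_bool (\<forall>t\<in>S. a f t = b f (\<sigma> t))) = (of_nat (card {f\<in>X. \<forall>t\<in>S. a f t = b f (\<sigma> t)}) :: complex)"
      unfolding eq by (rule sum_of_bool_eq[OF X X])
  qed
  finally show ?thesis .
qed

lemma case_sum_PiE:
  assumes "v \<in> A \<rightarrow>\<^sub>E C" "w \<in> B \<rightarrow>\<^sub>E C"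
  shows "case_sum v w \<in> (A <+> B) \<rightarrow>\<^sub>E C"
proof (rule PiE_I)
  fix t assume "t \<in> A <+> B"
  then show "case_sum v w t \<in> C"
    by (rule PlusE) (use PiE_mem[OF assms(1)] PiE_mem[OF assms(2)] in simp_all)
next
  fix t assume t: "t \<notin> A <+> B"
  show "case_sum v w t = undefined"
  proof (cases t)
    case (Inl a)
    then show ?thesis using t PiE_arb[OF assms(1), of a] by (simp add: InlI) blast
  next
    case (Inr a)
    then show ?thesis using t PiE_arb[OF assms(2), of a] by (simp add: InrI) blast
  qed
qed

lemma sum_Times: "sum F (A \<times> B) = (\<Sum>a\<in>A. \<Sum>b\<in>B. F (a, b))"
  unfolding sum.cartesian_product[of "\<lambda>a b. F (a, b)"] by (simp only: case_prod_eta)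

text \<open>By Wick's formula the expectation counts pairs of a walk and a compatible reduced
  permutation. It is a sum of cardinalities, hence real, and summing over walks first yields the
  index triples.\<close>

lemma cheb_trace_integral:
  assumes d: "0 < d" and p: "0 < p"
  obtains E :: real where
    "has_bochner_integral (gauss_space (idx (d * d) s)) (cheb_trace d s p) (complex_of_real E)"
    "E \<le> (\<Sum>\<sigma> | \<sigma> permutes {..<p} \<and> reduced_on (\<lambda>t. t) p \<sigma>. real (card (index_triples {..<p} (csucc p) \<sigma> d s)))"
proof -
  let ?M = "gauss_space (idx (d * d) s)"
  let ?X = "({..<p} \<rightarrow>\<^sub>E {..<d * d}) \<times> ({..<p} \<rightarrow>\<^sub>E {..<s})"
  let ?a = "\<lambda>(v, k). path_a d (v (p - 1)) v k" and ?b = "\<lambda>(v, k). path_b d (v (p - 1)) v k"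
  have fX: "finite ?X" by (simp add: finite_PiE)
  have one: "has_bochner_integral ?M (\<lambda>x. rprod (?a f) (?b f) (\<lambda>t. t) p x)
      (wick_sum (?a f) (?b f) {..<p} (reduced_on (\<lambda>t. t) p))" if f: "f \<in> ?X" for f
  proof -
    obtain v k where vk: "f = (v, k)" "v \<in> {..<p} \<rightarrow>\<^sub>E {..<d * d}" "k \<in> {..<p} \<rightarrow>\<^sub>E {..<s}" using f by auto
    have y: "v (p - 1) < d * d" using PiE_mem[OF vk(2), of "p - 1"] p by simp
    have "has_bochner_integral ?M (\<lambda>x. (\<lambda>_. 1) x * rprod (?a f) (?b f) (\<lambda>t. t) p x * (\<Prod>t\<in>{}. x (?a f t) * cnj (x (?b f t))))
      (wick_sum (?a f) (?b f) ({} \<union> (\<lambda>t. t) ` {..<p} \<union> {}) (\<lambda>\<sigma>. True \<and> reduced_on (\<lambda>t. t) p \<sigma>))"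
    proof (rule rprod_wick[where U = "{..<p}" and ?S0.0 = "{}" and P = "\<lambda>_. True" and R = "\<lambda>_. 1" and T = "{}"])
      show "has_bochner_integral ?M (\<lambda>x. 1 * (\<Prod>t\<in>T. x (?a f t) * cnj (x (?b f t)))) (wick_sum (?a f) (?b f) ({} \<union> T) (\<lambda>_. True))"
        if T: "T \<subseteq> {..<p}" for T
      proof -
        have fT: "finite T" using T finite_subset by blast
        have ab: "?a f \<in> T \<rightarrow> idx (d * d) s" "?b f \<in> T \<rightarrow> idx (d * d) s"
          using path_idx[OF vk(2,3) y] T by (auto simp: vk(1))
        show ?thesis
          using wick[OF finite_idx fT ab] by (simp only: mult_1_left Un_empty_left)
      qed
    qed (simp_all only: finite_lessThan finite.emptyI inj_on_id2 Int_empty_right Int_empty_left image_ident order_refl empty_subsetI simp_thms)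
    then show ?thesis by (simp only: prod.empty mult_1_left mult_1_right Un_empty_left Un_empty_right image_ident simp_thms)
  qed
  have h1: "has_bochner_integral ?M (\<lambda>x. \<Sum>f\<in>?X. rprod (?a f) (?b f) (\<lambda>t. t) p x)
     (\<Sum>f\<in>?X. wick_sum (?a f) (?b f) {..<p} (reduced_on (\<lambda>t. t) p))"
    by (rule has_bochner_integral_sum) (rule one)
  have h2: "(\<lambda>x. \<Sum>f\<in>?X. rprod (?a f) (?b f) (\<lambda>t. t) p x) = cheb_trace d s p"
    by (rule ext) (simp only: sum_Times cheb_trace_path[OF d p] path_prod_def prod.case)
  have h3: "(\<Sum>f\<in>?X. wick_sum (?a f) (?b f) {..<p} (reduced_on (\<lambda>t. t) p)) =
      (\<Sum>\<sigma> | \<sigma> permutes {..<p} \<and> reduced_on (\<lambda>t. t) p \<sigma>. of_nat (card {f\<in>?X. \<forall>t\<in>{..<p}. ?a f t = ?b f (\<sigma> t)}))"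
    by (rule wick_sum_eq_card) (use fX in auto)
  from h1 have hb: "has_bochner_integral ?M (cheb_trace d s p) (complex_of_real
      (\<Sum>\<sigma> | \<sigma> permutes {..<p} \<and> reduced_on (\<lambda>t. t) p \<sigma>. real (card {f\<in>?X. \<forall>t\<in>{..<p}. ?a f t = ?b f (\<sigma> t)})))"
    unfolding h2 h3 by (simp only: of_real_sum of_real_of_nat_eq)
  show ?thesis
  proof (rule that[OF hb], rule sum_mono)
    fix \<sigma> assume "\<sigma> \<in> {\<sigma>. \<sigma> permutes {..<p} \<and> reduced_on (\<lambda>t. t) p \<sigma>}"
    then have s: "\<sigma> permutes {..<p}" by simp
    have sp: "\<sigma> t < p \<longleftrightarrow> t < p" for t using permutes_in_image[OF s, of t] by simp
    have "{f\<in>?X. \<forall>t\<in>{..<p}. ?a f t = ?b f (\<sigma> t)} =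
      {(v, k). v \<in> {..<p} \<rightarrow>\<^sub>E {..<d * d} \<and> k \<in> {..<p} \<rightarrow>\<^sub>E {..<s} \<and>
      (\<forall>t\<in>{..<p}. (mix d (v (inv_into UNIV (csucc p) t)) (v t), k t) = (mix d (v (\<sigma> t)) (v (inv_into UNIV (csucc p) (\<sigma> t))), k (\<sigma> t)))}"
    proof (rule Set.set_eqI)
      fix f :: "(nat \<Rightarrow> nat) \<times> (nat \<Rightarrow> nat)"
      obtain v k where f: "f = (v, k)" by (cases f)
      have e: "path_a d (v (p - 1)) v k t = (mix d (v (inv_into UNIV (csucc p) t)) (v t), k t)"
        "path_b d (v (p - 1)) v k t = (mix d (v t) (v (inv_into UNIV (csucc p) t)), k t)" if "t < p" for t
        unfolding path_a_def path_b_def inv_csucc[OF that] by (rule refl)+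
      have "(path_a d (v (p - 1)) v k t = path_b d (v (p - 1)) v k (\<sigma> t)) \<longleftrightarrow>
        ((mix d (v (inv_into UNIV (csucc p) t)) (v t), k t) = (mix d (v (\<sigma> t)) (v (inv_into UNIV (csucc p) (\<sigma> t))), k (\<sigma> t)))"
        if "t \<in> {..<p}" for t using that e(1)[of t] e(2)[of "\<sigma> t"] sp[of t] by (simp only: lessThan_iff)
      then show "f \<in> {f\<in>?X. \<forall>t\<in>{..<p}. ?a f t = ?b f (\<sigma> t)} \<longleftrightarrow> f \<in> {(v, k). v \<in> {..<p} \<rightarrow>\<^sub>E {..<d * d} \<and> k \<in> {..<p} \<rightarrow>\<^sub>E {..<s} \<and>
      (\<forall>t\<in>{..<p}. (mix d (v (inv_into UNIV (csucc p) t)) (v t), k t) = (mix d (v (\<sigma> t)) (v (inv_into UNIV (csucc p) (\<sigma> t))), k (\<sigma> t)))}"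
        unfolding f mem_Collect_eq prod.case mem_Times_iff fst_conv snd_conv conj_assoc
        by (intro conj_cong refl ball_cong)
    qed
    then show "real (card {f\<in>?X. \<forall>t\<in>{..<p}. ?a f t = ?b f (\<sigma> t)}) \<le> real (card (index_triples {..<p} (csucc p) \<sigma> d s))"
      using card_compat_le[OF finite_lessThan csucc_permutes s d, of s] by (simp only: of_nat_le_iff)
  qed
qed

lemma inv_csucc2: "inv_into UNIV (csucc2 p) (Inl t) = Inl (inv_into UNIV (csucc p) t)"
  "inv_into UNIV (csucc2 p) (Inr t) = Inr (inv_into UNIV (csucc p) t)"
proof -
  have "csucc2 p (Inl (inv_into UNIV (csucc p) t)) = Inl t" "csucc2 p (Inr (inv_into UNIV (csucc p) t)) = Inr t"
    using permutes_inverses(1)[OF csucc_permutes[of p]] by (simp_all add: csucc2_def)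
  then show "inv_into UNIV (csucc2 p) (Inl t) = Inl (inv_into UNIV (csucc p) t)"
    "inv_into UNIV (csucc2 p) (Inr t) = Inr (inv_into UNIV (csucc p) t)"
    using permutes_inverses(2)[OF csucc2_permutes[of p]] by metis+
qed

lemma cheb_trace_square_integral:
  assumes d: "0 < d" and p: "0 < p"
  obtains E :: real where
    "has_bochner_integral (gauss_space (idx (d * d) s)) (\<lambda>x. cheb_trace d s p x * cheb_trace d s p x) (complex_of_real E)"
    "E \<le> (\<Sum>\<sigma> | \<sigma> permutes ({..<p} <+> {..<p}) \<and> reduced_on Inl p \<sigma> \<and> reduced_on Inr p \<sigma>.
        real (card (index_triples ({..<p} <+> {..<p}) (csucc2 p) \<sigma> d s)))"
proof -
  let ?M = "gauss_space (idx (d * d) s)"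
  let ?S = "{..<p} <+> {..<p}"
  let ?V = "{..<p} \<rightarrow>\<^sub>E {..<d * d}" and ?K = "{..<p} \<rightarrow>\<^sub>E {..<s}"
  let ?X = "(?V \<times> ?K) \<times> (?V \<times> ?K)"
  let ?a1 = "\<lambda>(v, k). path_a d (v (p - 1)) v k" and ?b1 = "\<lambda>(v, k). path_b d (v (p - 1)) v k"
  let ?a = "\<lambda>(f, g). case_sum (?a1 f) (?a1 g)" and ?b = "\<lambda>(f, g). case_sum (?b1 f) (?b1 g)"
  have fX: "finite ?X" by (simp add: finite_PiE)
  have SU: "?S = Inl ` {..<p} \<union> Inr ` {..<p}" by (simp add: Plus_def)
  have finS: "finite ?S" by simp
  have one: "has_bochner_integral ?M (\<lambda>x. rprod (?a f) (?b f) Inl p x * rprod (?a f) (?b f) Inr p x)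
      (wick_sum (?a f) (?b f) ?S (\<lambda>\<sigma>. reduced_on Inl p \<sigma> \<and> reduced_on Inr p \<sigma>))" if f: "f \<in> ?X" for f
  proof -
    obtain v k v' k' where vk: "f = ((v, k), (v', k'))" "v \<in> ?V" "k \<in> ?K" "v' \<in> ?V" "k' \<in> ?K" using f by auto
    have y: "v (p - 1) < d * d" "v' (p - 1) < d * d" using PiE_mem[OF vk(2), of "p - 1"] PiE_mem[OF vk(4), of "p - 1"] p by simp_all
    \<comment> \<open>The first circle is processed with arbitrary plain slots \<open>T\<close>,
      because this statement serves as the hypothesis on \<open>R\<close> when the second circle is
      processed.\<close>
    have l: "has_bochner_integral ?M (\<lambda>x. (\<lambda>_. 1) x * rprod (?a f) (?b f) Inl p x * (\<Prod>t\<in>T. x (?a f t) * cnj (x (?b f t))))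
      (wick_sum (?a f) (?b f) ({} \<union> Inl ` {..<p} \<union> T) (\<lambda>\<sigma>. True \<and> reduced_on Inl p \<sigma>))"
      if T0: "T \<subseteq> ?S" "T \<inter> Inl ` {..<p} = {}" for T
    proof (rule rprod_wick[where U = ?S and ?S0.0 = "{}" and P = "\<lambda>_. True" and R = "\<lambda>_. 1" and T = T])
      show "has_bochner_integral ?M (\<lambda>x. 1 * (\<Prod>t\<in>T. x (?a f t) * cnj (x (?b f t)))) (wick_sum (?a f) (?b f) ({} \<union> T) (\<lambda>_. True))"
        if T: "T \<subseteq> ?S" for T
      proof -
        have fT: "finite T" by (rule finite_subset[OF T finS])
        have "?a f t \<in> idx (d * d) s \<and> ?b f t \<in> idx (d * d) s" if "t \<in> ?S" for t
          using that path_idx[OF vk(2,3) y(1)] path_idx[OF vk(4,5) y(2)] by (auto simp: vk(1))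
        then have ab: "?a f \<in> T \<rightarrow> idx (d * d) s" "?b f \<in> T \<rightarrow> idx (d * d) s" using T by blast+
        show ?thesis
          using wick[OF finite_idx fT ab] by (simp only: mult_1_left Un_empty_left)
      qed
      show "T \<subseteq> ?S" "T \<inter> Inl ` {..<p} = {}" by (fact T0)+
      show "Inl ` {..<p} \<subseteq> ?S" unfolding SU by (rule Un_upper1)
    qed (simp_all only: finS finite.emptyI inj_Inl Int_empty_right simp_thms)
    have "has_bochner_integral ?M (\<lambda>x. rprod (?a f) (?b f) Inl p x * rprod (?a f) (?b f) Inr p x * (\<Prod>t\<in>{}. x (?a f t) * cnj (x (?b f t))))
      (wick_sum (?a f) (?b f) (Inl ` {..<p} \<union> Inr ` {..<p} \<union> {}) (\<lambda>\<sigma>. reduced_on Inl p \<sigma> \<and> reduced_on Inr p \<sigma>))"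
    proof (rule rprod_wick[where U = ?S and ?S0.0 = "Inl ` {..<p}" and P = "reduced_on Inl p" and R = "rprod (?a f) (?b f) Inl p" and T = "{}"])
      fix T assume T: "T \<subseteq> ?S" "T \<inter> Inl ` {..<p} = {}"
      show "has_bochner_integral ?M (\<lambda>x. rprod (?a f) (?b f) Inl p x * (\<Prod>t\<in>T. x (?a f t) * cnj (x (?b f t))))
         (wick_sum (?a f) (?b f) (Inl ` {..<p} \<union> T) (reduced_on Inl p))"
        using l[OF T] by (simp only: mult_1_left Un_empty_left simp_thms)
    next
      fix \<sigma> :: "nat + nat \<Rightarrow> nat + nat" and v w
      assume vw: "v \<notin> Inl ` {..<p}" "w \<notin> Inl ` {..<p}" "\<sigma> v = v" "\<sigma> w = w" "inj \<sigma>"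
      \<comment> \<open>By injectivity \<sigma> maps no point of the first circle to the fixed
        points \<open>v\<close> and \<open>w\<close>, so the transposition is invisible
        there.\<close>
      have "(Transposition.transpose v w \<circ> \<sigma>) (Inl t) = \<sigma> (Inl t)" if "t < p" for t
      proof -
        have "Inl t \<noteq> v" "Inl t \<noteq> w" using vw that by auto
        then have "\<sigma> (Inl t) \<noteq> v" "\<sigma> (Inl t) \<noteq> w" using vw by (metis injD)+
        then show ?thesis by (simp add: transpose_apply_other)
      qed
      then show "reduced_on Inl p (Transposition.transpose v w \<circ> \<sigma>) = reduced_on Inl p \<sigma>"
        unfolding reduced_on_def by (metis Suc_lessD)
    next
      show "Inr ` {..<p} \<subseteq> ?S" unfolding SU by (rule Un_upper2)
      show "range Inr \<inter> Inl ` {..<p} = {}" by blast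
    qed (simp_all only: finS finite_imageI finite_lessThan inj_Inr Int_empty_left empty_subsetI)
    then show ?thesis by (simp only: SU prod.empty mult_1_right Un_empty_right)
  qed
  have h1: "has_bochner_integral ?M (\<lambda>x. \<Sum>f\<in>?X. rprod (?a f) (?b f) Inl p x * rprod (?a f) (?b f) Inr p x)
     (\<Sum>f\<in>?X. wick_sum (?a f) (?b f) ?S (\<lambda>\<sigma>. reduced_on Inl p \<sigma> \<and> reduced_on Inr p \<sigma>))"
    by (rule has_bochner_integral_sum) (rule one)
  have h2: "(\<lambda>x. \<Sum>f\<in>?X. rprod (?a f) (?b f) Inl p x * rprod (?a f) (?b f) Inr p x) = (\<lambda>x. cheb_trace d s p x * cheb_trace d s p x)"
  proof
    fix x
    have r: "rprod (case_sum A A') (case_sum B B') Inl p x = rprod A B (\<lambda>t. t) p x"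
      "rprod (case_sum A A') (case_sum B B') Inr p x = rprod A' B' (\<lambda>t. t) p x"
      for A A' B B' :: "nat \<Rightarrow> nat \<times> nat" by (rule rprod_cong; simp)+
    have "cheb_trace d s p x = (\<Sum>f\<in>?V \<times> ?K. rprod (?a1 f) (?b1 f) (\<lambda>t. t) p x)"
      by (simp only: sum_Times cheb_trace_path[OF d p] path_prod_def prod.case)
    then have "cheb_trace d s p x * cheb_trace d s p x =
      (\<Sum>(f, g)\<in>?X. rprod (?a1 f) (?b1 f) (\<lambda>t. t) p x * rprod (?a1 g) (?b1 g) (\<lambda>t. t) p x)"
      by (simp only: sum_product sum_Times[of _ "?V \<times> ?K" "?V \<times> ?K"] prod.case)
    also have "\<dots> = (\<Sum>f\<in>?X. rprod (?a f) (?b f) Inl p x * rprod (?a f) (?b f) Inr p x)"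
    proof (rule sum.cong[OF refl])
      fix h assume "h \<in> ?X"
      obtain f g where h: "h = (f, g)" by (cases h)
      show "(case h of (f, g) \<Rightarrow> rprod (?a1 f) (?b1 f) (\<lambda>t. t) p x * rprod (?a1 g) (?b1 g) (\<lambda>t. t) p x) =
         rprod (?a h) (?b h) Inl p x * rprod (?a h) (?b h) Inr p x"
        unfolding h prod.case r ..
    qed
    finally show "(\<Sum>f\<in>?X. rprod (?a f) (?b f) Inl p x * rprod (?a f) (?b f) Inr p x) = cheb_trace d s p x * cheb_trace d s p x" ..
  qed
  have h3: "(\<Sum>f\<in>?X. wick_sum (?a f) (?b f) ?S (\<lambda>\<sigma>. reduced_on Inl p \<sigma> \<and> reduced_on Inr p \<sigma>)) =
      (\<Sum>\<sigma> | \<sigma> permutes ?S \<and> reduced_on Inl p \<sigma> \<and> reduced_on Inr p \<sigma>. of_nat (card {f\<in>?X. \<forall>t\<in>?S. ?a f t = ?b f (\<sigma> t)}))"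
    by (rule wick_sum_eq_card) (use fX in auto)
  from h1 have hb: "has_bochner_integral ?M (\<lambda>x. cheb_trace d s p x * cheb_trace d s p x) (complex_of_real
      (\<Sum>\<sigma> | \<sigma> permutes ?S \<and> reduced_on Inl p \<sigma> \<and> reduced_on Inr p \<sigma>. real (card {f\<in>?X. \<forall>t\<in>?S. ?a f t = ?b f (\<sigma> t)})))"
    unfolding h2 h3 by (simp only: of_real_sum of_real_of_nat_eq)
  show ?thesis
  proof (rule that[OF hb], rule sum_mono)
    fix \<sigma> assume "\<sigma> \<in> {\<sigma>. \<sigma> permutes ?S \<and> reduced_on Inl p \<sigma> \<and> reduced_on Inr p \<sigma>}"
    then have s: "\<sigma> permutes ?S" by simp
    let ?\<delta> = "inv_into UNIV (csucc2 p)"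
    let ?C = "{(v, k). v \<in> ?S \<rightarrow>\<^sub>E {..<d * d} \<and> k \<in> ?S \<rightarrow>\<^sub>E {..<s} \<and>
      (\<forall>t\<in>?S. (mix d (v (?\<delta> t)) (v t), k t) = (mix d (v (\<sigma> t)) (v (?\<delta> (\<sigma> t))), k (\<sigma> t)))}"
    define \<Phi> where "\<Phi> = (\<lambda>((v::nat\<Rightarrow>nat, k::nat\<Rightarrow>nat), (v'::nat\<Rightarrow>nat, k'::nat\<Rightarrow>nat)). (case_sum v v', case_sum k k'))"
    have cs: "case_sum v v' = case_sum w w' \<longleftrightarrow> v = w \<and> v' = w'" for v v' w w' :: "nat \<Rightarrow> nat"
    proof
      assume "case_sum v v' = case_sum w w'"
      from fun_cong[OF this] have "case_sum v v' (Inl t) = case_sum w w' (Inl t)" "case_sum v v' (Inr t) = case_sum w w' (Inr t)" for t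
        by blast+
      then show "v = w \<and> v' = w'" by (simp only: sum.case) blast
    qed simp
    have "inj \<Phi>" by (rule injI) (auto simp: \<Phi>_def cs)
    then have "inj_on \<Phi> {f\<in>?X. \<forall>t\<in>?S. ?a f t = ?b f (\<sigma> t)}" by (rule inj_on_subset) (rule subset_UNIV)
    moreover have "\<Phi> ` {f\<in>?X. \<forall>t\<in>?S. ?a f t = ?b f (\<sigma> t)} \<subseteq> ?C"
    proof (rule image_subsetI)
      fix f assume f: "f \<in> {f\<in>?X. \<forall>t\<in>?S. ?a f t = ?b f (\<sigma> t)}"
      then have "f \<in> ?X" by blast
      then obtain v k v' k' where vk: "f = ((v, k), (v', k'))" "v \<in> ?V" "k \<in> ?K" "v' \<in> ?V" "k' \<in> ?K" by auto
      let ?v = "case_sum v v'" and ?k = "case_sum k k'"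
      have A: "?a f t = (mix d (?v (?\<delta> t)) (?v t), ?k t)" if "t \<in> ?S" for t
        using that by (auto simp: vk(1) path_a_def inv_csucc inv_csucc2 simp del: One_nat_def)
      have B: "?b f t = (mix d (?v t) (?v (?\<delta> t)), ?k t)" if "t \<in> ?S" for t
        using that by (auto simp: vk(1) path_b_def inv_csucc inv_csucc2 simp del: One_nat_def)
      have h: "?a f t = ?b f (\<sigma> t)" if "t \<in> ?S" for t using f that by blast
      have mm: "(mix d (?v (?\<delta> t)) (?v t), ?k t) = (mix d (?v (\<sigma> t)) (?v (?\<delta> (\<sigma> t))), ?k (\<sigma> t))" if "t \<in> ?S" for t
        using h[OF that] unfolding A[OF that] B[OF permutes_in_image[OF s, THEN iffD2, OF that]] .
      have v: "?v \<in> ?S \<rightarrow>\<^sub>E {..<d * d}"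
        by (rule case_sum_PiE[OF vk(2,4)])
      have k: "?k \<in> ?S \<rightarrow>\<^sub>E {..<s}"
        by (rule case_sum_PiE[OF vk(3,5)])
      from v k mm show "\<Phi> f \<in> ?C"
        unfolding \<Phi>_def vk(1) prod.case mem_Collect_eq by (intro conjI ballI)
    qed
    moreover have "finite ?C"
    proof (rule finite_subset)
      show "?C \<subseteq> (?S \<rightarrow>\<^sub>E {..<d * d}) \<times> (?S \<rightarrow>\<^sub>E {..<s})" by blast
    qed (simp add: finite_PiE)
    ultimately have "card {f\<in>?X. \<forall>t\<in>?S. ?a f t = ?b f (\<sigma> t)} \<le> card ?C" by (rule card_inj_on_le)
    also have "\<dots> \<le> card (index_triples ?S (csucc2 p) \<sigma> d s)"
      by (rule card_compat_le[OF _ csucc2_permutes s d]) simp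
    finally show "real (card {f\<in>?X. \<forall>t\<in>?S. ?a f t = ?b f (\<sigma> t)}) \<le> real (card (index_triples ?S (csucc2 p) \<sigma> d s))" by simp
  qed
qed

theorem cheb_trace_moments:
  assumes p: "1 \<le> p" and d: "1 \<le> d" and ds: "real d powr (3/2) \<le> real s"
  obtains E1 E2 :: real where
    "has_bochner_integral (gauss_space (idx (d * d) s)) (cheb_trace d s p) (complex_of_real E1)"
    "E1 \<le> real s powr (p / 2) * real d powr (p + 2 - 11/96) * (1 + (real p + 1) * real d powr (-1/96)) ^ p"
    "has_bochner_integral (gauss_space (idx (d * d) s)) (\<lambda>x. cheb_trace d s p x * cheb_trace d s p x) (complex_of_real E2)"
    "E2 \<le> fact (2 * p) * (real s powr p * real d powr (real (2 * p + 4) - 1/4))"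
proof -
  have pd: "0 < d" "0 < p" using p d by auto
  obtain E1 where E1: "has_bochner_integral (gauss_space (idx (d * d) s)) (cheb_trace d s p) (complex_of_real E1)"
    "E1 \<le> (\<Sum>\<sigma> | \<sigma> permutes {..<p} \<and> reduced_on (\<lambda>t. t) p \<sigma>. real (card (index_triples {..<p} (csucc p) \<sigma> d s)))"
    using cheb_trace_integral[OF pd] by blast
  obtain E2 where E2: "has_bochner_integral (gauss_space (idx (d * d) s)) (\<lambda>x. cheb_trace d s p x * cheb_trace d s p x) (complex_of_real E2)"
    "E2 \<le> (\<Sum>\<sigma> | \<sigma> permutes ({..<p} <+> {..<p}) \<and> reduced_on Inl p \<sigma> \<and> reduced_on Inr p \<sigma>.
        real (card (index_triples ({..<p} <+> {..<p}) (csucc2 p) \<sigma> d s)))"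
    using cheb_trace_square_integral[OF pd] by blast
  let ?R = "{\<sigma>. \<sigma> permutes ({..<p} <+> {..<p}) \<and> reduced_on Inl p \<sigma> \<and> reduced_on Inr p \<sigma>}"
  let ?B = "real s powr p * real d powr (real (2 * p + 4) - 1/4)"
  note E2(2)
  also have "(\<Sum>\<sigma>\<in>?R. real (card (index_triples ({..<p} <+> {..<p}) (csucc2 p) \<sigma> d s))) \<le> real (card ?R) * ?B"
  proof (rule sum_bounded_above)
    fix \<sigma> assume "\<sigma> \<in> ?R"
    then have "\<sigma> permutes ({..<p} <+> {..<p})" "reduced_on Inl p \<sigma>" "reduced_on Inr p \<sigma>" by blast+
    then show "real (card (index_triples ({..<p} <+> {..<p}) (csucc2 p) \<sigma> d s)) \<le> ?B"
      by (rule card_index_triples2[OF p d ds])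
  qed
  \<comment> \<open>The second moment is used only for fixed \<open>p\<close>, so the number of all
    permutations of the \<open>2 * p\<close> positions is good enough.\<close>
  also have "\<dots> \<le> fact (2 * p) * ?B"
  proof (rule mult_right_mono)
    have "card ?R \<le> card {\<sigma>. \<sigma> permutes ({..<p} <+> {..<p})}"
      by (rule card_mono[OF finite_permutations]) (simp, blast)
    also have "\<dots> = fact (card ({..<p} <+> {..<p}))" by (rule card_permutations) simp_all
    also have "card ({..<p} <+> {..<p}) = 2 * p" by (simp add: card_Plus)
    finally have "real (card ?R) \<le> real (fact (2 * p))" by (simp only: of_nat_le_iff)
    then show "real (card ?R) \<le> fact (2 * p)" by (simp only: of_nat_fact)
  qed simp
  finally have "E2 \<le> fact (2 * p) * ?B" .
  then show ?thesis
    by (rule that[OF E1(1) order_trans[OF E1(2) sum_reduced_index_triples[OF p d ds]] E2(1)])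
qed

subsection \<open>The sphere as a normalized Gaussian vector\<close>

definition norm_idx :: "'v set \<Rightarrow> ('v \<Rightarrow> complex) \<Rightarrow> real" where
  "norm_idx V x = sqrt (\<Sum>v\<in>V. (cmod (x v))\<^sup>2)"

definition leb_idx :: "'v set \<Rightarrow> ('v \<Rightarrow> complex) measure" where
  "leb_idx V = PiM V (\<lambda>_. lborel :: complex measure)"

lemma sets_gauss_leb: "sets (gauss_space V) = sets (leb_idx V)"
  unfolding gauss_space_def leb_idx_def by (intro sets_PiM_cong) auto

lemma space_leb_idx: "space (leb_idx V) = V \<rightarrow>\<^sub>E UNIV"
  by (simp add: leb_idx_def space_PiM)

lemma measurable_coord: "v \<in> V \<Longrightarrow> (\<lambda>x. x v) \<in> borel_measurable (leb_idx V)"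
  unfolding leb_idx_def using measurable_component_singleton[of v V "\<lambda>_. lborel :: complex measure"] by simp

lemma measurable_norm_idx [measurable]: "norm_idx V \<in> borel_measurable (leb_idx V)"
  unfolding norm_idx_def
  by (intro borel_measurable_sqrt[THEN measurable_compose[rotated]] borel_measurable_sum
        borel_measurable_power borel_measurable_norm[THEN measurable_compose[rotated]] measurable_coord) auto

lemma gauss_space_density:
  assumes V: "finite V"
  shows "gauss_space V = density (leb_idx V) (\<lambda>x. ennreal (exp (- (norm_idx V x)\<^sup>2) / pi ^ card V))"
proof -
  interpret product_sigma_finite "\<lambda>_::'a. lborel :: complex measure" by standard
  interpret cg: prob_space cgauss by (rule prob_space_cgauss)
  interpret G: product_sigma_finite "\<lambda>_::'a. cgauss" by standard
  have dens: "ennreal (exp (- (norm_idx V x)\<^sup>2) / pi ^ card V) = (\<Prod>v\<in>V. ennreal (exp (- (cmod (x v))\<^sup>2) / pi))" for x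
  proof -
    have "(norm_idx V x)\<^sup>2 = (\<Sum>v\<in>V. (cmod (x v))\<^sup>2)" unfolding norm_idx_def by (simp add: sum_nonneg)
    then have "exp (- (norm_idx V x)\<^sup>2) / pi ^ card V = (\<Prod>v\<in>V. exp (- (cmod (x v))\<^sup>2) / pi)"
      using V by (simp add: prod_dividef exp_sum sum_negf[symmetric])
    then show ?thesis by (simp add: prod_ennreal)
  qed
  have "density (leb_idx V) (\<lambda>x. ennreal (exp (- (norm_idx V x)\<^sup>2) / pi ^ card V)) = PiM V (\<lambda>_. cgauss)"
  proof (rule G.PiM_eqI[OF V])
    show "sets (density (leb_idx V) (\<lambda>x. ennreal (exp (- (norm_idx V x)\<^sup>2) / pi ^ card V))) = sets (PiM V (\<lambda>_. cgauss))"
      using sets_gauss_leb[of V] by (simp add: gauss_space_def)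
    fix A assume A: "\<And>v. v \<in> V \<Longrightarrow> A v \<in> sets cgauss"
    then have AB: "A v \<in> sets borel" if "v \<in> V" for v using that by simp
    have S: "PiE V A \<in> sets (leb_idx V)" unfolding leb_idx_def by (intro sets_PiM_I_finite V) (use AB in auto)
    have "emeasure (density (leb_idx V) (\<lambda>x. ennreal (exp (- (norm_idx V x)\<^sup>2) / pi ^ card V))) (PiE V A)
      = (\<integral>\<^sup>+x. ennreal (exp (- (norm_idx V x)\<^sup>2) / pi ^ card V) * indicator (PiE V A) x \<partial>leb_idx V)"
      by (rule emeasure_density[OF _ S]) measurable
    also have "\<dots> = (\<integral>\<^sup>+x. (\<Prod>v\<in>V. ennreal (exp (- (cmod (x v))\<^sup>2) / pi) * indicator (A v) (x v)) \<partial>leb_idx V)"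
    proof (rule nn_integral_cong)
      fix x assume "x \<in> space (leb_idx V)"
      then have "indicator (PiE V A) x = (\<Prod>v\<in>V. indicator (A v) (x v) :: ennreal)"
        using V by (auto simp: space_leb_idx PiE_iff indicator_def prod_eq_1_iff intro!: prod_zero_iff[THEN iffD2, symmetric])
      then show "ennreal (exp (- (norm_idx V x)\<^sup>2) / pi ^ card V) * indicator (PiE V A) x =
         (\<Prod>v\<in>V. ennreal (exp (- (cmod (x v))\<^sup>2) / pi) * indicator (A v) (x v))"
        by (simp add: dens prod.distrib)
    qed
    also have "\<dots> = (\<Prod>v\<in>V. \<integral>\<^sup>+z. ennreal (exp (- (cmod z)\<^sup>2) / pi) * indicator (A v) z \<partial>lborel)"
      unfolding leb_idx_def by (rule product_nn_integral_prod[OF V]) (use AB in measurable)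
    also have "\<dots> = (\<Prod>v\<in>V. emeasure cgauss (A v))"
      unfolding cgauss_def by (intro prod.cong refl emeasure_density[symmetric]) (use AB in auto)
    finally show "emeasure (density (leb_idx V) (\<lambda>x. ennreal (exp (- (norm_idx V x)\<^sup>2) / pi ^ card V))) (PiE V A)
      = (\<Prod>v\<in>V. emeasure cgauss (A v))" .
  qed
  then show ?thesis by (simp add: gauss_space_def)
qed

definition scale_idx :: "'v set \<Rightarrow> real \<Rightarrow> ('v \<Rightarrow> complex) \<Rightarrow> 'v \<Rightarrow> complex" where
  "scale_idx V r x = restrict (\<lambda>v. complex_of_real r * x v) V"

lemma measurable_scale_idx [measurable]: "scale_idx V r \<in> measurable (leb_idx V) (leb_idx V)"
proof -
  have "scale_idx V r \<in> measurable (leb_idx V) (PiM V (\<lambda>_. lborel :: complex measure))"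
    unfolding scale_idx_def
    by (intro measurable_restrict) (use measurable_coord in \<open>auto intro!: borel_measurable_times\<close>)
  then show ?thesis by (simp add: leb_idx_def)
qed

lemma lborel_scale:
  fixes A :: "complex set"
  assumes r: "0 < r" and A: "A \<in> sets borel"
  shows "emeasure lborel A = ennreal (r\<^sup>2) * emeasure lborel ((\<lambda>z. complex_of_real r * z) -` A)"
proof -
  have "(lborel :: complex measure) = density (distr lborel borel (\<lambda>x. 0 + r *\<^sub>R x)) (\<lambda>_. ennreal (\<bar>r\<bar> ^ DIM(complex)))"
    by (rule lborel_affine) (use r in simp)
  then have "emeasure lborel A = emeasure (density (distr lborel borel (\<lambda>x. 0 + r *\<^sub>R x)) (\<lambda>_. ennreal (\<bar>r\<bar> ^ DIM(complex)))) A"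
    by simp
  also have "\<dots> = ennreal (\<bar>r\<bar> ^ DIM(complex)) * emeasure (distr lborel borel (\<lambda>x. 0 + r *\<^sub>R x :: complex)) A"
    by (rule emeasure_density_const) (use A in simp)
  also have "emeasure (distr lborel borel (\<lambda>x. 0 + r *\<^sub>R x :: complex)) A = emeasure lborel ((\<lambda>x. 0 + r *\<^sub>R x) -` A)"
    using A by (subst emeasure_distr) auto
  finally show ?thesis using r by (simp add: scaleR_conv_of_real)
qed

lemma leb_idx_scale:
  assumes V: "finite V" and r: "0 < r" and A: "A \<in> sets (leb_idx V)"
  shows "emeasure (leb_idx V) A = ennreal (r ^ (2 * card V)) * emeasure (leb_idx V) (scale_idx V r -` A \<inter> space (leb_idx V))"
proof -
  interpret product_sigma_finite "\<lambda>_::'a. lborel :: complex measure" by standard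
  let ?D = "distr (leb_idx V) (leb_idx V) (scale_idx V r)"
  let ?c = "ennreal (r ^ (2 * card V))"
  have "density ?D (\<lambda>_. ?c) = PiM V (\<lambda>_. lborel :: complex measure)"
  proof (rule PiM_eqI[OF V])
    show "sets (density ?D (\<lambda>_. ?c)) = sets (PiM V (\<lambda>_. lborel :: complex measure))" by (simp add: leb_idx_def)
    fix B assume B: "\<And>v. v \<in> V \<Longrightarrow> B v \<in> sets (lborel :: complex measure)"
    have S: "PiE V B \<in> sets (leb_idx V)" unfolding leb_idx_def by (intro sets_PiM_I_finite V) (use B in auto)
    have pre: "scale_idx V r -` PiE V B \<inter> space (leb_idx V) = PiE V (\<lambda>v. (\<lambda>z. complex_of_real r * z) -` B v)"
      by (auto simp: scale_idx_def space_leb_idx PiE_iff)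
    have m: "(\<lambda>z. complex_of_real r * z) -` B v \<in> sets (lborel :: complex measure)" if "v \<in> V" for v
      using measurable_sets[of "\<lambda>z. complex_of_real r * z" borel borel "B v"] B[OF that] by simp
    have "emeasure (density ?D (\<lambda>_. ?c)) (PiE V B) = ?c * emeasure ?D (PiE V B)"
      by (rule emeasure_density_const) (use S in simp)
    also have "emeasure ?D (PiE V B) = emeasure (leb_idx V) (PiE V (\<lambda>v. (\<lambda>z. complex_of_real r * z) -` B v))"
      by (subst emeasure_distr[OF measurable_scale_idx S]) (simp only: pre)
    also have "\<dots> = (\<Prod>v\<in>V. emeasure lborel ((\<lambda>z. complex_of_real r * z) -` B v))"
      unfolding leb_idx_def by (rule emeasure_PiM[OF V]) (use m in auto)
    also have "?c * \<dots> = (\<Prod>v\<in>V. ennreal (r\<^sup>2) * emeasure lborel ((\<lambda>z. complex_of_real r * z) -` B v))"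
      using r by (simp add: prod.distrib power_mult ennreal_power)
    also have "\<dots> = (\<Prod>v\<in>V. emeasure lborel (B v))"
      by (intro prod.cong refl lborel_scale[OF r, symmetric]) (use B in simp)
    finally show "emeasure (density ?D (\<lambda>_. ?c)) (PiE V B) = (\<Prod>v\<in>V. emeasure lborel (B v))" .
  qed
  then have "emeasure (leb_idx V) A = emeasure (density ?D (\<lambda>_. ?c)) A" by (simp add: leb_idx_def)
  also have "\<dots> = ?c * emeasure ?D A" by (rule emeasure_density_const) (use A in simp)
  also have "emeasure ?D A = emeasure (leb_idx V) (scale_idx V r -` A \<inter> space (leb_idx V))"
    by (rule emeasure_distr[OF measurable_scale_idx A])
  finally show ?thesis .
qed

lemma norm_scale_idx: "0 < r \<Longrightarrow> norm_idx V (scale_idx V r x) = r * norm_idx V x"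
  by (simp add: norm_idx_def scale_idx_def norm_mult power_mult_distrib sum_distrib_left[symmetric] real_sqrt_mult)

lemma norm_idx_nonneg: "0 \<le> norm_idx V x"
  by (simp add: norm_idx_def sum_nonneg)

text \<open>Layer cake: a cone has the same proportion of Gaussian and of Lebesgue measure, because
  \<open>exp (-|x|^2)\<close> is a mixture of indicators of balls and these are dilates of each other.\<close>

lemma gauss_cone:
  assumes V: "finite V"
  obtains K :: ennreal where
    "\<And>C. C \<in> sets (leb_idx V) \<Longrightarrow> (\<And>r x. 0 < r \<Longrightarrow> x \<in> space (leb_idx V) \<Longrightarrow> scale_idx V r x \<in> C \<longleftrightarrow> x \<in> C) \<Longrightarrow>
      emeasure (gauss_space V) C = K * emeasure (leb_idx V) (C \<inter> {x \<in> space (leb_idx V). norm_idx V x \<le> 1})"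
proof
  let ?L = "leb_idx V"
  let ?K = "\<integral>\<^sup>+t. ennreal (exp (- t) / pi ^ card V) * ennreal (sqrt t ^ (2 * card V)) * indicator {0<..} t \<partial>lborel"
  fix C assume C: "C \<in> sets ?L" and cone: "\<And>r x. 0 < r \<Longrightarrow> x \<in> space ?L \<Longrightarrow> scale_idx V r x \<in> C \<longleftrightarrow> x \<in> C"
  interpret product_sigma_finite "\<lambda>_::'a. lborel :: complex measure" by standard
  interpret L: sigma_finite_measure ?L unfolding leb_idx_def by (rule sigma_finite[OF V])
  interpret P: pair_sigma_finite ?L "lborel :: real measure" by standard
  have [measurable]: "C \<in> sets ?L" by (rule C)
  let ?B = "{x \<in> space ?L. norm_idx V x \<le> 1}"
  \<comment> \<open>exp (-a) is the integral of exp (-t) over t at least a; with a = |x|^2 the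
    Gaussian density becomes a mixture of indicators of balls of radius sqrt t.\<close>
  have layer: "ennreal (exp (- a) / c) = (\<integral>\<^sup>+t. ennreal (exp (- t) / c) * indicator {a..} t \<partial>lborel)" if "0 < c" for a c :: real
  proof -
    have "(\<integral>\<^sup>+t. ennreal (exp (- t) / c) * indicator {a..} t \<partial>lborel) = ennreal (0 - (- exp (- a) / c))"
    proof (rule nn_integral_FTC_atLeast)
      show "((\<lambda>t. - exp (- t) / c) \<longlongrightarrow> 0) at_top" using that by real_asymp
      show "((\<lambda>t. - exp (- t) / c) has_real_derivative exp (- t) / c) (at t)" for t
        using that by (auto intro!: derivative_eq_intros)
    qed (use that in auto)
    then show ?thesis by simp
  qed
  have pi0: "0 < pi ^ card V" by simp
  have "emeasure (gauss_space V) C = (\<integral>\<^sup>+x. ennreal (exp (- (norm_idx V x)\<^sup>2) / pi ^ card V) * indicator C x \<partial>?L)"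
    unfolding gauss_space_density[OF V] by (rule emeasure_density[OF _ C]) measurable
  also have "\<dots> = (\<integral>\<^sup>+x. \<integral>\<^sup>+t. ennreal (exp (- t) / pi ^ card V) * indicator {(norm_idx V x)\<^sup>2..} t * indicator C x \<partial>lborel \<partial>?L)"
  proof (rule nn_integral_cong)
    fix x
    show "ennreal (exp (- (norm_idx V x)\<^sup>2) / pi ^ card V) * indicator C x =
      (\<integral>\<^sup>+t. ennreal (exp (- t) / pi ^ card V) * indicator {(norm_idx V x)\<^sup>2..} t * indicator C x \<partial>lborel)"
      by (subst layer[OF pi0], subst nn_integral_multc) simp_all
  qed
  also have "\<dots> = (\<integral>\<^sup>+x. \<integral>\<^sup>+t. ennreal (exp (- t) / pi ^ card V) * (if 0 \<le> t \<and> (norm_idx V x)\<^sup>2 \<le> t then indicator C x else 0) \<partial>lborel \<partial>?L)"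
    by (intro nn_integral_cong) (auto simp: indicator_def intro: order_trans[OF zero_le_power2])
  also have "\<dots> = (\<integral>\<^sup>+t. \<integral>\<^sup>+x. ennreal (exp (- t) / pi ^ card V) * (if 0 \<le> t \<and> (norm_idx V x)\<^sup>2 \<le> t then indicator C x else 0) \<partial>?L \<partial>lborel)"
    by (rule P.Fubini'[symmetric]) measurable
  also have "\<dots> = (\<integral>\<^sup>+t. ennreal (exp (- t) / pi ^ card V) * ennreal (sqrt t ^ (2 * card V)) * indicator {0<..} t * emeasure ?L (C \<inter> ?B) \<partial>lborel)"
  proof (rule nn_integral_cong_AE)
    \<comment> \<open>Only positive radii can be rescaled to 1; the single value t = 0 is a null
      set.\<close>
    have "AE t in lborel. t \<noteq> (0::real)" by (rule AE_lborel_singleton)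
    then show "AE t in lborel. (\<integral>\<^sup>+x. ennreal (exp (- t) / pi ^ card V) * (if 0 \<le> t \<and> (norm_idx V x)\<^sup>2 \<le> t then indicator C x else 0) \<partial>?L)
      = ennreal (exp (- t) / pi ^ card V) * ennreal (sqrt t ^ (2 * card V)) * indicator {0<..} t * emeasure ?L (C \<inter> ?B)"
    proof (rule AE_mp, intro AE_I2 impI)
      fix t :: real assume t0: "t \<noteq> 0"
      show "(\<integral>\<^sup>+x. ennreal (exp (- t) / pi ^ card V) * (if 0 \<le> t \<and> (norm_idx V x)\<^sup>2 \<le> t then indicator C x else 0) \<partial>?L)
        = ennreal (exp (- t) / pi ^ card V) * ennreal (sqrt t ^ (2 * card V)) * indicator {0<..} t * emeasure ?L (C \<inter> ?B)"
      proof (cases "0 < t")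
        case False
        then show ?thesis using t0 by (simp add: indicator_def)
      next
        case True
        let ?D = "C \<inter> {x \<in> space ?L. norm_idx V x \<le> sqrt t}"
        have D: "?D \<in> sets ?L" by measurable
        have st: "0 < sqrt t" using True by simp
        have sq: "(norm_idx V x)\<^sup>2 \<le> t \<longleftrightarrow> norm_idx V x \<le> sqrt t" for x
        proof
          assume "norm_idx V x \<le> sqrt t"
          then have "(norm_idx V x)\<^sup>2 \<le> (sqrt t)\<^sup>2" by (intro power_mono norm_idx_nonneg)
          then show "(norm_idx V x)\<^sup>2 \<le> t" using True by simp
        qed (rule real_le_rsqrt)
        have "(\<integral>\<^sup>+x. ennreal (exp (- t) / pi ^ card V) * (if 0 \<le> t \<and> (norm_idx V x)\<^sup>2 \<le> t then indicator C x else 0) \<partial>?L)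
          = (\<integral>\<^sup>+x. ennreal (exp (- t) / pi ^ card V) * indicator ?D x \<partial>?L)"
          by (rule nn_integral_cong) (use True sq in \<open>auto simp: indicator_def\<close>)
        also have "\<dots> = ennreal (exp (- t) / pi ^ card V) * emeasure ?L ?D"
          by (rule nn_integral_cmult_indicator[OF D])
        \<comment> \<open>Dilation turns the ball of radius sqrt t into the unit ball and leaves the
          cone \<open>C\<close> unchanged, so the dependence on t is a scalar factor collected in
          \<open>?K\<close>.\<close>
        also have "emeasure ?L ?D = ennreal (sqrt t ^ (2 * card V)) * emeasure ?L (scale_idx V (sqrt t) -` ?D \<inter> space ?L)"
          by (rule leb_idx_scale[OF V st D])
        also have "scale_idx V (sqrt t) -` ?D \<inter> space ?L = C \<inter> ?B"
        proof -
          have sp: "scale_idx V (sqrt t) x \<in> space ?L" for x by (simp add: scale_idx_def space_leb_idx)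
          have "x \<in> space ?L" if "x \<in> C" for x using sets.sets_into_space[OF C] that by blast
          then show ?thesis using cone[OF st] sp st by (auto simp: norm_scale_idx)
        qed
        finally show ?thesis using True by (simp add: mult.assoc)
      qed
    qed
  qed
  also have "\<dots> = ?K * emeasure ?L (C \<inter> ?B)"
    by (rule nn_integral_multc) measurable
  finally show "emeasure (gauss_space V) C = ?K * emeasure ?L (C \<inter> ?B)" .
qed

lemma vec_space_eq: "vec_space n s = leb_idx (idx n s)"
  by (simp add: vec_space_def leb_idx_def)

lemma vnorm_eq: "vnorm n s = norm_idx (idx n s)"
  by (rule ext) (simp add: vnorm_def norm_idx_def)

definition normalize_idx :: "'v set \<Rightarrow> ('v \<Rightarrow> complex) \<Rightarrow> 'v \<Rightarrow> complex" where
  "normalize_idx V x = restrict (\<lambda>v. x v / complex_of_real (norm_idx V x)) V"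

lemma measurable_normalize_idx [measurable]: "normalize_idx V \<in> measurable (leb_idx V) (leb_idx V)"
proof -
  have "normalize_idx V \<in> measurable (leb_idx V) (PiM V (\<lambda>_. lborel :: complex measure))"
    unfolding normalize_idx_def
  proof (intro measurable_restrict)
    fix v assume v: "v \<in> V"
    have [measurable]: "(\<lambda>x. x v) \<in> borel_measurable (leb_idx V)" by (rule measurable_coord[OF v])
    have "(\<lambda>x. x v / complex_of_real (norm_idx V x)) \<in> borel_measurable (leb_idx V)" by measurable
    then show "(\<lambda>x. x v / complex_of_real (norm_idx V x)) \<in> measurable (leb_idx V) lborel" by simp
  qed
  then show ?thesis by (simp add: leb_idx_def)
qed

lemma normalize_scale: "0 < r \<Longrightarrow> normalize_idx V (scale_idx V r x) = normalize_idx V x"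
  by (rule ext) (simp add: normalize_idx_def norm_scale_idx, simp add: scale_idx_def)

text \<open>The preimage of \<open>A\<close> under normalization is a cone, and by
  \<open>gauss_cone\<close> its Gaussian probability is proportional to its volume in the unit ball,
  which defines the uniform measure.\<close>

theorem sphere_measure_gauss:
  assumes A: "A \<in> sets (sphere_measure n s)"
  shows "measure (sphere_measure n s) A =
    measure (gauss_space (idx n s)) {x \<in> space (leb_idx (idx n s)). normalize_idx (idx n s) x \<in> A}"
proof -
  let ?V = "idx n s"
  let ?L = "leb_idx ?V"
  let ?B = "{x \<in> space ?L. norm_idx ?V x \<le> 1}"
  let ?U = "uniform_measure ?L ?B"
  have V: "finite ?V" by (simp add: idx_def)
  interpret G: prob_space "gauss_space ?V" by (rule prob_space_gauss_space)
  have sm: "sphere_measure n s = distr ?U ?L (normalize_idx ?V)"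
    unfolding sphere_measure_def vec_space_eq vnorm_eq normalize_idx_def[abs_def] ..
  have AL: "A \<in> sets ?L" using A unfolding sm by simp
  let ?C = "{x \<in> space ?L. normalize_idx ?V x \<in> A}"
  have C: "?C \<in> sets ?L" using measurable_sets[OF measurable_normalize_idx AL] by (simp add: vimage_def Int_def conj_commute)
  have B: "?B \<in> sets ?L" by measurable
  have sp: "scale_idx ?V r x \<in> space ?L" for r x by (simp add: scale_idx_def space_leb_idx)
  obtain K where K: "\<And>C. C \<in> sets ?L \<Longrightarrow> (\<And>r x. 0 < r \<Longrightarrow> x \<in> space ?L \<Longrightarrow> scale_idx ?V r x \<in> C \<longleftrightarrow> x \<in> C) \<Longrightarrow>
      emeasure (gauss_space ?V) C = K * emeasure ?L (C \<inter> ?B)" using gauss_cone[OF V] by blast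
  have "emeasure (gauss_space ?V) (space ?L) = K * emeasure ?L (space ?L \<inter> ?B)"
    by (rule K) (use sp in auto)
  moreover have "space (gauss_space ?V) = space ?L" by (rule sets_eq_imp_space_eq[OF sets_gauss_leb])
  moreover have "space ?L \<inter> ?B = ?B" by auto
  \<comment> \<open>The whole space is a cone as well. This normalizes \<open>K\<close> and shows at
    the same time that the volume of the ball is neither 0 nor infinite, as the later cancellation
    requires.\<close>
  ultimately have one: "K * emeasure ?L ?B = 1" using G.emeasure_space_1 by simp
  have gC: "emeasure (gauss_space ?V) ?C = K * emeasure ?L (?C \<inter> ?B)"
    by (rule K[OF C]) (use sp in \<open>simp add: normalize_scale\<close>)
  have nz: "emeasure ?L ?B \<noteq> 0" "emeasure ?L ?B \<noteq> \<top>"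
    using one by (auto simp: ennreal_mult_top ennreal_mult_eq_top_iff split: if_splits)
  have "emeasure (sphere_measure n s) A = emeasure ?U (normalize_idx ?V -` A \<inter> space ?U)"
    unfolding sm by (rule emeasure_distr) (use AL in simp_all)
  also have "normalize_idx ?V -` A \<inter> space ?U = ?C" by auto
  also have "emeasure ?U ?C = emeasure ?L (?B \<inter> ?C) / emeasure ?L ?B"
    by (rule emeasure_uniform_measure[OF B C])
  also have "\<dots> = K * emeasure ?L ?B * (emeasure ?L (?C \<inter> ?B) / emeasure ?L ?B)" unfolding one by (simp add: Int_commute)
  also have "\<dots> = K * emeasure ?L (?C \<inter> ?B) * emeasure ?L ?B / emeasure ?L ?B"
    by (simp add: ennreal_times_divide mult_ac)
  also have "\<dots> = K * emeasure ?L (?C \<inter> ?B)" using nz by (simp add: ennreal_mult_divide_eq)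
  finally show ?thesis unfolding measure_def gC[symmetric] by simp
qed

lemma space_sphere: "space (sphere_measure n s) = space (leb_idx (idx n s))"
  and sets_sphere: "sets (sphere_measure n s) = sets (leb_idx (idx n s))"
  by (simp_all add: sphere_measure_def vec_space_eq)

subsection \<open>Real spectra\<close>

text \<open>A list records multiplicities; its order carries no meaning.\<close>

definition real_spectrum :: "complex mat \<Rightarrow> real list \<Rightarrow> bool" where
  "real_spectrum A es \<longleftrightarrow> char_poly A = (\<Prod>e\<leftarrow>map complex_of_real es. [:- e, 1:])"

text \<open>The quadratic form of \<open>A\<close> at an eigenvector is its own conjugate and equals
  \<open>a\<close> times a positive real number.\<close>

lemma hermitian_eigenvalue_real:
  assumes A: "A \<in> carrier_mat n n" and herm: "\<And>p q. p < n \<Longrightarrow> q < n \<Longrightarrow> A $$ (p, q) = cnj (A $$ (q, p))"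
    and ev: "eigenvalue A a"
  shows "Im a = 0"
proof -
  obtain v where v: "v \<in> carrier_vec n" "v \<noteq> 0\<^sub>v n" "A *\<^sub>v v = a \<cdot>\<^sub>v v"
    using ev A unfolding eigenvalue_def eigenvector_def by auto
  have entry: "(\<Sum>q<n. A $$ (p, q) * v $ q) = a * v $ p" if p: "p < n" for p
  proof -
    have "(A *\<^sub>v v) $ p = (\<Sum>q<n. A $$ (p, q) * v $ q)"
      using A v(1) p by (simp add: scalar_prod_def atLeast0LessThan)
    then show ?thesis using v p by simp
  qed
  define N where "N = (\<Sum>p<n. cnj (v $ p) * v $ p)"
  define Q where "Q = (\<Sum>p<n. \<Sum>q<n. cnj (v $ p) * (A $$ (p, q) * v $ q))"
  have QN: "Q = a * N"
    unfolding Q_def N_def sum_distrib_left[symmetric] using entry by (simp add: sum_distrib_left mult_ac)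
  have "cnj Q = (\<Sum>p<n. \<Sum>q<n. v $ p * (cnj (A $$ (p, q)) * cnj (v $ q)))"
    by (simp add: Q_def)
  also have "\<dots> = (\<Sum>q<n. \<Sum>p<n. v $ p * (cnj (A $$ (p, q)) * cnj (v $ q)))" by (rule sum.swap)
  also have "\<dots> = Q" unfolding Q_def
    by (intro sum.cong refl) (simp add: herm[symmetric] mult_ac)
  finally have cQ: "cnj Q = Q" .
  have NN: "N = complex_of_real (\<Sum>p<n. (cmod (v $ p))\<^sup>2)"
    unfolding N_def of_real_sum complex_norm_square by (intro sum.cong refl mult.commute)
  obtain p where p: "p < n" "v $ p \<noteq> 0"
  proof -
    have "\<exists>p<n. v $ p \<noteq> 0"
    proof (rule ccontr)
      assume "\<not> (\<exists>p<n. v $ p \<noteq> 0)"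
      then have "v = 0\<^sub>v n" using v(1) by (intro eq_vecI) auto
      then show False using v(2) by simp
    qed
    then show ?thesis using that by blast
  qed
  have "0 < (\<Sum>p<n. (cmod (v $ p))\<^sup>2)"
    by (rule sum_pos2[of _ p]) (use p in auto)
  then have N0: "N \<noteq> 0" and cN: "cnj N = N" unfolding NN of_real_eq_0_iff by auto
  have "cnj a * N = a * N" using cQ unfolding QN by (simp add: cN)
  then have "cnj a = a" using N0 by simp
  then show ?thesis by (simp add: complex_eq_iff)
qed

lemma eigenvalue_iff_mem:
  fixes A :: "complex mat"
  assumes A: "A \<in> carrier_mat n n" and es: "char_poly A = (\<Prod>e\<leftarrow>as. [:- e, 1:])"
  shows "eigenvalue A a \<longleftrightarrow> a \<in> set as"
proof -
  have "poly (\<Prod>e\<leftarrow>as. [:- e, 1:]) a = 0 \<longleftrightarrow> a \<in> set as"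
    by (induction as) auto
  then show ?thesis unfolding eigenvalue_root_char_poly[OF A] es .
qed

lemma real_spectrum_exists:
  assumes A: "A \<in> carrier_mat n n" and herm: "\<And>p q. p < n \<Longrightarrow> q < n \<Longrightarrow> A $$ (p, q) = cnj (A $$ (q, p))"
  shows "\<exists>es. real_spectrum A es \<and> length es = n"
proof -
  obtain as where as: "char_poly A = (\<Prod>a\<leftarrow>as. [:- a, 1:])" "length as = n"
    using char_poly_factorized[OF A] by auto
  have "map complex_of_real (map Re as) = as"
  proof -
    have "complex_of_real (Re a) = a" if "a \<in> set as" for a
      using hermitian_eigenvalue_real[OF A herm, of a] eigenvalue_iff_mem[OF A as(1), of a] that
      by (simp add: complex_eq_iff)
    then show ?thesis by (simp add: map_idI)
  qed
  then have "real_spectrum A (map Re as)" using as(1) unfolding real_spectrum_def by simp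
  then show ?thesis using as(2) by auto
qed

lemma schur_witness:
  assumes A: "A \<in> carrier_mat n n" and sp: "real_spectrum A es"
  obtains T P Q where "T \<in> carrier_mat n n" "P \<in> carrier_mat n n" "Q \<in> carrier_mat n n"
    "P * Q = 1\<^sub>m n" "Q * P = 1\<^sub>m n" "A = P * T * Q" "upper_triangular T" "diag_mat T = map complex_of_real es"
proof -
  obtain T P Q where d: "schur_decomposition A (map complex_of_real es) = (T, P, Q)" by (metis prod_cases3)
  have cp: "char_poly A = (\<Prod>e\<leftarrow>map complex_of_real es. [:- e, 1:])" using sp unfolding real_spectrum_def .
  have w: "similar_mat_wit A T P Q" "upper_triangular T" "diag_mat T = map complex_of_real es"
    using schur_decomposition[OF A cp d] by blast+
  have dn: "dim_row A = n" using A by simp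
  have c: "A = P * T * Q" "P * Q = 1\<^sub>m n" "Q * P = 1\<^sub>m n" "{A, T, P, Q} \<subseteq> carrier_mat n n"
    using w(1) unfolding similar_mat_wit_def Let_def dn by blast+
  from c(4) have "T \<in> carrier_mat n n" "P \<in> carrier_mat n n" "Q \<in> carrier_mat n n" by blast+
  then show ?thesis by (rule that[OF _ _ _ c(2,3,1) w(2,3)])
qed

text \<open>The same similarity triangularizes both matrices, and the affine map acts on the
  diagonal entries.\<close>

lemma real_spectrum_affine:
  assumes A: "A \<in> carrier_mat n n" and sp: "real_spectrum A es"
  shows "real_spectrum (complex_of_real k \<cdot>\<^sub>m A + complex_of_real c \<cdot>\<^sub>m 1\<^sub>m n) (map (\<lambda>e. k * e + c) es)"
proof -
  obtain T P Q where w: "T \<in> carrier_mat n n" "P \<in> carrier_mat n n" "Q \<in> carrier_mat n n"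
    "P * Q = 1\<^sub>m n" "Q * P = 1\<^sub>m n" "A = P * T * Q" "upper_triangular T" "diag_mat T = map complex_of_real es"
    by (rule schur_witness[OF A sp])
  let ?k = "complex_of_real k" and ?c = "complex_of_real c"
  let ?B = "?k \<cdot>\<^sub>m A + ?c \<cdot>\<^sub>m 1\<^sub>m n" and ?T = "?k \<cdot>\<^sub>m T + ?c \<cdot>\<^sub>m 1\<^sub>m n"
  have B: "?B \<in> carrier_mat n n" and T: "?T \<in> carrier_mat n n" using A w(1) by auto
  have "P * ?T * Q = P * (?k \<cdot>\<^sub>m T) * Q + P * (?c \<cdot>\<^sub>m 1\<^sub>m n) * Q"
    using w(1-3) by (simp add: mult_add_distrib_mat[of P n n _ n _] add_mult_distrib_mat[of _ n n _ Q n])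
  also have "P * (?k \<cdot>\<^sub>m T) * Q = ?k \<cdot>\<^sub>m (P * T * Q)"
    using w(1-3) by (simp add: mult_smult_distrib[of P n n T n] mult_smult_assoc_mat[of "P * T" n n Q n])
  also have "P * (?c \<cdot>\<^sub>m 1\<^sub>m n) * Q = ?c \<cdot>\<^sub>m 1\<^sub>m n"
    using w(1-4) by (simp add: mult_smult_distrib[of P n n _ n] mult_smult_assoc_mat[of P n n Q n])
  finally have eq: "?B = P * ?T * Q" unfolding w(6)[symmetric] ..
  have sim: "similar_mat ?B ?T"
    by (rule similar_matI[OF _ w(4,5) eq]) (use B T w(2,3) in blast)
  have up: "upper_triangular ?T"
  proof (rule upper_triangularI)
    fix i j assume ij: "j < i" "i < dim_row ?T"
    then have "T $$ (i, j) = 0" using w(1) w(7) by (intro upper_triangularD) auto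
    then show "?T $$ (i, j) = 0" using ij w(1) by simp
  qed
  have dg: "diag_mat ?T = map complex_of_real (map (\<lambda>e. k * e + c) es)"
  proof (rule nth_equalityI)
    have l: "length es = n" using arg_cong[OF w(8), of length] w(1) by (simp add: diag_mat_def)
    show "length (diag_mat ?T) = length (map complex_of_real (map (\<lambda>e. k * e + c) es))"
      using w(1) l by (simp add: diag_mat_def)
    fix i assume "i < length (diag_mat ?T)"
    then have i: "i < n" using w(1) by (simp add: diag_mat_def)
    have "T $$ (i, i) = diag_mat T ! i" using i w(1) by (simp add: diag_mat_def)
    also have "\<dots> = complex_of_real (es ! i)" unfolding w(8) using i l by simp
    finally show "diag_mat ?T ! i = map complex_of_real (map (\<lambda>e. k * e + c) es) ! i"
      using i w(1) l by (simp add: diag_mat_def)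
  qed
  have "char_poly ?B = char_poly ?T" by (rule char_poly_similar[OF sim])
  also have "\<dots> = (\<Prod>a\<leftarrow>diag_mat ?T. [:- a, 1:])" by (rule char_poly_upper_triangular[OF T up])
  finally show ?thesis unfolding real_spectrum_def dg .
qed

lemma order_linear_factors:
  "Polynomial.order a (\<Prod>e\<leftarrow>as. [:- e, 1:]) = count_list as (a :: complex)"
proof (induction as)
  case (Cons b as)
  have nz: "(\<Prod>e\<leftarrow>as. [:- e, 1:]) \<noteq> 0" by (subst prod_list_zero_iff) auto
  have "Polynomial.order a [:- b, 1:] = of_bool (b = a)"
    using order_power_n_n[of a 1] by (auto intro: order_0I)
  moreover have "Polynomial.order a ([:- b, 1:] * (\<Prod>e\<leftarrow>as. [:- e, 1:])) = Polynomial.order a [:- b, 1:] + Polynomial.order a (\<Prod>e\<leftarrow>as. [:- e, 1:])"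
    by (rule order_mult) (use nz in \<open>simp del: mult_pCons_left\<close>)
  ultimately show ?case using Cons by (simp del: mult_pCons_left)
qed simp

lemma eig_count_spectrum:
  assumes A: "A \<in> carrier_mat n n" and sp: "real_spectrum A es"
  shows "eig_count A S = length (filter (\<lambda>e. e \<in> S) es)"
proof -
  let ?X = "{a. eigenvalue A a \<and> Im a = 0 \<and> Re a \<in> S}"
  have cp: "char_poly A = (\<Prod>e\<leftarrow>map complex_of_real es. [:- e, 1:])" using sp by (simp add: real_spectrum_def)
  have X: "?X = complex_of_real ` set (filter (\<lambda>e. e \<in> S) es)"
    unfolding eigenvalue_iff_mem[OF A cp] by (auto simp: image_iff)
  have cnt: "count_list (map complex_of_real xs) (complex_of_real e) = count_list xs e" for xs e
    by (induction xs) auto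
  have cf: "count_list (filter (\<lambda>e. e \<in> S) xs) e = count_list xs e" if "e \<in> S" for xs e
    using that by (induction xs) auto
  have "eig_count A S = (\<Sum>a\<in>complex_of_real ` set (filter (\<lambda>e. e \<in> S) es). count_list (map complex_of_real es) a)"
    unfolding eig_count_def X cp order_linear_factors ..
  also have "\<dots> = (\<Sum>e\<in>set (filter (\<lambda>e. e \<in> S) es). count_list es e)"
    by (subst sum.reindex) (auto simp: inj_on_def cnt)
  also have "\<dots> = (\<Sum>e\<in>set (filter (\<lambda>e. e \<in> S) es). count_list (filter (\<lambda>e. e \<in> S) es) e)"
    by (rule sum.cong) (auto simp: cf)
  also have "\<dots> = length (filter (\<lambda>e. e \<in> S) es)"
    by (rule sum_count_set) auto
  finally show ?thesis .
qed

lemma lambda_spectrum: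
  assumes A: "A \<in> carrier_mat n n" and sp: "real_spectrum A es"
  shows "lambda_max A = Max (set es)" "lambda_min A = Min (set es)"
proof -
  have cp: "char_poly A = (\<Prod>e\<leftarrow>map complex_of_real es. [:- e, 1:])" using sp by (simp add: real_spectrum_def)
  have "{Re a | a. eigenvalue A a} = set es"
    unfolding eigenvalue_iff_mem[OF A cp] by force
  then show "lambda_max A = Max (set es)" "lambda_min A = Min (set es)"
    by (simp_all add: lambda_max_def lambda_min_def)
qed

section \<open>Chebyshev polynomials of a matrix and their traces\<close>

fun cheb_gen :: "'a::comm_ring_1 \<Rightarrow> nat \<Rightarrow> 'a \<Rightarrow> 'a" where
  "cheb_gen c 0 z = 1"
| "cheb_gen c (Suc 0) z = z"
| "cheb_gen c (Suc (Suc p)) z = cheb_gen c (Suc p) z * z - c * cheb_gen c p z"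

fun cheb_mat :: "nat \<Rightarrow> complex mat \<Rightarrow> complex \<Rightarrow> nat \<Rightarrow> complex mat" where
  "cheb_mat n B c 0 = 1\<^sub>m n"
| "cheb_mat n B c (Suc 0) = B"
| "cheb_mat n B c (Suc (Suc p)) = cheb_mat n B c (Suc p) * B - c \<cdot>\<^sub>m cheb_mat n B c p"

lemma cheb_mat_carrier: "B \<in> carrier_mat n n \<Longrightarrow> cheb_mat n B c p \<in> carrier_mat n n"
  by (induction p rule: induct_nat_012) auto

lemma mat_mult_entry:
  assumes "X \<in> carrier_mat n n" "Y \<in> carrier_mat n n" "i < n" "j < n"
  shows "(X * Y) $$ (i, j) = (\<Sum>k<n. X $$ (i, k) * Y $$ (k, j))"
  using assms by (simp add: scalar_prod_def atLeast0LessThan)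

lemma cheb_mat_entry:
  assumes B: "B \<in> carrier_mat n n" and y: "y < n" and z: "z < n"
    and b: "\<And>y z. y < n \<Longrightarrow> z < n \<Longrightarrow> b y z = B $$ (y, z)"
  shows "cheb_mat n B c p $$ (y, z) = cheb_entry b n c p y z"
  using z
proof (induction p arbitrary: z rule: induct_nat_012)
  case 0
  then show ?case using y by simp
next
  case 1
  then show ?case using y by (simp add: b)
next
  case (ge2 p)
  have c: "cheb_mat n B c (Suc p) \<in> carrier_mat n n" "cheb_mat n B c p \<in> carrier_mat n n"
    by (rule cheb_mat_carrier[OF B])+
  have "cheb_mat n B c (Suc (Suc p)) $$ (y, z) =
     (cheb_mat n B c (Suc p) * B) $$ (y, z) - c * cheb_mat n B c p $$ (y, z)"
    using c B y ge2.prems by simp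
  also have "(cheb_mat n B c (Suc p) * B) $$ (y, z) = (\<Sum>k<n. cheb_mat n B c (Suc p) $$ (y, k) * B $$ (k, z))"
    by (rule mat_mult_entry[OF c(1) B y ge2.prems])
  also have "\<dots> = (\<Sum>k<n. cheb_entry b n c (Suc p) y k * b k z)"
    by (rule sum.cong) (use ge2 b in auto)
  finally show ?case using ge2 by simp
qed

lemma cheb_mat_triangular:
  assumes T: "T \<in> carrier_mat n n" and up: "upper_triangular T"
  shows "upper_triangular (cheb_mat n T c p) \<and> (\<forall>i<n. cheb_mat n T c p $$ (i, i) = cheb_gen c p (T $$ (i, i)))"
proof (induction p rule: induct_nat_012)
  case 0
  then show ?case by simp
next
  case 1
  then show ?case using up by simp
next
  case (ge2 p)
  let ?X = "cheb_mat n T c (Suc p)" and ?Y = "cheb_mat n T c p"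
  have c: "?X \<in> carrier_mat n n" "?Y \<in> carrier_mat n n"
    by (rule cheb_mat_carrier[OF T])+
  have X: "?X $$ (i, j) = 0" if "j < i" "i < n" for i j
    using ge2 that c(1) upper_triangularD by (metis carrier_matD(1))
  have Y: "?Y $$ (i, j) = 0" if "j < i" "i < n" for i j
    using ge2 that c(2) upper_triangularD by (metis carrier_matD(1))
  have TT: "T $$ (i, j) = 0" if "j < i" "i < n" for i j
    using up that T upper_triangularD by (metis carrier_matD(1))
  have e: "cheb_mat n T c (Suc (Suc p)) $$ (i, j) = (\<Sum>k<n. ?X $$ (i, k) * T $$ (k, j)) - c * ?Y $$ (i, j)"
    if "i < n" "j < n" for i j
    using c T that mat_mult_entry[OF c(1) T that] by simp
  show ?case
  proof (intro conjI allI impI upper_triangularI)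
    fix i j assume "j < i" "i < dim_row (cheb_mat n T c (Suc (Suc p)))"
    then have ij: "j < i" "i < n" using T c by auto
    have "(\<Sum>k<n. ?X $$ (i, k) * T $$ (k, j)) = 0"
    proof (rule sum.neutral, intro ballI)
      fix k assume k: "k \<in> {..<n}"
      show "?X $$ (i, k) * T $$ (k, j) = 0"
        by (cases "k < i") (use X[of k i] TT[of j k] k ij in auto)
    qed
    then show "cheb_mat n T c (Suc (Suc p)) $$ (i, j) = 0" using e[of i j] ij Y[OF ij] by simp
  next
    fix i assume i: "i < n"
    have "(\<Sum>k<n. ?X $$ (i, k) * T $$ (k, i)) = (\<Sum>k<n. if k = i then ?X $$ (i, i) * T $$ (i, i) else 0)"
    proof (rule sum.cong[OF refl])
      fix k assume k: "k \<in> {..<n}"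
      show "?X $$ (i, k) * T $$ (k, i) = (if k = i then ?X $$ (i, i) * T $$ (i, i) else 0)"
        using X[of k i] TT[of i k] k i by (cases k i rule: linorder_cases) auto
    qed
    then show "cheb_mat n T c (Suc (Suc p)) $$ (i, i) = cheb_gen c (Suc (Suc p)) (T $$ (i, i))"
      using e[OF i i] i ge2 by simp
  qed
qed

lemma cheb_mat_similar:
  assumes w: "T \<in> carrier_mat n n" "P \<in> carrier_mat n n" "Q \<in> carrier_mat n n" "P * Q = 1\<^sub>m n" "Q * P = 1\<^sub>m n"
  shows "cheb_mat n (P * T * Q) c p = P * cheb_mat n T c p * Q"
proof (induction p rule: induct_nat_012)
  case 0
  then show ?case using w by simp
next
  case 1
  then show ?case by simp
next
  case (ge2 p)
  let ?X = "cheb_mat n T c (Suc p)" and ?Y = "cheb_mat n T c p"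
  have c: "?X \<in> carrier_mat n n" "?Y \<in> carrier_mat n n"
    by (rule cheb_mat_carrier[OF w(1)])+
  have "Q * (P * (T * Q)) = Q * P * (T * Q)"
    using w by (intro assoc_mult_mat[symmetric, of _ n n _ n _ n]) auto
  also have "\<dots> = T * Q" using w by simp
  finally have qp: "Q * (P * (T * Q)) = T * Q" .
  have m: "(P * ?X * Q) * (P * T * Q) = P * (?X * T) * Q"
    using w c qp by (simp add: assoc_mult_mat[of _ n n _ n _ n])
  have "P * (?X * T - c \<cdot>\<^sub>m ?Y) * Q = P * (?X * T) * Q - P * (c \<cdot>\<^sub>m ?Y) * Q"
    using w c by (simp add: mult_minus_distrib_mat[of P n n _ n _] minus_mult_distrib_mat[of _ n n _ Q n])
  also have "P * (c \<cdot>\<^sub>m ?Y) * Q = c \<cdot>\<^sub>m (P * ?Y * Q)"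
    using w c by (simp add: mult_smult_distrib[of P n n _ n] mult_smult_assoc_mat[of "P * ?Y" n n Q n])
  finally show ?case using ge2 m by simp
qed

lemma trace_mult_commute:
  fixes X Y :: "complex mat"
  assumes "X \<in> carrier_mat n n" "Y \<in> carrier_mat n n"
  shows "(\<Sum>i<n. (X * Y) $$ (i, i)) = (\<Sum>i<n. (Y * X) $$ (i, i))"
proof -
  have "(\<Sum>i<n. (X * Y) $$ (i, i)) = (\<Sum>i<n. \<Sum>k<n. X $$ (i, k) * Y $$ (k, i))"
    by (rule sum.cong) (use mat_mult_entry[OF assms] in auto)
  also have "\<dots> = (\<Sum>k<n. \<Sum>i<n. X $$ (i, k) * Y $$ (k, i))" by (rule sum.swap)
  also have "\<dots> = (\<Sum>k<n. (Y * X) $$ (k, k))"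
  proof (rule sum.cong[OF refl])
    fix k assume "k \<in> {..<n}"
    then have "(Y * X) $$ (k, k) = (\<Sum>i<n. Y $$ (k, i) * X $$ (i, k))" by (intro mat_mult_entry[OF assms(2,1)]) auto
    then show "(\<Sum>i<n. X $$ (i, k) * Y $$ (k, i)) = (Y * X) $$ (k, k)" by (simp only: mult.commute)
  qed
  finally show ?thesis .
qed

lemma cheb_gen_of_real: "cheb_gen (complex_of_real c) p (complex_of_real e) = complex_of_real (cheb_gen c p e)"
  by (induction p rule: induct_nat_012) auto

text \<open>A triangular form suffices: polynomials of an upper triangular matrix act entrywise on
  its diagonal, and the change of basis disappears under the trace.\<close>

lemma cheb_entry_trace:
  assumes B: "B \<in> carrier_mat n n" and sp: "real_spectrum B es"
    and b: "\<And>y z. y < n \<Longrightarrow> z < n \<Longrightarrow> b y z = B $$ (y, z)"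
  shows "(\<Sum>y<n. cheb_entry b n (complex_of_real c) p y y) = complex_of_real (\<Sum>e\<leftarrow>es. cheb_gen c p e)"
proof -
  obtain T P Q where w: "T \<in> carrier_mat n n" "P \<in> carrier_mat n n" "Q \<in> carrier_mat n n"
    "P * Q = 1\<^sub>m n" "Q * P = 1\<^sub>m n" "B = P * T * Q" "upper_triangular T" "diag_mat T = map complex_of_real es"
    by (rule schur_witness[OF B sp])
  let ?c = "complex_of_real c"
  let ?U = "cheb_mat n T ?c p"
  have U: "?U \<in> carrier_mat n n" by (rule cheb_mat_carrier[OF w(1)])
  have l: "length es = n" using arg_cong[OF w(8), of length] w(1) by (simp add: diag_mat_def)
  have "(\<Sum>y<n. cheb_entry b n ?c p y y) = (\<Sum>y<n. cheb_mat n B ?c p $$ (y, y))"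
    by (rule sum.cong) (use cheb_mat_entry[OF B _ _ b] in auto)
  also have "\<dots> = (\<Sum>y<n. (P * (?U * Q)) $$ (y, y))"
    unfolding w(6) cheb_mat_similar[OF w(1-5)] using assoc_mult_mat[OF w(2) U w(3)] by simp
  also have "\<dots> = (\<Sum>y<n. (?U * Q * P) $$ (y, y))"
    by (rule trace_mult_commute) (use w U in auto)
  also have "?U * Q * P = ?U" using assoc_mult_mat[OF U w(3) w(2)] w(5) U by simp
  also have "(\<Sum>y<n. ?U $$ (y, y)) = (\<Sum>y<n. complex_of_real (cheb_gen c p (es ! y)))"
  proof (rule sum.cong[OF refl])
    fix y assume "y \<in> {..<n}"
    then have y: "y < n" by simp
    have "T $$ (y, y) = diag_mat T ! y" using y w(1) by (simp add: diag_mat_def)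
    also have "\<dots> = complex_of_real (es ! y)" unfolding w(8) using y l by simp
    finally show "?U $$ (y, y) = complex_of_real (cheb_gen c p (es ! y))"
      using cheb_mat_triangular[OF w(1) w(7), of ?c p] y by (simp add: cheb_gen_of_real)
  qed
  also have "\<dots> = complex_of_real (\<Sum>e\<leftarrow>es. cheb_gen c p e)"
    unfolding sum_list_sum_nth by (simp add: l atLeast0LessThan)
  finally show ?thesis .
qed

subsection \<open>The semicircular distribution\<close>

abbreviation cheb :: "nat \<Rightarrow> real \<Rightarrow> real" where "cheb \<equiv> cheb_gen 1"

lemma cheb_cos: "cheb p (2 * cos t) * sin t = sin ((real p + 1) * t)"
proof (induction p rule: induct_nat_012)
  case 0
  then show ?case by simp
next
  case 1
  then show ?case using sin_double[of t] by (simp add: mult_ac)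
next
  case (ge2 p)
  have "cheb (Suc (Suc p)) (2 * cos t) * sin t = 2 * cos t * (cheb (Suc p) (2 * cos t) * sin t) - cheb p (2 * cos t) * sin t"
    by (simp add: algebra_simps)
  also have "\<dots> = 2 * cos t * sin ((real (Suc p) + 1) * t) - sin ((real p + 1) * t)" unfolding ge2 ..
  also have "sin ((real p + 1) * t) = sin ((real (Suc p) + 1) * t) * cos t - cos ((real (Suc p) + 1) * t) * sin t"
    unfolding sin_diff[symmetric] by (rule arg_cong[of _ _ sin]) (simp add: algebra_simps)
  also have "2 * cos t * sin ((real (Suc p) + 1) * t) - \<dots> = sin ((real (Suc p) + 1) * t + t)"
    unfolding sin_add by (simp add: algebra_simps)
  also have "(real (Suc p) + 1) * t + t = (real (Suc (Suc p)) + 1) * t" by (simp add: algebra_simps)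
  finally show ?case .
qed

lemma continuous_cheb [continuous_intros]: "continuous_on S g \<Longrightarrow> continuous_on S (\<lambda>x. cheb p (g x))"
  by (induction p rule: induct_nat_012) (auto intro!: continuous_intros)

definition sc_weight :: "real \<Rightarrow> real \<Rightarrow> real" where
  "sc_weight r x = sqrt (4 * r\<^sup>2 - (x - 1)\<^sup>2) / (2 * pi * r\<^sup>2)"

lemma sc_weight_continuous: "r > 0 \<Longrightarrow> continuous_on S (sc_weight r)"
  unfolding sc_weight_def[abs_def] by (intro continuous_intros) auto

lemma sc_weight_nonneg: assumes "r > 0" "x \<in> {1 - 2 * r..1 + 2 * r}" shows "0 \<le> sc_weight r x"
proof -
  have "\<bar>x - 1\<bar> \<le> \<bar>2 * r\<bar>" using assms by auto
  then have "(x - 1)\<^sup>2 \<le> (2 * r)\<^sup>2" by (rule abs_le_square_iff[THEN iffD1])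
  then show ?thesis by (simp add: sc_weight_def power_mult_distrib)
qed

text \<open>Substituting x = 1 + 2 r cos \<theta> turns weight, polynomial and differential into 2
  sin \<theta> sin ((p + 1) \<theta>) / pi, a difference of two cosines. Its integral over [0, pi]
  vanishes except for the constant one at \<open>p = 0\<close>.\<close>

lemma sc_cheb_has_integral:
  assumes r: "r > 0"
  shows "((\<lambda>x. sc_weight r x * cheb p ((x - 1) / r)) has_integral (of_bool (p = 0))) {1 - 2 * r..1 + 2 * r}"
proof -
  define \<theta> where "\<theta> x = arccos ((x - 1) / (2 * r))" for x
  \<comment> \<open>A primitive of cos (p t); at \<open>p = 0\<close> the quotient degenerates and
    is replaced by its limit t.\<close>
  define Sp where "Sp t = (if p = 0 then t else sin (real p * t) / real p)" for t
  define \<Phi> where "\<Phi> t = - (Sp t - sin (real (p + 2) * t) / real (p + 2)) / pi" for t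
  have dSp: "(Sp has_real_derivative cos (real p * t)) (at t)" for t
  proof (cases "p = 0")
    case True
    then show ?thesis by (auto simp: Sp_def[abs_def])
  next
    case False
    then show ?thesis unfolding Sp_def[abs_def] by (auto intro!: derivative_eq_intros)
  qed
  have d\<Phi>: "(\<Phi> has_real_derivative - (cos (real p * t) - cos (real (p + 2) * t)) / pi) (at t)" for t
    unfolding \<Phi>_def[abs_def] by (auto intro!: derivative_eq_intros dSp)
  have ends: "\<theta> (1 + 2 * r) = 0" "\<theta> (1 - 2 * r) = pi" using r by (simp_all add: \<theta>_def)
  have "((\<lambda>x. sc_weight r x * cheb p ((x - 1) / r)) has_integral \<Phi> (\<theta> (1 + 2 * r)) - \<Phi> (\<theta> (1 - 2 * r))) {1 - 2 * r..1 + 2 * r}"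
  \<comment> \<open>arccos is not differentiable at the end points, hence the version that asks for
    derivatives only inside and for continuity up to the boundary.\<close>
  proof (rule fundamental_theorem_of_calculus_interior)
    show "1 - 2 * r \<le> 1 + 2 * r" using r by simp
    have "continuous_on {1 - 2 * r..1 + 2 * r} \<theta>"
      unfolding \<theta>_def[abs_def] using r by (intro continuous_intros) (auto simp: field_simps)
    moreover have "continuous_on UNIV \<Phi>"
      using d\<Phi> by (meson DERIV_isCont continuous_at_imp_continuous_on)
    ultimately show "continuous_on {1 - 2 * r..1 + 2 * r} (\<lambda>x. \<Phi> (\<theta> x))"
      by (metis continuous_on_compose2 subset_UNIV)
    fix x assume x: "x \<in> {1 - 2 * r<..<1 + 2 * r}"
    let ?y = "(x - 1) / (2 * r)"
    have y: "- 1 < ?y" "?y < 1" using x r by (auto simp: field_simps)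
    have cth: "cos (\<theta> x) = ?y" using y by (simp add: \<theta>_def)
    have sth: "sin (\<theta> x) = sqrt (1 - ?y\<^sup>2)" using y by (simp add: \<theta>_def sin_arccos)
    have y2: "?y\<^sup>2 < 1" using y by (simp add: abs_square_less_1 abs_less_iff)
    have spos: "0 < sin (\<theta> x)" unfolding sth using y2 by simp
    have d\<theta>: "(\<theta> has_real_derivative inverse (- sin (\<theta> x)) * (1 / (2 * r))) (at x)"
    proof -
      have "(arccos has_real_derivative inverse (- sin (\<theta> x))) (at ?y)"
        unfolding sth using DERIV_arccos[of ?y] y by simp
      moreover have "((\<lambda>x. (x - 1) / (2 * r)) has_real_derivative 1 / (2 * r)) (at x)"
        using r by (auto intro!: derivative_eq_intros)
      ultimately show ?thesis unfolding \<theta>_def[abs_def] by (rule DERIV_chain2)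
    qed
    have "((\<lambda>x. \<Phi> (\<theta> x)) has_real_derivative
       (- (cos (real p * \<theta> x) - cos (real (p + 2) * \<theta> x)) / pi) * (inverse (- sin (\<theta> x)) * (1 / (2 * r)))) (at x)"
      by (rule DERIV_chain2[OF d\<Phi> d\<theta>])
    also have "(- (cos (real p * \<theta> x) - cos (real (p + 2) * \<theta> x)) / pi) * (inverse (- sin (\<theta> x)) * (1 / (2 * r)))
      = sc_weight r x * cheb p ((x - 1) / r)"
    proof -
      let ?t = "\<theta> x"
      have "cos (real p * ?t) - cos (real (p + 2) * ?t) = 2 * sin ((real p + 1) * ?t) * sin ?t"
      proof -
        have e: "real p * ?t = (real p + 1) * ?t - ?t" "real (p + 2) * ?t = (real p + 1) * ?t + ?t"
          by (simp_all add: algebra_simps)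
        show ?thesis unfolding e cos_diff cos_add by simp
      qed
      also have "sin ((real p + 1) * ?t) = cheb p ((x - 1) / r) * sin ?t"
      proof -
        have "2 * ((x - 1) / (2 * r)) = (x - 1) / r" using r by (simp add: field_simps)
        then show ?thesis using cheb_cos[of p ?t] unfolding cth by simp
      qed
      finally have "(- (cos (real p * ?t) - cos (real (p + 2) * ?t)) / pi) * (inverse (- sin ?t) * (1 / (2 * r)))
         = cheb p ((x - 1) / r) * (sin ?t / (pi * r))"
        using spos r by (simp add: field_simps)
      also have "sin ?t / (pi * r) = sc_weight r x"
      proof -
        have "4 * r\<^sup>2 - (x - 1)\<^sup>2 = (2 * r)\<^sup>2 * (1 - ?y\<^sup>2)" using r by (simp add: field_simps power2_eq_square)
        then have "sqrt (4 * r\<^sup>2 - (x - 1)\<^sup>2) = 2 * r * sin ?t"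
          unfolding sth using r by (simp add: real_sqrt_mult)
        then show ?thesis using r by (simp add: sc_weight_def field_simps power2_eq_square)
      qed
      finally show ?thesis by (simp add: mult_ac)
    qed
    finally show "((\<lambda>x. \<Phi> (\<theta> x)) has_vector_derivative sc_weight r x * cheb p ((x - 1) / r)) (at x)"
      by (simp add: has_real_derivative_iff_has_vector_derivative)
  qed
  moreover have "\<Phi> (\<theta> (1 + 2 * r)) - \<Phi> (\<theta> (1 - 2 * r)) = of_bool (p = 0)"
    unfolding ends \<Phi>_def Sp_def using sin_npi[of p] sin_npi[of "p + 2"] by (simp del: of_nat_add)
  ultimately show ?thesis by simp
qed

lemma semicircle_eq:
  assumes r: "r > 0"
  shows "semicircle 1 (r\<^sup>2) = density lborel (\<lambda>x. ennreal (indicator {1 - 2 * r..1 + 2 * r} x * sc_weight r x))"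
proof -
  have "sqrt (r\<^sup>2) = r" using r by simp
  then show ?thesis
    unfolding semicircle_def semicircle_density_def[abs_def] sc_weight_def by simp
qed

lemma semicircle_integral:
  assumes r: "r > 0" and g: "continuous_on UNIV (g :: real \<Rightarrow> real)"
  shows "integrable (semicircle 1 (r\<^sup>2)) g"
    "integral\<^sup>L (semicircle 1 (r\<^sup>2)) g = integral {1 - 2 * r..1 + 2 * r} (\<lambda>x. sc_weight r x * g x)"
proof -
  let ?I = "{1 - 2 * r..1 + 2 * r}"
  have c: "continuous_on ?I (\<lambda>x. sc_weight r x * g x)"
    by (intro continuous_intros sc_weight_continuous r continuous_on_subset[OF g]) simp
  have i: "set_integrable lborel ?I (\<lambda>x. sc_weight r x * g x)" by (rule borel_integrable_atLeastAtMost'[OF c])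
  have mg: "g \<in> borel_measurable borel" using g by (rule borel_measurable_continuous_onI)
  have mw: "sc_weight r \<in> borel_measurable borel" using sc_weight_continuous[OF r] by (rule borel_measurable_continuous_onI)
  have D: "(\<lambda>x. indicator ?I x * sc_weight r x) \<in> borel_measurable lborel" using mw by measurable
  have nn: "AE x in lborel. 0 \<le> indicator ?I x * sc_weight r x"
    by (rule AE_I2) (use sc_weight_nonneg[OF r] in \<open>auto simp: indicator_def\<close>)
  have eq: "(\<lambda>x. (indicator ?I x * sc_weight r x) *\<^sub>R g x) = (\<lambda>x. indicator ?I x *\<^sub>R (sc_weight r x * g x))" by auto
  show "integrable (semicircle 1 (r\<^sup>2)) g"
    unfolding semicircle_eq[OF r] using integrable_density[OF _ D nn, of g] mg i unfolding set_integrable_def eq by simp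
  have "integral\<^sup>L (semicircle 1 (r\<^sup>2)) g = (\<integral>x. (indicator ?I x * sc_weight r x) *\<^sub>R g x \<partial>lborel)"
    unfolding semicircle_eq[OF r] by (rule integral_density) (use mg D nn in auto)
  also have "\<dots> = (LINT x:?I|lborel. sc_weight r x * g x)" unfolding eq set_lebesgue_integral_def ..
  also have "\<dots> = integral ?I (\<lambda>x. sc_weight r x * g x)" by (rule set_borel_integral_eq_integral(2)[OF i])
  finally show "integral\<^sup>L (semicircle 1 (r\<^sup>2)) g = integral ?I (\<lambda>x. sc_weight r x * g x)" .
qed

lemma semicircle_cheb:
  assumes r: "r > 0"
  shows "integral\<^sup>L (semicircle 1 (r\<^sup>2)) (\<lambda>x. cheb p ((x - 1) / r)) = of_bool (p = 0)"
  using semicircle_integral(2)[OF r, of "\<lambda>x. cheb p ((x - 1) / r)"] integral_unique[OF sc_cheb_has_integral[OF r, of p]] r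
  by (simp add: continuous_intros)

lemma space_semicircle: "space (semicircle a v) = UNIV" and sets_semicircle: "sets (semicircle a v) = sets borel"
  by (simp_all add: semicircle_def)

lemma prob_space_semicircle:
  assumes r: "r > 0" shows "prob_space (semicircle 1 (r\<^sup>2))"
proof
  let ?\<mu> = "semicircle 1 (r\<^sup>2)"
  have i: "integrable ?\<mu> (\<lambda>_. 1 :: real)" using semicircle_integral(1)[OF r, of "\<lambda>_. 1"] by simp
  have "integrable ?\<mu> (indicator (space ?\<mu>) :: real \<Rightarrow> real)"
    using i by (simp add: indicator_def[abs_def] space_semicircle)
  then have fin: "emeasure ?\<mu> (space ?\<mu>) \<noteq> \<infinity>" unfolding integrable_indicator_iff by auto
  have "measure ?\<mu> (space ?\<mu>) = 1" using semicircle_cheb[OF r, of 0] by simp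
  then show "emeasure ?\<mu> (space ?\<mu>) = 1" using emeasure_eq_ennreal_measure[of ?\<mu> "space ?\<mu>"] fin by simp
qed

lemma semicircle_support:
  assumes r: "r > 0" shows "AE x in semicircle 1 (r\<^sup>2). x \<in> {1 - 2 * r..1 + 2 * r}"
proof -
  have mw: "sc_weight r \<in> borel_measurable borel" using sc_weight_continuous[OF r] by (rule borel_measurable_continuous_onI)
  then have m: "(\<lambda>x. ennreal (indicator {1 - 2 * r..1 + 2 * r} x * sc_weight r x)) \<in> borel_measurable lborel" by measurable
  show ?thesis unfolding semicircle_eq[OF r] AE_density[OF m] by (rule AE_I2) (auto simp: indicator_def)
qed

inductive cheb_span :: "(real \<Rightarrow> real) \<Rightarrow> bool" where
  zero: "cheb_span (\<lambda>_. 0)"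
| add: "cheb_span f \<Longrightarrow> cheb_span (\<lambda>x. f x + c * cheb m x)"

lemma cheb_span_add: assumes "cheb_span f" "cheb_span g" shows "cheb_span (\<lambda>x. f x + g x)"
  using assms(2)
proof induction
  case zero
  then show ?case using assms(1) by simp
next
  case (add g c m)
  from cheb_span.add[OF add.IH, of c m] show ?case by (simp add: add.assoc)
qed

lemma cheb_span_scale: assumes "cheb_span f" shows "cheb_span (\<lambda>x. a * f x)"
  using assms
proof induction
  case zero
  then show ?case by (simp add: cheb_span.zero)
next
  case (add f c m)
  from cheb_span.add[OF add.IH, of "a * c" m] show ?case by (simp add: algebra_simps)
qed

text \<open>The recursion read backwards: x times the polynomial of degree k + 1 is the sum of those
  of degrees k + 2 and k.\<close>

lemma cheb_span_mult_x: assumes "cheb_span f" shows "cheb_span (\<lambda>x. x * f x)"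
  using assms
proof induction
  case zero
  then show ?case by (simp add: cheb_span.zero)
next
  case (add f c m)
  show ?case
  proof (cases m)
    case 0
    from cheb_span.add[OF add.IH, of c "Suc 0"] show ?thesis using 0 by (simp add: algebra_simps)
  next
    case (Suc k)
    from cheb_span.add[OF cheb_span.add[OF add.IH, of c "Suc (Suc k)"], of c k] show ?thesis
      using Suc by (simp add: algebra_simps)
  qed
qed

lemma cheb_span_polynomial: "cheb_span (\<lambda>x. \<Sum>i\<le>n. a i * x ^ i)"
proof (induction n)
  case 0
  from cheb_span.add[OF cheb_span.zero, of "a 0" 0] show ?case by simp
next
  case (Suc n)
  have "cheb_span (\<lambda>x. x ^ k)" for k
  proof (induction k)
    case 0
    from cheb_span.add[OF cheb_span.zero, of 1 0] show ?case by simp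
  next
    case (Suc k)
    from cheb_span_mult_x[OF Suc] show ?case by simp
  qed
  from cheb_span_add[OF Suc cheb_span_scale[OF this[of "Suc n"], of "a (Suc n)"]] show ?case by simp
qed

lemma cheb_span_sum:
  assumes "cheb_span f" shows "\<exists>M c. f = (\<lambda>x. \<Sum>m\<le>M. c m * cheb m x)"
  using assms
proof induction
  case zero
  show ?case by (intro exI[of _ 0] exI[of _ "\<lambda>_. 0"]) simp
next
  case (add f b m)
  then obtain M c where f: "f = (\<lambda>x. \<Sum>m\<le>M. c m * cheb m x)" by blast
  define c' where "c' k = (if k \<le> M then c k else 0) + (if k = m then b else 0)" for k
  have "f x + b * cheb m x = (\<Sum>k\<le>max M m. c' k * cheb k x)" for x
  proof -
    have "(\<Sum>k\<le>max M m. c' k * cheb k x) = (\<Sum>k\<le>max M m. if k \<le> M then c k * cheb k x else 0) + (\<Sum>k\<le>max M m. if k = m then b * cheb k x else 0)"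
      unfolding sum.distrib[symmetric] by (rule sum.cong) (auto simp: c'_def algebra_simps)
    also have "(\<Sum>k\<le>max M m. if k \<le> M then c k * cheb k x else 0) = (\<Sum>k\<le>M. c k * cheb k x)"
      by (subst sum.inter_filter[symmetric]) (auto intro!: sum.cong)
    also have "(\<Sum>k\<le>max M m. if k = m then b * cheb k x else 0) = b * cheb m x" by simp
    finally show ?thesis by (simp add: f)
  qed
  then show ?case by blast
qed

lemma weierstrass_cheb:
  assumes f: "continuous_on UNIV (f :: real \<Rightarrow> real)" and e: "0 < e"
  shows "\<exists>M c. \<forall>x. \<bar>x\<bar> \<le> K \<longrightarrow> \<bar>f x - (\<Sum>m\<le>M. c m * cheb m x)\<bar> < e"
proof -
  obtain g where g: "real_polynomial_function g" "\<And>x. x \<in> {-K..K} \<Longrightarrow> \<bar>f x - g x\<bar> < e"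
    using Stone_Weierstrass_real_polynomial_function[of "{-K..K}" f e] continuous_on_subset[OF f, of "{-K..K}"] e
    by (metis compact_Icc subset_UNIV)
  obtain a n where "g = (\<lambda>x. \<Sum>i\<le>n. a i * x ^ i)" using g(1) unfolding real_polynomial_function_iff_sum by blast
  then obtain M c where "g = (\<lambda>x. \<Sum>m\<le>M. c m * cheb m x)" using cheb_span_sum[OF cheb_span_polynomial[of a n]] by auto
  then have "\<forall>x. \<bar>x\<bar> \<le> K \<longrightarrow> \<bar>f x - (\<Sum>m\<le>M. c m * cheb m x)\<bar> < e" using g(2) by (auto simp: abs_le_iff)
  then show ?thesis by blast
qed

section \<open>Empirical averages compared with semicircle integrals\<close>

definition avg :: "(real \<Rightarrow> real) \<Rightarrow> real list \<Rightarrow> real" where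
  "avg f xs = (\<Sum>x\<leftarrow>xs. f x) / real (length xs)"

lemma avg_mono: "(\<And>x. x \<in> set xs \<Longrightarrow> f x \<le> g x) \<Longrightarrow> avg f xs \<le> avg g xs"
  unfolding avg_def by (intro divide_right_mono sum_list_mono) auto

lemma avg_const: "xs \<noteq> [] \<Longrightarrow> avg (\<lambda>_. c) xs = c"
  by (simp add: avg_def sum_list_triv)

lemma avg_add: "avg (\<lambda>x. f x + g x) xs = avg f xs + avg g xs"
  by (simp add: avg_def sum_list_addf add_divide_distrib)

lemma avg_scale: "avg (\<lambda>x. c * f x) xs = c * avg f xs"
  by (simp add: avg_def sum_list_const_mult)

lemma avg_sum: "avg (\<lambda>x. \<Sum>m\<in>A. f m x) xs = (\<Sum>m\<in>A. avg (f m) xs)"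
proof (induction A rule: infinite_finite_induct)
  case (insert a A)
  then show ?case by (simp add: avg_add)
qed (simp_all add: avg_def sum_list_triv)

lemma avg_close_abs:
  assumes "xs \<noteq> []" "\<And>x. x \<in> set xs \<Longrightarrow> \<bar>f x - g x\<bar> \<le> b"
  shows "\<bar>avg f xs - avg g xs\<bar> \<le> b"
proof -
  have "avg f xs \<le> avg (\<lambda>x. g x + b) xs" by (rule avg_mono) (use assms(2) in \<open>force simp: abs_le_iff\<close>)
  moreover have "avg g xs \<le> avg (\<lambda>x. f x + b) xs" by (rule avg_mono) (use assms(2) in \<open>force simp: abs_le_iff\<close>)
  ultimately show ?thesis using avg_const[OF assms(1), of b] by (simp add: avg_add abs_le_iff)
qed

text \<open>Here \<open>xs\<close> stands for the spectrum of the centred matrix, and the rescaled eigenvalues of the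
  partial transpose are \<open>\<kappa> * (1 + \<tau> * x)\<close> for \<open>x \<in> xs\<close>.\<close>

definition near_edge_data :: "real \<Rightarrow> real \<Rightarrow> nat \<Rightarrow> real list \<Rightarrow> real \<Rightarrow> real \<Rightarrow> bool" where
  "near_edge_data r \<eta> M xs \<kappa> \<tau> \<longleftrightarrow> xs \<noteq> [] \<and> \<bar>\<kappa> - 1\<bar> \<le> \<eta> \<and> \<bar>\<tau> - r\<bar> \<le> \<eta> \<and> (\<forall>x\<in>set xs. \<bar>x\<bar> \<le> 3) \<and>
     (\<forall>m\<in>{1..M}. \<bar>avg (cheb m) xs\<bar> \<le> \<eta>)"

text \<open>In a Chebyshev expansion of \<open>f\<close> only the coefficient \<open>c 0\<close>
  survives on either side: exactly under the semicircle by orthogonality, approximately under the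
  empirical average by \<open>near_edge_data\<close>. The four quarters of \<open>e\<close> pay for
  the perturbed argument, for each of two polynomial approximations, and for the Chebyshev
  averages.\<close>

lemma avg_lipschitz_close:
  assumes r: "r > 0" and L: "0 \<le> L" and lip: "\<And>x y. \<bar>f x - f y\<bar> \<le> L * \<bar>x - y\<bar>" and e: "0 < e"
  obtains \<eta> M where "0 < \<eta>" "\<And>xs \<kappa> \<tau>. near_edge_data r \<eta> M xs \<kappa> \<tau> \<Longrightarrow>
    \<bar>avg (\<lambda>x. f (\<kappa> * (1 + \<tau> * x))) xs - integral\<^sup>L (semicircle 1 (r\<^sup>2)) f\<bar> \<le> e"
proof -
  let ?\<mu> = "semicircle 1 (r\<^sup>2)"
  interpret prob_space ?\<mu> by (rule prob_space_semicircle[OF r])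
  have cf: "continuous_on UNIV f"
  proof (rule continuous_onI)
    fix x e :: real assume e: "0 < e"
    show "\<exists>d>0. \<forall>x'\<in>UNIV. dist x' x < d \<longrightarrow> dist (f x') (f x) \<le> e"
    proof (intro exI[of _ "e / (L + 1)"] conjI ballI impI)
      fix x' assume "dist x' x < e / (L + 1)"
      then have "(L + 1) * \<bar>x' - x\<bar> \<le> e" using L by (simp add: dist_real_def field_simps)
      moreover have "L * \<bar>x' - x\<bar> \<le> (L + 1) * \<bar>x' - x\<bar>" by (intro mult_right_mono) auto
      ultimately show "dist (f x') (f x) \<le> e" using lip[of x' x] by (simp add: dist_real_def)
    qed (use e L in auto)
  qed
  define F where "F y = f (1 + r * y)" for y
  have cF: "continuous_on UNIV F" unfolding F_def by (intro continuous_on_compose2[OF cf] continuous_intros) auto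
  obtain M c where Mc: "\<And>x. \<bar>x\<bar> \<le> 3 \<Longrightarrow> \<bar>F x - (\<Sum>m\<le>M. c m * cheb m x)\<bar> < e / 4"
  proof -
    have "0 < e / 4" using e by simp
    from weierstrass_cheb[OF cF this, of 3] show ?thesis using that by blast
  qed
  let ?P = "\<lambda>x. \<Sum>m\<le>M. c m * cheb m x"
  define A where "A = (\<Sum>m\<in>{1..M}. \<bar>c m\<bar>)"
  have A0: "0 \<le> A" by (simp add: A_def sum_nonneg)
  \<comment> \<open>The second bound lets \<eta> times the sum of the coefficients stay below
    \<open>e / 4\<close>, the third does the same for the Lipschitz error caused by \<kappa> and
    \<tau>.\<close>
  define \<eta> where "\<eta> = min 1 (min (e / (4 * (A + 1))) (e / (4 * (L + 1) * (7 + 3 * r))))"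
  have \<eta>: "0 < \<eta>" "\<eta> \<le> 1" "A * \<eta> \<le> e / 4" "L * (\<eta> * (7 + 3 * r)) \<le> e / 4"
  proof -
    show "0 < \<eta>" using e A0 L r by (simp add: \<eta>_def add_pos_nonneg)
    show "\<eta> \<le> 1" by (simp add: \<eta>_def)
    have "A * \<eta> \<le> A * (e / (4 * (A + 1)))" using A0 by (intro mult_left_mono) (auto simp: \<eta>_def)
    also have "\<dots> \<le> e / 4" using A0 e by (simp add: field_simps)
    finally show "A * \<eta> \<le> e / 4" .
    have "\<eta> * (7 + 3 * r) \<le> e / (4 * (L + 1) * (7 + 3 * r)) * (7 + 3 * r)"
      using r by (intro mult_right_mono) (auto simp: \<eta>_def)
    also have "\<dots> = e / (4 * (L + 1))" using r by simp
    finally have "L * (\<eta> * (7 + 3 * r)) \<le> L * (e / (4 * (L + 1)))" using L by (intro mult_left_mono)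
    also have "\<dots> \<le> e / 4" using L e by (simp add: field_simps)
    finally show "L * (\<eta> * (7 + 3 * r)) \<le> e / 4" .
  qed
  have mu: "\<bar>integral\<^sup>L ?\<mu> f - c 0\<bar> \<le> e / 4"
  proof -
    let ?g = "\<lambda>x. ?P ((x - 1) / r)"
    have cg: "continuous_on UNIV (\<lambda>x. cheb m ((x - 1) / r))" for m using r by (intro continuous_intros) auto
    have ig: "integrable ?\<mu> (\<lambda>x. cheb m ((x - 1) / r))" for m by (rule semicircle_integral(1)[OF r cg])
    have "integral\<^sup>L ?\<mu> ?g = (\<Sum>m\<le>M. c m * of_bool (m = 0))"
      using ig by (simp add: semicircle_cheb[OF r])
    also have "\<dots> = (\<Sum>m\<le>M. if m = 0 then c 0 else 0)" by (rule sum.cong) auto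
    also have "\<dots> = c 0" by simp
    finally have g0: "integral\<^sup>L ?\<mu> ?g = c 0" .
    have ig': "integrable ?\<mu> ?g" using ig by simp
    have if': "integrable ?\<mu> f" by (rule semicircle_integral(1)[OF r cf])
    have close: "AE x in ?\<mu>. \<bar>f x - ?g x\<bar> \<le> e / 4"
      using semicircle_support[OF r]
    proof eventually_elim
      case (elim x)
      then have "\<bar>(x - 1) / r\<bar> \<le> 3" using r by (auto simp: abs_le_iff field_simps)
      from Mc[OF this] show ?case using r by (simp add: F_def)
    qed
    have "\<bar>integral\<^sup>L ?\<mu> f - integral\<^sup>L ?\<mu> ?g\<bar> = \<bar>integral\<^sup>L ?\<mu> (\<lambda>x. f x - ?g x)\<bar>"
      using if' ig' by (simp add: Bochner_Integration.integral_diff[OF if' ig'])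
    also have "\<dots> \<le> integral\<^sup>L ?\<mu> (\<lambda>x. \<bar>f x - ?g x\<bar>)" by (rule integral_abs_bound)
    also have "\<dots> \<le> integral\<^sup>L ?\<mu> (\<lambda>_. e / 4)"
      by (rule integral_mono_AE) (use if' ig' close in auto)
    finally show ?thesis using prob_space by (simp add: g0)
  qed
  show ?thesis
  proof (rule that[OF \<eta>(1)])
    fix xs \<kappa> \<tau> assume d: "near_edge_data r \<eta> M xs \<kappa> \<tau>"
    then have ne: "xs \<noteq> []" and k: "\<bar>\<kappa> - 1\<bar> \<le> \<eta>" and t: "\<bar>\<tau> - r\<bar> \<le> \<eta>" and x3: "\<And>x. x \<in> set xs \<Longrightarrow> \<bar>x\<bar> \<le> 3"
      and ch: "\<And>m. m \<in> {1..M} \<Longrightarrow> \<bar>avg (cheb m) xs\<bar> \<le> \<eta>" by (auto simp: near_edge_data_def)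
    have 1: "\<bar>avg (\<lambda>x. f (\<kappa> * (1 + \<tau> * x))) xs - avg F xs\<bar> \<le> e / 4"
    proof (rule avg_close_abs[OF ne])
      fix x assume x: "x \<in> set xs"
      have "\<kappa> * (1 + \<tau> * x) - (1 + r * x) = (\<kappa> - 1) * (1 + \<tau> * x) + (\<tau> - r) * x" by (simp add: algebra_simps)
      then have "\<bar>\<kappa> * (1 + \<tau> * x) - (1 + r * x)\<bar> \<le> \<bar>\<kappa> - 1\<bar> * \<bar>1 + \<tau> * x\<bar> + \<bar>\<tau> - r\<bar> * \<bar>x\<bar>"
        by (metis abs_mult abs_triangle_ineq)
      \<comment> \<open>Points are bounded by 3 and \<tau> by r + 1, which adds up to the constant 7
        + 3 r.\<close>
      also have "\<dots> \<le> \<eta> * (1 + (r + 1) * 3) + \<eta> * 3"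
      proof (intro add_mono mult_mono k t x3[OF x])
        have "\<bar>\<tau>\<bar> \<le> r + 1" using t \<eta>(2) r by linarith
        then have "\<bar>\<tau> * x\<bar> \<le> (r + 1) * 3" unfolding abs_mult using x3[OF x] r by (intro mult_mono) auto
        then show "\<bar>1 + \<tau> * x\<bar> \<le> 1 + (r + 1) * 3" by linarith
      qed (use \<eta>(1) in auto)
      finally have b: "\<bar>\<kappa> * (1 + \<tau> * x) - (1 + r * x)\<bar> \<le> \<eta> * (7 + 3 * r)" by (simp add: algebra_simps)
      have "\<bar>f (\<kappa> * (1 + \<tau> * x)) - F x\<bar> \<le> L * \<bar>\<kappa> * (1 + \<tau> * x) - (1 + r * x)\<bar>"
        unfolding F_def by (rule lip)
      also have "\<dots> \<le> L * (\<eta> * (7 + 3 * r))" by (rule mult_left_mono[OF b L])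
      finally show "\<bar>f (\<kappa> * (1 + \<tau> * x)) - F x\<bar> \<le> e / 4" using \<eta>(4) by linarith
    qed
    have 2: "\<bar>avg F xs - avg ?P xs\<bar> \<le> e / 4"
      by (rule avg_close_abs[OF ne]) (use Mc x3 less_imp_le in blast)
    have 3: "\<bar>avg ?P xs - c 0\<bar> \<le> e / 4"
    proof -
      have "avg ?P xs = (\<Sum>m\<le>M. c m * avg (cheb m) xs)" by (simp add: avg_sum avg_scale)
      also have "\<dots> = c 0 * avg (cheb 0) xs + (\<Sum>m\<in>{1..M}. c m * avg (cheb m) xs)"
        by (simp add: atMost_atLeast0 sum.atLeast_Suc_atMost)
      also have "avg (cheb 0) xs = 1"
      proof -
        have "cheb 0 = (\<lambda>_. 1)" by (rule ext) simp
        then show ?thesis using avg_const[OF ne, of 1] by (simp only:)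
      qed
      finally have "avg ?P xs - c 0 = (\<Sum>m\<in>{1..M}. c m * avg (cheb m) xs)" by simp
      also have "\<bar>\<dots>\<bar> \<le> (\<Sum>m\<in>{1..M}. \<bar>c m * avg (cheb m) xs\<bar>)" by (rule sum_abs)
      also have "\<dots> \<le> (\<Sum>m\<in>{1..M}. \<bar>c m\<bar> * \<eta>)"
        by (intro sum_mono) (simp add: abs_mult ch mult_left_mono)
      also have "\<dots> = A * \<eta>" by (simp add: A_def sum_distrib_right)
      finally show ?thesis using \<eta>(3) by linarith
    qed
    show "\<bar>avg (\<lambda>x. f (\<kappa> * (1 + \<tau> * x))) xs - integral\<^sup>L ?\<mu> f\<bar> \<le> e" using 1 2 3 mu by linarith
  qed
qed

lemma near_edge_data_mono:
  "near_edge_data r \<eta> M xs \<kappa> \<tau> \<Longrightarrow> \<eta> \<le> \<eta>' \<Longrightarrow> M' \<le> M \<Longrightarrow> near_edge_data r \<eta>' M' xs \<kappa> \<tau>"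
  unfolding near_edge_data_def by force

text \<open>The indicator is squeezed between Lipschitz functions of the distance to the complement
  and to the interval. Their integrals come arbitrarily close, because the frontier of the interval
  is a null set for the semicircle.\<close>

lemma avg_indicator_close:
  assumes r: "r > 0" and I: "is_interval (I :: real set)" and e: "0 < e"
  obtains \<eta> M where "0 < \<eta>" "\<And>xs \<kappa> \<tau>. near_edge_data r \<eta> M xs \<kappa> \<tau> \<Longrightarrow>
    \<bar>avg (\<lambda>x. indicator I (\<kappa> * (1 + \<tau> * x))) xs - measure (semicircle 1 (r\<^sup>2)) I\<bar> \<le> e"
proof -
  let ?\<mu> = "semicircle 1 (r\<^sup>2)"
  interpret prob_space ?\<mu> by (rule prob_space_semicircle[OF r])
  have cI: "convex I" using I by (simp add: is_interval_convex_1)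
  have Ib: "I \<in> sets ?\<mu>" unfolding sets_semicircle by (rule real_interval_borel_measurable[OF I])
  \<comment> \<open>The distance to the empty set is 0 by convention, which would ruin the
    approximating functions; so the two extreme intervals are treated apart.\<close>
  consider "I = {}" | "I = UNIV" | "I \<noteq> {}" "- I \<noteq> {}" by blast
  then show ?thesis
  proof cases
    case 1
    show ?thesis by (rule that[of 1 0]) (use 1 e in \<open>auto simp: avg_def sum_list_triv\<close>)
  next
    case 2
    have "measure ?\<mu> UNIV = 1" using prob_space by (simp add: space_semicircle)
    then show ?thesis
      by (intro that[of 1 0]) (use 2 e avg_const in \<open>auto simp: near_edge_data_def\<close>)
  next
    case 3
    define fp where "fp k x = max 0 (1 - real (Suc k) * infdist x I)" for k x
    define fm where "fm k x = min 1 (real (Suc k) * infdist x (- I))" for k x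
    have inf_lip: "\<bar>infdist x S - infdist y S\<bar> \<le> \<bar>x - y\<bar>" for x y :: real and S
      using infdist_triangle[of x S y] infdist_triangle[of y S x] by (simp add: dist_real_def abs_minus_commute abs_le_iff)
    have mult_lip: "\<bar>real (Suc k) * infdist x S - real (Suc k) * infdist y S\<bar> \<le> real (Suc k) * \<bar>x - y\<bar>" for k S and x y :: real
      unfolding right_diff_distrib[symmetric] abs_mult using inf_lip[of x S y] by (simp add: mult_left_mono)
    have fp_lip: "\<bar>fp k x - fp k y\<bar> \<le> real (Suc k) * \<bar>x - y\<bar>" for k x y
      using mult_lip[of k x I y] unfolding fp_def by linarith
    have fm_lip: "\<bar>fm k x - fm k y\<bar> \<le> real (Suc k) * \<bar>x - y\<bar>" for k x y
      using mult_lip[of k x "- I" y] unfolding fm_def by linarith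
    have fp_ge: "indicator I x \<le> fp k x" for k x by (auto simp: fp_def indicator_def)
    have fm_le: "fm k x \<le> indicator I x" for k x by (auto simp: fm_def indicator_def)
    have cinf: "continuous_on UNIV (\<lambda>x. infdist x S)" for S :: "real set" by (intro continuous_intros)
    have cfp: "continuous_on UNIV (fp k)" for k unfolding fp_def[abs_def] by (intro continuous_intros cinf)
    have cfm: "continuous_on UNIV (fm k)" for k unfolding fm_def[abs_def] by (intro continuous_intros cinf)
    have ifp: "integrable ?\<mu> (fp k)" for k by (rule semicircle_integral(1)[OF r cfp])
    have ifm: "integrable ?\<mu> (fm k)" for k by (rule semicircle_integral(1)[OF r cfm])
    \<comment> \<open>Away from the frontier both functions eventually equal the indicator, so
      dominated convergence applies.\<close>
    have lim: "(\<lambda>k. integral\<^sup>L ?\<mu> (\<lambda>x. fp k x - fm k x)) \<longlonglongrightarrow> integral\<^sup>L ?\<mu> (\<lambda>_. 0)"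
    proof (rule integral_dominated_convergence[where w = "\<lambda>_. 1"])
      have "negligible (frontier I)" by (rule negligible_convex_frontier[OF cI])
      then have "AE x in lebesgue. x \<notin> frontier I" unfolding negligible_iff_null_sets by (rule AE_not_in)
      then have ae: "AE x in lborel. x \<notin> frontier I"
        by (subst (asm) AE_completion_iff)
      have mw: "sc_weight r \<in> borel_measurable borel" using sc_weight_continuous[OF r] by (rule borel_measurable_continuous_onI)
      then have m: "(\<lambda>x. ennreal (indicator {1 - 2 * r..1 + 2 * r} x * sc_weight r x)) \<in> borel_measurable lborel" by measurable
      have "AE x in ?\<mu>. x \<notin> frontier I"
        unfolding semicircle_eq[OF r] AE_density[OF m] using ae by eventually_elim simp
      then show "AE x in ?\<mu>. (\<lambda>k. fp k x - fm k x) \<longlonglongrightarrow> 0"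
      proof eventually_elim
        case (elim x)
        have lin: "eventually (\<lambda>k. 1 \<le> real (Suc k) * b) sequentially" if "0 < b" for b :: real
        proof -
          obtain N where N: "1 / b < real N" using reals_Archimedean2 by blast
          show ?thesis
          proof (rule eventually_sequentiallyI[of N])
            fix k assume "N \<le> k"
            then have "1 / b < real (Suc k)" using N by linarith
            then show "1 \<le> real (Suc k) * b" using that by (simp add: field_simps)
          qed
        qed
        show ?case
        proof (cases "x \<in> I")
          case True
          then have "x \<in> interior I" using elim closure_subset by (auto simp: frontier_def)
          then have "x \<notin> closure (- I)" by (simp add: closure_complement)
          then have "0 < infdist x (- I)" using 3 in_closure_iff_infdist_zero[of "- I" x] infdist_nonneg[of x "- I"] by fastforce
          from lin[OF this] have "eventually (\<lambda>k. fp k x - fm k x = 0) sequentially"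
            by eventually_elim (use True in \<open>simp add: fp_def fm_def min_def\<close>)
          then show ?thesis by (rule tendsto_eventually)
        next
          case False
          then have "x \<notin> closure I" using elim interior_subset by (auto simp: frontier_def)
          then have "0 < infdist x I" using 3 in_closure_iff_infdist_zero[of I x] infdist_nonneg[of x I] by fastforce
          from lin[OF this] have "eventually (\<lambda>k. fp k x - fm k x = 0) sequentially"
            by eventually_elim (use False in \<open>simp add: fp_def fm_def max_def\<close>)
          then show ?thesis by (rule tendsto_eventually)
        qed
      qed
      show "AE x in ?\<mu>. norm (fp k x - fm k x) \<le> 1" for k
      proof (rule AE_I2)
        fix x
        have "0 \<le> fm k x" "fp k x \<le> 1" by (simp_all add: fm_def fp_def infdist_nonneg)
        then show "norm (fp k x - fm k x) \<le> 1" using fp_ge[of x k] fm_le[of k x] by simp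
      qed
      show "(\<lambda>x. fp k x - fm k x) \<in> borel_measurable ?\<mu>" for k using ifp[of k] ifm[of k] by measurable
    qed auto
    then have "eventually (\<lambda>k. integral\<^sup>L ?\<mu> (\<lambda>x. fp k x - fm k x) < e / 2) sequentially"
      by (rule order_tendstoD(2)) (use e in simp)
    then obtain k where k: "integral\<^sup>L ?\<mu> (\<lambda>x. fp k x - fm k x) < e / 2" by (auto simp: eventually_sequentially)
    have k': "integral\<^sup>L ?\<mu> (fp k) - integral\<^sup>L ?\<mu> (fm k) < e / 2" using k ifp ifm by simp
    have iI: "integrable ?\<mu> (indicator I :: real \<Rightarrow> real)" using Ib by (simp add: emeasure_eq_measure)
    have mI: "integral\<^sup>L ?\<mu> (indicator I) = measure ?\<mu> I" using Ib by (simp add: space_semicircle)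
    have up: "measure ?\<mu> I \<le> integral\<^sup>L ?\<mu> (fp k)" unfolding mI[symmetric] by (rule integral_mono[OF iI ifp fp_ge])
    have lo: "integral\<^sup>L ?\<mu> (fm k) \<le> measure ?\<mu> I" unfolding mI[symmetric] by (rule integral_mono[OF ifm iI fm_le])
    obtain \<eta>1 M1 where 1: "0 < \<eta>1" "\<And>xs \<kappa> \<tau>. near_edge_data r \<eta>1 M1 xs \<kappa> \<tau> \<Longrightarrow>
      \<bar>avg (\<lambda>x. fp k (\<kappa> * (1 + \<tau> * x))) xs - integral\<^sup>L ?\<mu> (fp k)\<bar> \<le> e / 2"
      by (rule avg_lipschitz_close[OF r _ fp_lip[of k], of "e / 2"]) (use e in auto)
    obtain \<eta>2 M2 where 2: "0 < \<eta>2" "\<And>xs \<kappa> \<tau>. near_edge_data r \<eta>2 M2 xs \<kappa> \<tau> \<Longrightarrow>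
      \<bar>avg (\<lambda>x. fm k (\<kappa> * (1 + \<tau> * x))) xs - integral\<^sup>L ?\<mu> (fm k)\<bar> \<le> e / 2"
      by (rule avg_lipschitz_close[OF r _ fm_lip[of k], of "e / 2"]) (use e in auto)
    show ?thesis
    proof (rule that[of "min \<eta>1 \<eta>2" "max M1 M2"])
      fix xs \<kappa> \<tau> assume d: "near_edge_data r (min \<eta>1 \<eta>2) (max M1 M2) xs \<kappa> \<tau>"
      have a: "avg (\<lambda>x. indicator I (\<kappa> * (1 + \<tau> * x))) xs \<le> avg (\<lambda>x. fp k (\<kappa> * (1 + \<tau> * x))) xs"
        by (rule avg_mono) (rule fp_ge)
      have b: "avg (\<lambda>x. fm k (\<kappa> * (1 + \<tau> * x))) xs \<le> avg (\<lambda>x. indicator I (\<kappa> * (1 + \<tau> * x))) xs"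
        by (rule avg_mono) (rule fm_le)
      have "\<bar>avg (\<lambda>x. fp k (\<kappa> * (1 + \<tau> * x))) xs - integral\<^sup>L ?\<mu> (fp k)\<bar> \<le> e / 2"
        by (rule 1(2)[OF near_edge_data_mono[OF d]]) auto
      moreover have "\<bar>avg (\<lambda>x. fm k (\<kappa> * (1 + \<tau> * x))) xs - integral\<^sup>L ?\<mu> (fm k)\<bar> \<le> e / 2"
        by (rule 2(2)[OF near_edge_data_mono[OF d]]) auto
      ultimately show "\<bar>avg (\<lambda>x. indicator I (\<kappa> * (1 + \<tau> * x))) xs - measure ?\<mu> I\<bar> \<le> e"
        using a b up lo k' by linarith
    qed (use 1 2 in simp)
  qed
qed

text \<open>The density is strictly positive inside the support. This is what will force eigenvalues
  into every neighbourhood of the two edges.\<close>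

lemma semicircle_interval_pos:
  assumes r: "r > 0" and ab: "1 - 2 * r \<le> a" "a < b" "b \<le> 1 + 2 * r" and S: "{a<..<b} \<subseteq> S" "S \<in> sets borel"
  shows "0 < measure (semicircle 1 (r\<^sup>2)) S"
proof -
  let ?\<mu> = "semicircle 1 (r\<^sup>2)"
  interpret prob_space ?\<mu> by (rule prob_space_semicircle[OF r])
  have mw: "sc_weight r \<in> borel_measurable borel" using sc_weight_continuous[OF r] by (rule borel_measurable_continuous_onI)
  then have m: "(\<lambda>x. ennreal (indicator {1 - 2 * r..1 + 2 * r} x * sc_weight r x)) \<in> borel_measurable lborel" by measurable
  have "measure ?\<mu> S \<noteq> 0"
  proof
    assume "measure ?\<mu> S = 0"
    then have "emeasure ?\<mu> S = 0" by (simp add: emeasure_eq_measure)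
    then have "S \<in> null_sets ?\<mu>" using S(2) by (simp add: null_sets_def sets_semicircle)
    then have "AE x in ?\<mu>. x \<notin> S" by (rule AE_not_in)
    then have "AE x in lborel. 0 < ennreal (indicator {1 - 2 * r..1 + 2 * r} x * sc_weight r x) \<longrightarrow> x \<notin> S"
      unfolding semicircle_eq[OF r] AE_density[OF m] .
    then have "AE x in lborel. x \<notin> {a<..<b}"
    proof eventually_elim
      case (elim x)
      show ?case
      proof
        assume x: "x \<in> {a<..<b}"
        then have "\<bar>x - 1\<bar> < \<bar>2 * r\<bar>" using ab r by auto
        then have "(x - 1)\<^sup>2 < 4 * r\<^sup>2" using power_strict_mono[of "\<bar>x - 1\<bar>" "\<bar>2 * r\<bar>" 2] by (simp add: power_mult_distrib)
        then have "0 < sc_weight r x" using r by (simp add: sc_weight_def power_mult_distrib)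
        then show False using elim x S(1) ab by (auto simp: indicator_def)
      qed
    qed
    then have "{a<..<b} \<in> null_sets lborel" by (subst AE_iff_null_sets) auto
    then show False using ab by (simp add: null_sets_def)
  qed
  then show ?thesis by (simp add: measure_nonneg order_less_le)
qed

subsection \<open>Measurability of spectral statistics\<close>

definition pt_state :: "nat \<Rightarrow> nat \<Rightarrow> (nat \<times> nat \<Rightarrow> complex) \<Rightarrow> complex mat" where
  "pt_state d s x = partial_transpose d (reduced_state (d * d) s x)"

lemma pt_state_carrier: "pt_state d s x \<in> carrier_mat (d * d) (d * d)"
  by (simp add: pt_state_def partial_transpose_def)

lemma pt_state_entry:
  assumes "p < d * d" "q < d * d"
  shows "pt_state d s x $$ (p, q) = (\<Sum>k<s. x (mix d p q, k) * cnj (x (mix d q p, k)))"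
  using assms mix_lt[OF assms(1), of q] mix_lt[OF assms(2), of p]
  by (simp add: pt_state_def partial_transpose_def reduced_state_def mix_def)

definition pt_spec :: "nat \<Rightarrow> nat \<Rightarrow> (nat \<times> nat \<Rightarrow> complex) \<Rightarrow> real list" where
  "pt_spec d s x = (SOME es. real_spectrum (pt_state d s x) es \<and> length es = d * d)"

lemma pt_spec: "real_spectrum (pt_state d s x) (pt_spec d s x)" "length (pt_spec d s x) = d * d"
proof -
  have "pt_state d s x $$ (p, q) = cnj (pt_state d s x $$ (q, p))" if "p < d * d" "q < d * d" for p q
    unfolding pt_state_entry[OF that] pt_state_entry[OF that(2,1)] by (simp add: mult.commute)
  from someI_ex[OF real_spectrum_exists[OF pt_state_carrier this]]
  show "real_spectrum (pt_state d s x) (pt_spec d s x)" "length (pt_spec d s x) = d * d"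
    unfolding pt_spec_def by blast+
qed

lemma real_spectrum_smult:
  assumes A: "A \<in> carrier_mat n n" and sp: "real_spectrum A es"
  shows "real_spectrum (complex_of_real k \<cdot>\<^sub>m A) (map (\<lambda>e. k * e) es)"
proof -
  have "complex_of_real k \<cdot>\<^sub>m A + complex_of_real 0 \<cdot>\<^sub>m 1\<^sub>m n = complex_of_real k \<cdot>\<^sub>m A"
    by (rule eq_matI) (use A in auto)
  then show ?thesis using real_spectrum_affine[OF A sp, of k 0] by simp
qed

lemma cheb_entry_measurable:
  assumes b: "\<And>y z. y < n \<Longrightarrow> z < n \<Longrightarrow> (\<lambda>x. b x y z) \<in> borel_measurable M" and y: "y < n" and z: "z < n"
  shows "(\<lambda>x. cheb_entry (b x) n c p y z) \<in> borel_measurable M"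
  using z
proof (induction p arbitrary: z rule: induct_nat_012)
  case 0
  then show ?case by simp
next
  case 1
  then show ?case using b y by simp
next
  case (ge2 p)
  have "(\<lambda>x. (\<Sum>w<n. cheb_entry (b x) n c (Suc p) y w * b x w z) - c * cheb_entry (b x) n c p y z) \<in> borel_measurable M"
    by (intro borel_measurable_diff borel_measurable_sum borel_measurable_times borel_measurable_const)
      (use ge2 b in auto)
  then show ?case by simp
qed

lemma sum_list_pt_spec: "(\<Sum>e\<leftarrow>pt_spec d s x. f e) = (\<Sum>i<d * d. f (pt_spec d s x ! i))"
  unfolding sum_list_sum_nth by (simp add: pt_spec(2) atLeast0LessThan)

text \<open>The list chosen by \<open>pt_spec\<close> need not depend measurably on the matrix; its symmetric functions
  do, because traces of polynomials are polynomials in the entries.\<close>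

lemma spec_cheb_measurable:
  "(\<lambda>x. \<Sum>e\<leftarrow>pt_spec d s x. cheb p e) \<in> borel_measurable (leb_idx (idx (d * d) s))"
proof -
  let ?M = "leb_idx (idx (d * d) s)"
  have "(\<lambda>x. \<Sum>k<s. x (mix d y z, k) * cnj (x (mix d z y, k))) \<in> borel_measurable ?M" if "y < d * d" "z < d * d" for y z
  proof (intro borel_measurable_sum borel_measurable_times)
    fix k assume "k \<in> {..<s}"
    then have "(mix d y z, k) \<in> idx (d * d) s" "(mix d z y, k) \<in> idx (d * d) s"
      using mix_lt[OF that(1)] mix_lt[OF that(2)] by (simp_all add: idx_def)
    note m = measurable_coord[OF this(1)] measurable_coord[OF this(2)]
    show "(\<lambda>x. x (mix d y z, k)) \<in> borel_measurable ?M" by (rule m(1))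
    have "continuous_on UNIV cnj" by (intro continuous_intros)
    from borel_measurable_continuous_on[OF this m(2)]
    show "(\<lambda>x. cnj (x (mix d z y, k))) \<in> borel_measurable ?M" .
  qed
  then have m: "(\<lambda>x. pt_state d s x $$ (y, z)) \<in> borel_measurable ?M" if "y < d * d" "z < d * d" for y z
    using that unfolding pt_state_entry[OF that] by blast
  have "(\<lambda>x. \<Sum>y<d * d. cheb_entry (\<lambda>y z. pt_state d s x $$ (y, z)) (d * d) (complex_of_real 1) p y y) \<in> borel_measurable ?M"
    by (intro borel_measurable_sum cheb_entry_measurable m) auto
  then have "(\<lambda>x. Re (\<Sum>y<d * d. cheb_entry (\<lambda>y z. pt_state d s x $$ (y, z)) (d * d) (complex_of_real 1) p y y)) \<in> borel_measurable ?M"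
    by measurable
  then show ?thesis
    unfolding cheb_entry_trace[OF pt_state_carrier pt_spec(1) refl] Re_complex_of_real .
qed

text \<open>A pointwise limit of Chebyshev statistics: the k-th polynomial is close to
  \<open>f\<close> on [-k, k], an interval that eventually contains every eigenvalue of the given
  matrix.\<close>

lemma spec_continuous_measurable:
  assumes f: "continuous_on UNIV (f :: real \<Rightarrow> real)"
  shows "(\<lambda>x. \<Sum>e\<leftarrow>pt_spec d s x. f e) \<in> borel_measurable (leb_idx (idx (d * d) s))"
proof -
  let ?M = "leb_idx (idx (d * d) s)"
  have "\<forall>k::nat. \<exists>M c. \<forall>x. \<bar>x\<bar> \<le> real k \<longrightarrow> \<bar>f x - (\<Sum>m\<le>M. c m * cheb m x)\<bar> < 1 / real (Suc k)"
    by (intro allI weierstrass_cheb[OF f]) simp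
  then obtain M c where Mc: "\<And>k x. \<bar>x\<bar> \<le> real k \<Longrightarrow> \<bar>f x - (\<Sum>m\<le>M k. c k m * cheb m x)\<bar> < 1 / real (Suc k)"
    by metis
  let ?P = "\<lambda>k x. \<Sum>m\<le>M k. c k m * cheb m x"
  show ?thesis
  proof (rule borel_measurable_LIMSEQ_real)
    fix k
    have "(\<Sum>e\<leftarrow>pt_spec d s x. ?P k e) = (\<Sum>m\<le>M k. c k m * (\<Sum>e\<leftarrow>pt_spec d s x. cheb m e))" for x
      unfolding sum_list_pt_spec by (subst sum.swap) (simp only: sum_distrib_left)
    then show "(\<lambda>x. \<Sum>e\<leftarrow>pt_spec d s x. ?P k e) \<in> borel_measurable ?M"
      by (simp only:) (intro borel_measurable_sum borel_measurable_times borel_measurable_const spec_cheb_measurable)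
  next
    fix x
    have "(\<lambda>k. ?P k e) \<longlonglongrightarrow> f e" for e
    proof (rule LIMSEQ_I)
      fix b :: real assume b: "0 < b"
      obtain N1 where N1: "\<bar>e\<bar> \<le> real N1" using real_arch_simple by blast
      obtain N2 where N2: "1 / b < real N2" using reals_Archimedean2 by blast
      show "\<exists>N. \<forall>k\<ge>N. norm (?P k e - f e) < b"
      proof (intro exI[of _ "max N1 N2"] allI impI)
        fix k assume k: "max N1 N2 \<le> k"
        then have "\<bar>e\<bar> \<le> real k" using N1 by linarith
        from Mc[OF this] have "\<bar>?P k e - f e\<bar> < 1 / real (Suc k)" by (simp only: abs_minus_commute)
        also have "1 / b < real (Suc k)" using k N2 by linarith
        then have "1 / real (Suc k) < b" using b by (simp add: field_simps)
        finally show "norm (?P k e - f e) < b" by simp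
      qed
    qed
    then show "(\<lambda>k. \<Sum>e\<leftarrow>pt_spec d s x. ?P k e) \<longlonglongrightarrow> (\<Sum>e\<leftarrow>pt_spec d s x. f e)"
      unfolding sum_list_pt_spec by (intro tendsto_sum)
  qed
qed

text \<open>Closed sets form an intersection-stable generator, and their indicators are limits of
  continuous functions of the distance. Complements are handled because the number of eigenvalues is
  constant, disjoint unions because the counts add up.\<close>

lemma spec_indicator_measurable:
  assumes S: "S \<in> sets (borel :: real measure)"
  shows "(\<lambda>x. \<Sum>e\<leftarrow>pt_spec d s x. indicator S e :: real) \<in> borel_measurable (leb_idx (idx (d * d) s))"
proof -
  let ?M = "leb_idx (idx (d * d) s)"
  have "Int_stable {C :: real set. closed C}" by (auto simp: Int_stable_def)
  moreover have "{C :: real set. closed C} \<subseteq> Pow UNIV" by simp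
  moreover have "S \<in> sigma_sets UNIV {C :: real set. closed C}" using S by (simp add: borel_eq_closed)
  ultimately show ?thesis
  proof (induction rule: sigma_sets_induct_disjoint)
    case (basic C)
    show ?case
    proof (cases "C = {}")
      case True
      then show ?thesis by simp
    next
      case False
      let ?f = "\<lambda>k x. max 0 (1 - real k * infdist x C)"
      show ?thesis
      proof (rule borel_measurable_LIMSEQ_real)
        show "(\<lambda>x. \<Sum>e\<leftarrow>pt_spec d s x. ?f k e) \<in> borel_measurable ?M" for k
          by (intro spec_continuous_measurable continuous_intros)
        fix x
        have "(\<lambda>k. ?f k e) \<longlonglongrightarrow> indicator C e" for e
        proof (cases "e \<in> C")
          case True
          then show ?thesis by simp
        next
          case nC: False
          have "closed C" using basic by simp
          then have pos: "0 < infdist e C" using nC False in_closed_iff_infdist_zero[of C e] infdist_nonneg[of e C] by fastforce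
          obtain N where N: "1 / infdist e C < real N" using reals_Archimedean2 by blast
          have "eventually (\<lambda>k. ?f k e = 0) sequentially"
          proof (rule eventually_sequentiallyI[of N])
            fix k assume "N \<le> k"
            then have "1 / infdist e C < real k" using N by linarith
            then show "?f k e = 0" using pos by (simp add: field_simps)
          qed
          then show ?thesis using nC by (auto intro: tendsto_eventually)
        qed
        then show "(\<lambda>k. \<Sum>e\<leftarrow>pt_spec d s x. ?f k e) \<longlonglongrightarrow> (\<Sum>e\<leftarrow>pt_spec d s x. indicator C e)"
          unfolding sum_list_pt_spec by (intro tendsto_sum)
      qed
    qed
  next
    case empty
    then show ?case by simp
  next
    case (compl A)
    have "(\<Sum>e\<leftarrow>pt_spec d s x. indicator (UNIV - A) e :: real) = real (d * d) - (\<Sum>e\<leftarrow>pt_spec d s x. indicator A e)" for x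
    proof -
      have "(\<Sum>i<d * d. indicator (UNIV - A) (pt_spec d s x ! i) :: real) = (\<Sum>i<d * d. 1 - indicator A (pt_spec d s x ! i))"
        by (rule sum.cong) (auto simp: indicator_def)
      then show ?thesis unfolding sum_list_pt_spec by (simp add: sum_subtractf)
    qed
    then show ?case using compl by simp
  next
    case (union A)
    show ?case
    proof (rule borel_measurable_LIMSEQ_real)
      fix k :: nat
      have "(\<Sum>e\<leftarrow>pt_spec d s x. \<Sum>i<k. indicator (A i) e :: real) = (\<Sum>i<k. \<Sum>e\<leftarrow>pt_spec d s x. indicator (A i) e)" for x
        unfolding sum_list_pt_spec by (rule sum.swap)
      then show "(\<lambda>x. \<Sum>e\<leftarrow>pt_spec d s x. \<Sum>i<k. indicator (A i) e :: real) \<in> borel_measurable ?M"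
        by (simp only:) (intro borel_measurable_sum, use union in blast)
    next
      fix x
      have "(\<lambda>k. \<Sum>i<k. indicator (A i) e :: real) \<longlonglongrightarrow> indicator (\<Union>i. A i) e" for e
      proof (cases "\<exists>i. e \<in> A i")
        case True
        then obtain i where i: "e \<in> A i" by blast
        have u: "e \<in> A j \<longleftrightarrow> j = i" for j using union(1) i by (auto simp: disjoint_family_on_def)
        have "eventually (\<lambda>k. (\<Sum>j<k. indicator (A j) e :: real) = 1) sequentially"
        proof (rule eventually_sequentiallyI[of "Suc i"])
          fix k assume k: "Suc i \<le> k"
          have "(\<Sum>j<k. indicator (A j) e :: real) = (\<Sum>j<k. if j = i then 1 else 0)"
            by (rule sum.cong) (simp_all add: indicator_def u)
          then show "(\<Sum>j<k. indicator (A j) e :: real) = 1" using k by simp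
        qed
        moreover have "indicator (\<Union>i. A i) e = (1::real)" using i by (auto simp: indicator_def)
        ultimately show ?thesis by (simp add: tendsto_eventually)
      next
        case False
        then show ?thesis by simp
      qed
      then show "(\<lambda>k. \<Sum>e\<leftarrow>pt_spec d s x. \<Sum>i<k. indicator (A i) e :: real) \<longlonglongrightarrow> (\<Sum>e\<leftarrow>pt_spec d s x. indicator (\<Union>i. A i) e)"
        unfolding sum_list_pt_spec by (intro tendsto_sum)
    qed
  qed
qed

lemma length_filter_indicator: "real (length (filter (\<lambda>e. e \<in> S) es)) = (\<Sum>e\<leftarrow>es. indicator S e)"
  by (induction es) auto

lemma eig_count_measurable:
  assumes S: "S \<in> sets (borel :: real measure)"
  shows "(\<lambda>x. real (eig_count (pt_state d s x) S)) \<in> borel_measurable (leb_idx (idx (d * d) s))"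
  unfolding eig_count_spectrum[OF pt_state_carrier pt_spec(1)] length_filter_indicator
  by (rule spec_indicator_measurable[OF S])

lemma pt_spec_ne: "0 < d \<Longrightarrow> pt_spec d s x \<noteq> []"
  using pt_spec(2)[of d s x] by auto

lemma lambda_scaled:
  assumes d: "0 < d" and A: "A \<in> carrier_mat (d * d) (d * d)" and sp: "real_spectrum A es" and ne: "es \<noteq> []"
  shows "lambda_max (of_nat (d * d) \<cdot>\<^sub>m A) = Max (set (map (\<lambda>e. real (d * d) * e) es))"
    "lambda_min (of_nat (d * d) \<cdot>\<^sub>m A) = Min (set (map (\<lambda>e. real (d * d) * e) es))"
proof -
  have c: "complex_of_nat (d * d) = complex_of_real (real (d * d))" by simp
  have B: "complex_of_real (real (d * d)) \<cdot>\<^sub>m A \<in> carrier_mat (d * d) (d * d)" using A by simp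
  show "lambda_max (of_nat (d * d) \<cdot>\<^sub>m A) = Max (set (map (\<lambda>e. real (d * d) * e) es))"
    "lambda_min (of_nat (d * d) \<cdot>\<^sub>m A) = Min (set (map (\<lambda>e. real (d * d) * e) es))"
    unfolding c using lambda_spectrum[OF B real_spectrum_smult[OF A sp]] by blast+
qed

text \<open>The largest eigenvalue exceeds a level iff the number of eigenvalues above it is
  positive, which reduces the claim to measurable counts; likewise from below.\<close>

lemma lambda_measurable:
  assumes d: "0 < d"
  shows "(\<lambda>x. lambda_max (of_nat (d * d) \<cdot>\<^sub>m pt_state d s x)) \<in> borel_measurable (leb_idx (idx (d * d) s))"
    "(\<lambda>x. lambda_min (of_nat (d * d) \<cdot>\<^sub>m pt_state d s x)) \<in> borel_measurable (leb_idx (idx (d * d) s))"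
proof -
  let ?M = "leb_idx (idx (d * d) s)"
  let ?n = "real (d * d)"
  have n: "0 < ?n" using d by simp
  have ind: "(\<exists>e\<in>set es. e \<in> S) \<longleftrightarrow> 0 < (\<Sum>e\<leftarrow>es. indicator S e :: real)" for es S
    unfolding length_filter_indicator[symmetric] by (auto simp: filter_empty_conv)
  note l = lambda_scaled[OF d pt_state_carrier pt_spec(1) pt_spec_ne[OF d]]
  have "{x \<in> space ?M. a < lambda_max (of_nat (d * d) \<cdot>\<^sub>m pt_state d s x)} \<in> sets ?M" for a
  proof -
    have "a < lambda_max (of_nat (d * d) \<cdot>\<^sub>m pt_state d s x) \<longleftrightarrow> 0 < (\<Sum>e\<leftarrow>pt_spec d s x. indicator {a / ?n<..} e :: real)" for x
    proof -
      have "a < lambda_max (of_nat (d * d) \<cdot>\<^sub>m pt_state d s x) \<longleftrightarrow> (\<exists>e\<in>set (pt_spec d s x). a < ?n * e)"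
        unfolding l(1) by (subst Max_gr_iff) (use pt_spec_ne[OF d] in auto)
      also have "\<dots> \<longleftrightarrow> (\<exists>e\<in>set (pt_spec d s x). e \<in> {a / ?n<..})" using n by (simp add: field_simps)
      finally show ?thesis unfolding ind .
    qed
    moreover have "{x \<in> space ?M. 0 < (\<Sum>e\<leftarrow>pt_spec d s x. indicator {a / ?n<..} e :: real)} \<in> sets ?M"
      using spec_indicator_measurable[of "{a / ?n<..}" d s] by measurable
    ultimately show ?thesis by simp
  qed
  then show "(\<lambda>x. lambda_max (of_nat (d * d) \<cdot>\<^sub>m pt_state d s x)) \<in> borel_measurable ?M"
    unfolding borel_measurable_iff_greater by blast
  have "{x \<in> space ?M. lambda_min (of_nat (d * d) \<cdot>\<^sub>m pt_state d s x) < a} \<in> sets ?M" for a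
  proof -
    have "lambda_min (of_nat (d * d) \<cdot>\<^sub>m pt_state d s x) < a \<longleftrightarrow> 0 < (\<Sum>e\<leftarrow>pt_spec d s x. indicator {..<a / ?n} e :: real)" for x
    proof -
      have "lambda_min (of_nat (d * d) \<cdot>\<^sub>m pt_state d s x) < a \<longleftrightarrow> (\<exists>e\<in>set (pt_spec d s x). ?n * e < a)"
        unfolding l(2) by (subst Min_less_iff) (use pt_spec_ne[OF d] in auto)
      also have "\<dots> \<longleftrightarrow> (\<exists>e\<in>set (pt_spec d s x). e \<in> {..<a / ?n})" using n by (simp add: field_simps)
      finally show ?thesis unfolding ind .
    qed
    moreover have "{x \<in> space ?M. 0 < (\<Sum>e\<leftarrow>pt_spec d s x. indicator {..<a / ?n} e :: real)} \<in> sets ?M"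
      using spec_indicator_measurable[of "{..<a / ?n}" d s] by measurable
    ultimately show ?thesis by simp
  qed
  then show "(\<lambda>x. lambda_min (of_nat (d * d) \<cdot>\<^sub>m pt_state d s x)) \<in> borel_measurable ?M"
    unfolding borel_measurable_iff_less by blast
qed

section \<open>The spectra of the centred and of the normalized matrix\<close>

definition centered_spec :: "nat \<Rightarrow> nat \<Rightarrow> (nat \<times> nat \<Rightarrow> complex) \<Rightarrow> real list" where
  "centered_spec d s x = map (\<lambda>e. (e - real s) / sqrt (real (d * d * s))) (pt_spec d s x)"

lemma cheb_gen_scale: "0 \<le> c \<Longrightarrow> cheb_gen c p (sqrt c * y) = sqrt c ^ p * cheb p y"
  by (induction p rule: induct_nat_012) (simp_all add: algebra_simps power2_eq_square[symmetric])

lemma cheb_trace_spec: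
  assumes d: "0 < d" and s: "0 < s"
  shows "cheb_trace d s p x = complex_of_real (sqrt (real (d * d * s)) ^ p * (\<Sum>y\<leftarrow>centered_spec d s x. cheb p y))"
proof -
  let ?c = "real (d * d * s)"
  let ?B = "complex_of_real 1 \<cdot>\<^sub>m pt_state d s x + complex_of_real (- real s) \<cdot>\<^sub>m 1\<^sub>m (d * d)"
  have c: "0 < ?c" using d s by simp
  have B: "?B \<in> carrier_mat (d * d) (d * d)" using pt_state_carrier[of d s x] by simp
  have b: "centered_entry d s x y z = ?B $$ (y, z)" if "y < d * d" "z < d * d" for y z
    using that pt_state_carrier[of d s x]
    by (auto simp: centered_entry_def pt_state_entry[OF that] sum_subtractf)
  have "cheb_trace d s p x = (\<Sum>y<d * d. cheb_entry (centered_entry d s x) (d * d) (complex_of_real ?c) p y y)"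
    by (simp add: cheb_trace_def)
  also have "\<dots> = complex_of_real (\<Sum>e\<leftarrow>map (\<lambda>e. 1 * e + - real s) (pt_spec d s x). cheb_gen ?c p e)"
    by (rule cheb_entry_trace[OF B real_spectrum_affine[OF pt_state_carrier pt_spec(1)] b])
  also have "(\<Sum>e\<leftarrow>map (\<lambda>e. 1 * e + - real s) (pt_spec d s x). cheb_gen ?c p e) =
     (\<Sum>e\<leftarrow>pt_spec d s x. sqrt ?c ^ p * cheb p ((e - real s) / sqrt ?c))"
  proof -
    have nz: "sqrt ?c * ((e - real s) / sqrt ?c) = e - real s" for e
      unfolding times_divide_eq_right by (rule nonzero_mult_div_cancel_left) (use d s in simp)
    have "1 * e + - real s = e - real s" for e by simp
    then have "cheb_gen ?c p (1 * e + - real s) = sqrt ?c ^ p * cheb p ((e - real s) / sqrt ?c)" for e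
      using cheb_gen_scale[OF less_imp_le[OF c], of p "(e - real s) / sqrt ?c"] unfolding nz by (simp only:)
    then show ?thesis by (simp only: map_map o_def)
  qed
  also have "\<dots> = sqrt ?c ^ p * (\<Sum>y\<leftarrow>centered_spec d s x. cheb p y)"
    by (simp add: centered_spec_def sum_list_const_mult o_def)
  finally show ?thesis .
qed

lemma centered_spec_props: "length (centered_spec d s x) = d * d" "0 < d \<Longrightarrow> centered_spec d s x \<noteq> []"
  using pt_spec_ne[of d s x] by (simp_all add: centered_spec_def pt_spec(2))

definition radial_factor :: "nat \<Rightarrow> nat \<Rightarrow> (nat \<times> nat \<Rightarrow> complex) \<Rightarrow> real" where
  "radial_factor d s x = real (d * d * s) / (norm_idx (idx (d * d) s) x)\<^sup>2"

text \<open>An eigenvalue e of the Gaussian matrix becomes e / |x|^2. Here e / s = 1 + sqrt (n / s)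
  y for the centred eigenvalue y, and the remaining factor s / |x|^2 is \<open>radial_factor\<close>
  divided by n.\<close>

lemma normalized_spectrum:
  assumes d: "0 < d" and s: "0 < s"
  shows "real_spectrum (pt_state d s (normalize_idx (idx (d * d) s) x))
    (map (\<lambda>y. radial_factor d s x * (1 + sqrt (real (d * d) / real s) * y) / real (d * d)) (centered_spec d s x))"
proof -
  let ?V = "idx (d * d) s"
  let ?N = "norm_idx ?V x"
  have eq: "pt_state d s (normalize_idx ?V x) = complex_of_real (1 / ?N\<^sup>2) \<cdot>\<^sub>m pt_state d s x"
  proof (rule eq_matI)
    fix p q assume "p < dim_row (complex_of_real (1 / ?N\<^sup>2) \<cdot>\<^sub>m pt_state d s x)" "q < dim_col (complex_of_real (1 / ?N\<^sup>2) \<cdot>\<^sub>m pt_state d s x)"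
    then have pq: "p < d * d" "q < d * d" using pt_state_carrier[of d s x] by auto
    have "(mix d p q, k) \<in> ?V" "(mix d q p, k) \<in> ?V" if "k < s" for k
      using that mix_lt[OF pq(1)] mix_lt[OF pq(2)] by (simp_all add: idx_def)
    then have "pt_state d s (normalize_idx ?V x) $$ (p, q) = (\<Sum>k<s. complex_of_real (1 / ?N\<^sup>2) * (x (mix d p q, k) * cnj (x (mix d q p, k))))"
      unfolding pt_state_entry[OF pq] by (intro sum.cong) (auto simp: normalize_idx_def power2_eq_square)
    also have "\<dots> = (complex_of_real (1 / ?N\<^sup>2) \<cdot>\<^sub>m pt_state d s x) $$ (p, q)"
      using pq pt_state_carrier[of d s x] by (simp add: pt_state_entry[OF pq] sum_distrib_left)
    finally show "pt_state d s (normalize_idx ?V x) $$ (p, q) = (complex_of_real (1 / ?N\<^sup>2) \<cdot>\<^sub>m pt_state d s x) $$ (p, q)" .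
  qed (use pt_state_carrier[of d s x] pt_state_carrier[of d s "normalize_idx ?V x"] in auto)
  have "map (\<lambda>e. 1 / ?N\<^sup>2 * e) (pt_spec d s x) =
     map (\<lambda>y. radial_factor d s x * (1 + sqrt (real (d * d) / real s) * y) / real (d * d)) (centered_spec d s x)"
  proof -
    have "1 / ?N\<^sup>2 * e = radial_factor d s x * (1 + sqrt (real (d * d) / real s) * ((e - real s) / sqrt (real (d * d * s)))) / real (d * d)" for e
    proof -
      have "sqrt (real (d * d) / real s) / sqrt (real (d * d * s)) = sqrt ((1 / real s)\<^sup>2)"
        unfolding real_sqrt_divide[symmetric] using d s by (simp add: power2_eq_square field_simps)
      then have q: "sqrt (real (d * d) / real s) / sqrt (real (d * d * s)) = 1 / real s" by simp
      have "sqrt (real (d * d) / real s) * ((e - real s) / sqrt (real (d * d * s))) = (sqrt (real (d * d) / real s) / sqrt (real (d * d * s))) * (e - real s)"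
        by simp
      also have "\<dots> = e / real s - 1" unfolding q using s by (simp add: field_simps)
      finally have w: "1 + sqrt (real (d * d) / real s) * ((e - real s) / sqrt (real (d * d * s))) = e / real s" by simp
      show ?thesis unfolding w radial_factor_def using d s by simp
    qed
    then show ?thesis unfolding centered_spec_def map_map o_def by (intro map_cong refl)
  qed
  then show ?thesis unfolding eq using real_spectrum_smult[OF pt_state_carrier[of d s x] pt_spec(1)[of d s x], of "1 / ?N\<^sup>2"] by (simp only:)
qed

subsection \<open>Concentration\<close>

lemma cheb_uminus: "cheb p (- y) = (- 1) ^ p * cheb p y"
  by (induction p rule: induct_nat_012) (simp_all add: algebra_simps)

text \<open>From y at least 2 + e, the recursion subtracts at most one copy of the current value, so
  each step still multiplies by at least 1 + e. The lower bound 1 is carried along because the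
  induction needs positivity.\<close>

lemma cheb_growth:
  assumes e: "0 \<le> e" and y: "2 + e \<le> y"
  shows "1 \<le> cheb p y \<and> (1 + e) * cheb p y \<le> cheb (Suc p) y"
proof (induction p)
  case 0
  then show ?case using assms by simp
next
  case (Suc p)
  have "cheb p y \<le> (1 + e) * cheb p y" using Suc e by (simp add: algebra_simps)
  then have le: "cheb p y \<le> cheb (Suc p) y" using Suc by linarith
  have "cheb (Suc p) y * (2 + e) \<le> cheb (Suc p) y * y" using y Suc le by (intro mult_left_mono) linarith+
  then have "(1 + e) * cheb (Suc p) y \<le> cheb (Suc p) y * y - cheb p y" using le by (simp add: algebra_simps)
  then show ?case using Suc le by simp
qed

lemma cheb_outside:
  assumes e: "0 \<le> e" and y: "2 + e \<le> \<bar>y\<bar>" and p: "even p"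
  shows "(1 + e) ^ p \<le> cheb p y"
proof -
  have pos: "(1 + e) ^ k \<le> cheb k \<bar>y\<bar>" for k
  proof (induction k)
    case (Suc k)
    have "(1 + e) ^ Suc k \<le> (1 + e) * cheb k \<bar>y\<bar>" using mult_left_mono[OF Suc, of "1 + e"] e by simp
    also have "\<dots> \<le> cheb (Suc k) \<bar>y\<bar>" using cheb_growth[OF e y] by blast
    finally show ?case .
  qed simp
  have "cheb p \<bar>y\<bar> = cheb p y" using p cheb_uminus[of p y] by (cases "0 \<le> y") simp_all
  then show ?thesis using pos[of p] by simp
qed

lemma abs_sin_mult: "\<bar>sin (real n * t)\<bar> \<le> real n * \<bar>sin t\<bar>"
proof (induction n)
  case (Suc n)
  have "\<bar>sin (real (Suc n) * t)\<bar> = \<bar>sin (real n * t) * cos t + cos (real n * t) * sin t\<bar>"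
    unfolding sin_add[symmetric] by (simp add: algebra_simps)
  also have "\<dots> \<le> \<bar>sin (real n * t)\<bar> * \<bar>cos t\<bar> + \<bar>cos (real n * t)\<bar> * \<bar>sin t\<bar>"
    unfolding abs_mult[symmetric] by (rule abs_triangle_ineq)
  also have "\<dots> \<le> \<bar>sin (real n * t)\<bar> * 1 + 1 * \<bar>sin t\<bar>"
    by (intro add_mono mult_left_mono mult_right_mono) auto
  also have "\<dots> \<le> real (Suc n) * \<bar>sin t\<bar>" using Suc by (simp add: algebra_simps)
  finally show ?case .
qed simp

text \<open>On [-2, 2] the quotient sin ((p + 1) t) / sin t is bounded by p + 1; outside, an even
  degree gives positive values.\<close>

lemma cheb_lower:
  assumes p: "even p"
  shows "- (real p + 1) \<le> cheb p y"
proof (cases "2 \<le> \<bar>y\<bar>")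
  case True
  then show ?thesis using cheb_outside[of 0 y p] p by simp
next
  case False
  define t where "t = arccos (y / 2)"
  have y: "- 1 < y / 2" "y / 2 < 1" using False by auto
  then have "cos t = y / 2" unfolding t_def by (intro cos_arccos) auto
  then have c: "y = 2 * cos t" by simp
  have s: "0 < sin t" unfolding t_def by (intro sin_gt_zero arccos_lt_bounded[THEN conjunct1] arccos_lt_bounded[THEN conjunct2] y)
  have "\<bar>cheb p y * sin t\<bar> = \<bar>sin (real (Suc p) * t)\<bar>" unfolding c cheb_cos by (simp add: add.commute)
  also have "\<dots> \<le> real (Suc p) * \<bar>sin t\<bar>" by (rule abs_sin_mult)
  finally have "\<bar>cheb p y\<bar> \<le> real (Suc p)" using s by (simp add: abs_mult)
  then show ?thesis by (simp add: abs_le_iff)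
qed

text \<open>Adding p + 1 to every summand makes all of them nonnegative, so a single outlier is not
  compensated by the rest of the spectrum.\<close>

lemma cheb_sum_outlier:
  assumes e: "0 \<le> e" and x: "x \<in> set xs" "2 + e \<le> \<bar>x\<bar>" and p: "even p"
  shows "(1 + e) ^ p \<le> (\<Sum>y\<leftarrow>xs. cheb p y) + real (length xs) * (real p + 1)"
proof -
  have "(1 + e) ^ p \<le> cheb p x" by (rule cheb_outside[OF e x(2) p])
  also have "\<dots> \<le> cheb p x + (real p + 1)" by simp
  also have "\<dots> \<le> (\<Sum>y\<leftarrow>xs. cheb p y + (real p + 1))"
  proof (rule member_le_sum_list)
    show "cheb p x + (real p + 1) \<in> set (map (\<lambda>y. cheb p y + (real p + 1)) xs)" using x(1) by auto
    fix z assume "z \<in> set (map (\<lambda>y. cheb p y + (real p + 1)) xs)"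
    then obtain y where "z = cheb p y + (real p + 1)" by auto
    then show "0 \<le> z" using cheb_lower[OF p, of y] by linarith
  qed
  also have "\<dots> = (\<Sum>y\<leftarrow>xs. cheb p y) + real (length xs) * (real p + 1)"
    by (simp add: sum_list_addf sum_list_triv algebra_simps)
  finally show ?thesis .
qed

definition cheb_sum :: "nat \<Rightarrow> nat \<Rightarrow> nat \<Rightarrow> (nat \<times> nat \<Rightarrow> complex) \<Rightarrow> real" where
  "cheb_sum d s p x = (\<Sum>y\<leftarrow>centered_spec d s x. cheb p y)"

text \<open>Division by sqrt (d^2 s)^p = d^p s^(p/2) cancels all powers of \<open>s\<close>; the
  joint counts d^(p + 2) and d^(2p + 4) become d^2 and d^4, and only the gains remain.\<close>

lemma cheb_sum_moments:
  assumes p: "1 \<le> p" and d: "1 \<le> d" and ds: "real d powr (3/2) \<le> real s"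
  obtains m1 m2 :: real where
    "has_bochner_integral (gauss_space (idx (d * d) s)) (cheb_sum d s p) m1"
    "m1 \<le> real d powr (2 - 11/96) * (1 + (real p + 1) * real d powr (-1/96)) ^ p"
    "has_bochner_integral (gauss_space (idx (d * d) s)) (\<lambda>x. (cheb_sum d s p x)\<^sup>2) m2"
    "m2 \<le> fact (2 * p) * real d powr (4 - 1/4)"
proof -
  let ?M = "gauss_space (idx (d * d) s)"
  have d0: "0 < real d" "0 < d" using d by auto
  have "0 < real d powr (3/2)" using d0 by simp
  then have s: "0 < real s" "0 < s" using ds by linarith+
  let ?K = "sqrt (real (d * d * s)) ^ p"
  have K: "?K = real d powr p * real s powr (p / 2)"
  proof -
    have "sqrt (real (d * d * s)) = real d * real s powr (1/2)"
      using d0 by (simp add: real_sqrt_mult powr_half_sqrt)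
    then have "?K = real d ^ p * (real s powr (1/2)) ^ p" by (simp only: power_mult_distrib)
    also have "\<dots> = real d powr p * real s powr (p / 2)"
      using d0 s by (simp add: powr_realpow[symmetric] powr_powr)
    finally show ?thesis .
  qed
  have K0: "0 < ?K" using d0 s by simp
  obtain E1 E2 where E: "has_bochner_integral ?M (cheb_trace d s p) (complex_of_real E1)"
    "E1 \<le> real s powr (p / 2) * real d powr (real p + 2 - 11/96) * (1 + (real p + 1) * real d powr (-1/96)) ^ p"
    "has_bochner_integral ?M (\<lambda>x. cheb_trace d s p x * cheb_trace d s p x) (complex_of_real E2)"
    "E2 \<le> fact (2 * p) * (real s powr p * real d powr (real (2 * p + 4) - 1/4))"
    by (rule cheb_trace_moments[OF p d ds])
  have tr: "cheb_trace d s p x = complex_of_real (?K * cheb_sum d s p x)" for x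
    unfolding cheb_sum_def by (rule cheb_trace_spec[OF d0(2) s(2)])
  have c1: "(1 / ?K) * (?K * u) = u" for u
  proof -
    have "k \<noteq> 0 \<Longrightarrow> (1 / k) * (k * u) = u" for k :: real by simp
    then show ?thesis using K0 by (metis less_irrefl)
  qed
  show ?thesis
  proof
    have "has_bochner_integral ?M (\<lambda>x. Re (cheb_trace d s p x)) (Re (complex_of_real E1))"
      by (rule has_bochner_integral_bounded_linear[OF bounded_linear_Re E(1)])
    then have "has_bochner_integral ?M (\<lambda>x. ?K * cheb_sum d s p x) E1" by (simp only: tr Re_complex_of_real)
    then have "has_bochner_integral ?M (\<lambda>x. (1 / ?K) * (?K * cheb_sum d s p x)) ((1 / ?K) * E1)"
      by (intro has_bochner_integral_mult_right)
    moreover note c1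
    ultimately show "has_bochner_integral ?M (cheb_sum d s p) ((1 / ?K) * E1)" by (simp only:)
    let ?X = "(1 + (real p + 1) * real d powr (-1/96)) ^ p"
    have "(1 / ?K) * E1 \<le> (1 / ?K) * (real s powr (p / 2) * real d powr (real p + 2 - 11/96) * ?X)"
      by (rule mult_left_mono[OF E(2)]) (use K0 in simp)
    also have "real d powr (real p + 2 - 11/96) = real d powr p * real d powr (2 - 11/96)"
      unfolding powr_add[symmetric] by (simp add: algebra_simps)
    also have "(1 / ?K) * (real s powr (p / 2) * (real d powr p * real d powr (2 - 11/96)) * ?X) =
       (1 / ?K) * (?K * (real d powr (2 - 11/96) * ?X))" unfolding K by (simp only: mult_ac)
    also have "\<dots> = real d powr (2 - 11/96) * ?X" by (rule c1)
    finally show "(1 / ?K) * E1 \<le> real d powr (2 - 11/96) * ?X" .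
  next
    have "has_bochner_integral ?M (\<lambda>x. Re (cheb_trace d s p x * cheb_trace d s p x)) (Re (complex_of_real E2))"
      by (rule has_bochner_integral_bounded_linear[OF bounded_linear_Re E(3)])
    then have "has_bochner_integral ?M (\<lambda>x. (?K * cheb_sum d s p x) * (?K * cheb_sum d s p x)) E2"
      by (simp only: tr of_real_mult[symmetric] Re_complex_of_real)
    then have "has_bochner_integral ?M (\<lambda>x. (1 / ?K\<^sup>2) * ((?K * cheb_sum d s p x) * (?K * cheb_sum d s p x))) ((1 / ?K\<^sup>2) * E2)"
      by (intro has_bochner_integral_mult_right)
    moreover have c2: "(1 / ?K\<^sup>2) * (?K * u * (?K * v)) = u * v" for u v
    proof -
      have "k \<noteq> 0 \<Longrightarrow> (1 / k\<^sup>2) * (k * u * (k * v)) = u * v" for k :: real by (simp add: power2_eq_square)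
      then show ?thesis using K0 by (metis less_irrefl)
    qed
    ultimately show "has_bochner_integral ?M (\<lambda>x. (cheb_sum d s p x)\<^sup>2) ((1 / ?K\<^sup>2) * E2)" by (simp only: power2_eq_square[of "cheb_sum d s p _"])
    have "(1 / ?K\<^sup>2) * E2 \<le> (1 / ?K\<^sup>2) * (fact (2 * p) * (real s powr p * real d powr (real (2 * p + 4) - 1/4)))"
      by (rule mult_left_mono[OF E(4)]) simp
    also have "real d powr (real (2 * p + 4) - 1/4) = real d powr p * (real d powr p * real d powr (4 - 1/4))"
      unfolding powr_add[symmetric] by (simp add: algebra_simps)
    also have "real s powr p = real s powr (p / 2) * real s powr (p / 2)" unfolding powr_add[symmetric] by simp
    also have "(1 / ?K\<^sup>2) * (fact (2 * p) * (real s powr (p / 2) * real s powr (p / 2) * (real d powr p * (real d powr p * real d powr (4 - 1/4))))) =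
      (1 / ?K\<^sup>2) * (?K * fact (2 * p) * (?K * real d powr (4 - 1/4)))" unfolding K by (simp only: mult_ac)
    finally show "(1 / ?K\<^sup>2) * E2 \<le> fact (2 * p) * real d powr (4 - 1/4)" unfolding c2 .
  qed
qed

lemma gauss_abs_square:
  assumes V: "finite V" and v: "v \<in> V"
  shows "has_bochner_integral (gauss_space V) (\<lambda>x. (cmod (x v))\<^sup>2) 1"
proof -
  have "has_bochner_integral (gauss_space V) (\<lambda>x. \<Prod>t\<in>{0::nat}. x v * cnj (x v)) (fiber_mom V {0::nat} (\<lambda>_. v) (\<lambda>_. v))"
    by (rule gauss_monomial[OF V]) (use v in auto)
  moreover have "fiber_mom V {0::nat} (\<lambda>_. v) (\<lambda>_. v) = 1"
    using fiber_mom_insert[OF V, of "{}" "0::nat" "\<lambda>_. v" "\<lambda>_. v"] v by (simp add: fiber_mom_def)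
  ultimately have "has_bochner_integral (gauss_space V) (\<lambda>x. x v * cnj (x v)) 1" by simp
  from has_bochner_integral_bounded_linear[OF bounded_linear_Re this] show ?thesis
    by (simp add: complex_mult_cnj cmod_power2)
qed

lemma gauss_abs_square_mult:
  fixes V :: "'a set"
  assumes V: "finite V" and v: "v \<in> V" and w: "w \<in> V"
  shows "has_bochner_integral (gauss_space V) (\<lambda>x. (cmod (x v))\<^sup>2 * (cmod (x w))\<^sup>2) (1 + of_bool (v = w))"
proof -
  let ?a = "\<lambda>t::nat. if t = 0 then v else w"
  have one: "fiber_mom V {1::nat} ?a b = of_bool (w = b 1)" for b
    using fiber_mom_insert[OF V, of "{}" "1::nat" ?a b] w by (simp add: fiber_mom_def)
  have "has_bochner_integral (gauss_space V) (\<lambda>x. \<Prod>t\<in>{0::nat, 1}. x (?a t) * cnj (x (?a t))) (fiber_mom V {0, 1} ?a ?a)"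
    by (rule gauss_monomial[OF V]) (use v w in auto)
  moreover have "fiber_mom V {0::nat, 1} ?a ?a = 1 + of_bool (v = w)"
    using fiber_mom_insert[OF V, of "{1}" "0::nat" ?a ?a] v by (simp add: one one[simplified])
  moreover have "(\<Prod>t\<in>{0::nat, 1}. x (?a t) * cnj (x (?a t))) = complex_of_real ((cmod (x v))\<^sup>2 * (cmod (x w))\<^sup>2)" for x :: "'a \<Rightarrow> complex"
    unfolding of_real_mult complex_norm_square by simp
  ultimately have "has_bochner_integral (gauss_space V) (\<lambda>x. complex_of_real ((cmod (x v))\<^sup>2 * (cmod (x w))\<^sup>2)) (1 + of_bool (v = w))" by (simp only:)
  from has_bochner_integral_bounded_linear[OF bounded_linear_Re this]
  have "has_bochner_integral (gauss_space V) (\<lambda>x. (cmod (x v))\<^sup>2 * (cmod (x w))\<^sup>2) (Re (1 + of_bool (v = w)))"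
    by (simp only: Re_complex_of_real)
  moreover have "Re (1 + of_bool (v = w)) = 1 + of_bool (v = w)" by simp
  ultimately show ?thesis by (simp only:)
qed

text \<open>The squared moduli of the coordinates have mean 1, second moment 2 and vanishing
  covariances, hence variance 1 each.\<close>

lemma norm_idx_variance:
  assumes V: "finite V"
  shows "has_bochner_integral (gauss_space V) (\<lambda>x. ((norm_idx V x)\<^sup>2 - real (card V))\<^sup>2) (real (card V))"
proof -
  interpret prob_space "gauss_space V" by (rule prob_space_gauss_space)
  let ?N = "real (card V)"
  have "has_bochner_integral (gauss_space V) (\<lambda>x. (\<Sum>v\<in>V. \<Sum>w\<in>V. (cmod (x v))\<^sup>2 * (cmod (x w))\<^sup>2) - 2 * ?N * (\<Sum>v\<in>V. (cmod (x v))\<^sup>2) + ?N\<^sup>2)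
     ((\<Sum>v\<in>V. \<Sum>w\<in>V. 1 + of_bool (v = w)) - 2 * ?N * (\<Sum>v\<in>V. 1) + ?N\<^sup>2)"
    by (intro has_bochner_integral_add has_bochner_integral_diff has_bochner_integral_mult_right has_bochner_integral_sum gauss_abs_square_mult[OF V] gauss_abs_square[OF V])
      (simp_all add: has_bochner_integral_iff prob_space)
  moreover have "(\<Sum>v\<in>V. \<Sum>w\<in>V. (cmod (x v))\<^sup>2 * (cmod (x w))\<^sup>2) - 2 * ?N * (\<Sum>v\<in>V. (cmod (x v))\<^sup>2) + ?N\<^sup>2
     = ((norm_idx V x)\<^sup>2 - ?N)\<^sup>2" for x
  proof -
    have "(norm_idx V x)\<^sup>2 = (\<Sum>v\<in>V. (cmod (x v))\<^sup>2)" unfolding norm_idx_def by (simp add: sum_nonneg)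
    then have n: "(\<Sum>v\<in>V. (cmod (x v))\<^sup>2) = (norm_idx V x)\<^sup>2" ..
    show ?thesis unfolding sum_product[symmetric] n by (simp only: power2_eq_square) (simp add: algebra_simps)
  qed
  moreover have "(\<Sum>v\<in>V. \<Sum>w\<in>V. 1 + of_bool (v = w)) - 2 * ?N * (\<Sum>v\<in>V. 1) + ?N\<^sup>2 = ?N"
    using V by (simp add: sum.distrib of_bool_def power2_eq_square algebra_simps)
  ultimately show ?thesis by (simp only:)
qed

lemma space_gauss_leb: "space (gauss_space V) = space (leb_idx V)"
  by (rule sets_eq_imp_space_eq[OF sets_gauss_leb])

abbreviation gauss_dim :: "nat \<Rightarrow> nat \<Rightarrow> (nat \<times> nat \<Rightarrow> complex) measure" where
  "gauss_dim d s \<equiv> gauss_space (idx (d * d) s)"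

text \<open>The event is only required to contain the complement of a small measurable set. So it
  may speak of \<open>pt_spec\<close>, a choice of list for which no measurability is
  established.\<close>

definition whp :: "(nat \<Rightarrow> nat) \<Rightarrow> (nat \<Rightarrow> (nat \<times> nat \<Rightarrow> complex) \<Rightarrow> bool) \<Rightarrow> bool" where
  "whp s P \<longleftrightarrow> (\<forall>\<epsilon>>0. \<forall>\<^sub>F d in sequentially. \<exists>B\<in>sets (gauss_dim d (s d)).
     measure (gauss_dim d (s d)) B \<le> \<epsilon> \<and> (\<forall>x\<in>space (gauss_dim d (s d)) - B. P d x))"

lemma whpD: "whp s P \<Longrightarrow> 0 < \<epsilon> \<Longrightarrow> \<forall>\<^sub>F d in sequentially. \<exists>B\<in>sets (gauss_dim d (s d)).
     measure (gauss_dim d (s d)) B \<le> \<epsilon> \<and> (\<forall>x\<in>space (gauss_dim d (s d)) - B. P d x)"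
  unfolding whp_def by blast

lemma whp_mono:
  assumes P: "whp s P" and PQ: "\<forall>\<^sub>F d in sequentially. \<forall>x. P d x \<longrightarrow> Q d x"
  shows "whp s Q"
  unfolding whp_def
proof (intro allI impI)
  fix \<epsilon> :: real assume "0 < \<epsilon>"
  from whpD[OF P this] PQ show "\<forall>\<^sub>F d in sequentially. \<exists>B\<in>sets (gauss_dim d (s d)).
     measure (gauss_dim d (s d)) B \<le> \<epsilon> \<and> (\<forall>x\<in>space (gauss_dim d (s d)) - B. Q d x)"
    by eventually_elim blast
qed

lemma whp_conj:
  assumes P: "whp s P" and Q: "whp s Q"
  shows "whp s (\<lambda>d x. P d x \<and> Q d x)"
  unfolding whp_def
proof (intro allI impI)
  fix \<epsilon> :: real assume "0 < \<epsilon>"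
  then have h: "0 < \<epsilon> / 2" by simp
  from whpD[OF P h] whpD[OF Q h] show "\<forall>\<^sub>F d in sequentially. \<exists>B\<in>sets (gauss_dim d (s d)).
     measure (gauss_dim d (s d)) B \<le> \<epsilon> \<and> (\<forall>x\<in>space (gauss_dim d (s d)) - B. P d x \<and> Q d x)"
  proof eventually_elim
    case (elim d)
    then obtain B C where B: "B \<in> sets (gauss_dim d (s d))" "measure (gauss_dim d (s d)) B \<le> \<epsilon> / 2" "\<forall>x\<in>space (gauss_dim d (s d)) - B. P d x"
      and C: "C \<in> sets (gauss_dim d (s d))" "measure (gauss_dim d (s d)) C \<le> \<epsilon> / 2" "\<forall>x\<in>space (gauss_dim d (s d)) - C. Q d x"
      by blast
    have "measure (gauss_dim d (s d)) (B \<union> C) \<le> \<epsilon>" using measure_Un_le[OF B(1) C(1)] B(2) C(2) by linarith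
    moreover have "B \<union> C \<in> sets (gauss_dim d (s d))" using B(1) C(1) by (rule sets.Un)
    moreover have "\<forall>x\<in>space (gauss_dim d (s d)) - (B \<union> C). P d x \<and> Q d x" using B(3) C(3) by blast
    ultimately show ?case by blast
  qed
qed

lemma whp_ball:
  assumes "finite A" "\<And>m. m \<in> A \<Longrightarrow> whp s (P m)"
  shows "whp s (\<lambda>d x. \<forall>m\<in>A. P m d x)"
  using assms
proof (induction A rule: finite_induct)
  case empty
  have "\<exists>B\<in>sets (gauss_dim d (s d)). measure (gauss_dim d (s d)) B \<le> \<epsilon> \<and> (\<forall>x\<in>space (gauss_dim d (s d)) - B. \<forall>m\<in>{}. P m d x)" if "0 < \<epsilon>" for d \<epsilon>
    using that by (intro bexI[of _ "{}"]) simp_all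
  then show ?case unfolding whp_def by (intro allI impI always_eventually) blast
next
  case (insert a A)
  have "whp s (\<lambda>d x. P a d x \<and> (\<forall>m\<in>A. P m d x))" by (rule whp_conj) (use insert in blast)+
  then show ?case by simp
qed

lemma whp_markov:
  fixes u :: "nat \<Rightarrow> (nat \<times> nat \<Rightarrow> complex) \<Rightarrow> real"
  assumes m: "\<forall>\<^sub>F d in sequentially. \<exists>m. has_bochner_integral (gauss_dim d (s d)) (u d) m \<and> m / c d \<le> f d"
    and c: "\<forall>\<^sub>F d in sequentially. 0 < c d" and u: "\<And>d x. 0 \<le> u d x" and f: "f \<longlonglongrightarrow> 0"
    and P: "\<forall>\<^sub>F d in sequentially. \<forall>x. u d x < c d \<longrightarrow> P d x"
  shows "whp s P"
  unfolding whp_def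
proof (intro allI impI)
  fix \<epsilon> :: real assume "0 < \<epsilon>"
  with f have "\<forall>\<^sub>F d in sequentially. f d < \<epsilon>" by (rule order_tendstoD(2))
  with m c P show "\<forall>\<^sub>F d in sequentially. \<exists>B\<in>sets (gauss_dim d (s d)).
     measure (gauss_dim d (s d)) B \<le> \<epsilon> \<and> (\<forall>x\<in>space (gauss_dim d (s d)) - B. P d x)"
  proof eventually_elim
    case (elim d)
    then obtain m where m: "has_bochner_integral (gauss_dim d (s d)) (u d) m" "m / c d \<le> f d" by blast
    have i: "integrable (gauss_dim d (s d)) (u d)" "integral\<^sup>L (gauss_dim d (s d)) (u d) = m" using m(1) by (simp_all add: has_bochner_integral_iff)
    let ?B = "{x \<in> space (gauss_dim d (s d)). c d \<le> u d x}"
    have "measure (gauss_dim d (s d)) ?B \<le> m / c d"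
      unfolding i(2)[symmetric] by (rule integral_Markov_inequality_measure[OF i(1) sets.empty_sets]) (use u elim(2) in auto)
    then have "measure (gauss_dim d (s d)) ?B \<le> \<epsilon>" using m(2) elim(4) by linarith
    moreover have "?B \<in> sets (gauss_dim d (s d))" using i(1) by measurable
    moreover have "\<forall>x\<in>space (gauss_dim d (s d)) - ?B. P d x" using elim(3) by (simp add: not_le)
    ultimately show ?case by blast
  qed
qed

lemma cheb_sum_lower: "even p \<Longrightarrow> 0 \<le> cheb_sum d s p x + real (d * d) * (real p + 1)"
proof -
  assume p: "even p"
  have "0 \<le> (\<Sum>y\<leftarrow>centered_spec d s x. cheb p y + (real p + 1))"
  proof (rule sum_list_nonneg)
    fix z assume "z \<in> set (map (\<lambda>y. cheb p y + (real p + 1)) (centered_spec d s x))"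
    then obtain y where "z = cheb p y + (real p + 1)" by auto
    then show "0 \<le> z" using cheb_lower[OF p, of y] by linarith
  qed
  also have "\<dots> = cheb_sum d s p x + real (d * d) * (real p + 1)"
    unfolding cheb_sum_def sum_list_addf sum_list_triv centered_spec_props by (simp add: algebra_simps)
  finally show ?thesis .
qed

text \<open>The degree is of order \<open>ln d\<close>: large enough for \<open>(1 + \<eta>) ^ p\<close> to beat \<open>d ^ 4\<close>, small enough
  for the error factor in the trace moment to stay subpolynomial.\<close>

lemma outliers_whp:
  assumes ds: "\<forall>\<^sub>F d in sequentially. real d powr (3/2) \<le> real (s d)" and e: "0 < \<eta>"
  shows "whp s (\<lambda>d x. \<forall>y\<in>set (centered_spec d (s d) x). \<bar>y\<bar> \<le> 2 + \<eta>)"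
proof -
  \<comment> \<open>Chosen so that the even degree, at least 2 K ln d, satisfies (1 + \<eta>)^p >=
    exp (4 ln d) = d^4.\<close>
  define K where "K = 2 / ln (1 + \<eta>)"
  have K: "0 < K" using e by (simp add: K_def)
  define p where "p d = 2 * Suc (nat \<lceil>K * ln (real d)\<rceil>)" for d :: nat
  let ?u = "\<lambda>d x. cheb_sum d (s d) (p d) x + real (d * d) * (real (p d) + 1)"
  let ?c = "\<lambda>d. (1 + \<eta>) ^ p d"
  let ?X = "\<lambda>d::nat. real d powr (2 - 11/96) * exp ((2 * K * ln (real d) + 4) * ((2 * K * ln (real d) + 5) * real d powr (-1/96)))
     + real (d * d) * (2 * K * ln (real d) + 5)"
  let ?f = "\<lambda>d. ?X d / real d ^ 4"
  have pe: "even (p d)" for d by (simp add: p_def)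
  have p1: "1 \<le> p d" for d by (simp add: p_def)
  show ?thesis
  proof (rule whp_markov[where u = ?u and c = ?c and f = ?f])
    show "0 \<le> ?u d x" for d x by (rule cheb_sum_lower[OF pe])
    show "?f \<longlonglongrightarrow> 0" using K by real_asymp
    show "\<forall>\<^sub>F d in sequentially. 0 < ?c d" using e by (intro always_eventually allI) simp
    show "\<forall>\<^sub>F d in sequentially. \<forall>x. ?u d x < ?c d \<longrightarrow> (\<forall>y\<in>set (centered_spec d (s d) x). \<bar>y\<bar> \<le> 2 + \<eta>)"
    proof (intro always_eventually allI impI ballI)
      fix d x y assume u: "?u d x < ?c d" and y: "y \<in> set (centered_spec d (s d) x)"
      show "\<bar>y\<bar> \<le> 2 + \<eta>"
      proof (rule ccontr)
        assume "\<not> \<bar>y\<bar> \<le> 2 + \<eta>"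
        then have "2 + \<eta> \<le> \<bar>y\<bar>" by simp
        from cheb_sum_outlier[OF less_imp_le[OF e] y this pe[of d]] show False
          using u unfolding cheb_sum_def centered_spec_props by linarith
      qed
    qed
    show "\<forall>\<^sub>F d in sequentially. \<exists>m. has_bochner_integral (gauss_dim d (s d)) (?u d) m \<and> m / ?c d \<le> ?f d"
      using ds eventually_ge_at_top[of 1]
    proof eventually_elim
      case (elim d)
      interpret prob_space "gauss_dim d (s d)" by (rule prob_space_gauss_space)
      have d: "1 \<le> d" "0 < real d" "0 \<le> ln (real d)" using elim(2) by auto
      obtain m1 m2 where m: "has_bochner_integral (gauss_dim d (s d)) (cheb_sum d (s d) (p d)) m1"
        "m1 \<le> real d powr (2 - 11/96) * (1 + (real (p d) + 1) * real d powr (-1/96)) ^ p d"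
        "has_bochner_integral (gauss_dim d (s d)) (\<lambda>x. (cheb_sum d (s d) (p d) x)\<^sup>2) m2"
        "m2 \<le> fact (2 * p d) * real d powr (4 - 1/4)"
        by (rule cheb_sum_moments[OF p1 d(1) elim(1)])
      let ?m = "m1 + real (d * d) * (real (p d) + 1)"
      have kl: "0 \<le> K * ln (real d)" using K d by simp
      have pb: "2 * (K * ln (real d)) \<le> real (p d)" "real (p d) \<le> 2 * K * ln (real d) + 4"
      proof -
        define c where "c = nat \<lceil>K * ln (real d)\<rceil>"
        have "K * ln (real d) \<le> real c" "real c \<le> K * ln (real d) + 1" unfolding c_def using kl by linarith+
        moreover have "real (p d) = 2 * real c + 2" by (simp add: p_def c_def)
        ultimately show "2 * (K * ln (real d)) \<le> real (p d)" "real (p d) \<le> 2 * K * ln (real d) + 4"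
          by (simp_all add: mult.assoc)
      qed
      have "has_bochner_integral (gauss_dim d (s d)) (?u d) ?m"
        by (intro has_bochner_integral_add m(1)) (simp add: has_bochner_integral_iff prob_space)
      moreover have "?m / ?c d \<le> ?f d"
      proof (rule frac_le)
        \<comment> \<open>The error factor is at most exp (p z), whose exponent is of order (ln d)^2
          d^(-1/96) and tends to 0. The expectation is therefore of order d^2 ln d, against the
          threshold d^4.\<close>
        let ?z = "(real (p d) + 1) * real d powr (-1/96)"
        have z: "0 \<le> ?z" by simp
        have "(1 + ?z) ^ p d \<le> exp ?z ^ p d" using z by (intro power_mono exp_ge_add_one_self) simp
        also have "\<dots> = exp (real (p d) * ?z)" by (simp only: exp_of_nat_mult)
        also have "\<dots> \<le> exp ((2 * K * ln (real d) + 4) * ((2 * K * ln (real d) + 5) * real d powr (-1/96)))"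
          using pb kl by (intro iffD2[OF exp_le_cancel_iff] mult_mono mult_right_mono) auto
        finally have E: "(1 + ?z) ^ p d \<le> exp ((2 * K * ln (real d) + 4) * ((2 * K * ln (real d) + 5) * real d powr (-1/96)))" .
        have "m1 \<le> real d powr (2 - 11/96) * exp ((2 * K * ln (real d) + 4) * ((2 * K * ln (real d) + 5) * real d powr (-1/96)))"
          using m(2) mult_left_mono[OF E, of "real d powr (2 - 11/96)"] by simp
        moreover have "real (d * d) * (real (p d) + 1) \<le> real (d * d) * (2 * K * ln (real d) + 5)"
          using pb by (intro mult_left_mono) auto
        ultimately show "?m \<le> ?X d" by linarith
        show "0 \<le> ?X d" using K d by (intro add_nonneg_nonneg mult_nonneg_nonneg) auto
        show "0 < real d ^ 4" using d by simp
        have "ln (1 + \<eta>) \<noteq> 0" using e by simp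
        then have "real d ^ 4 = exp ((2 * (K * ln (real d))) * ln (1 + \<eta>))"
          using d by (simp add: K_def exp_of_nat_mult[of 4 "ln (real d)", simplified])
        also have "\<dots> \<le> exp (real (p d) * ln (1 + \<eta>))"
          using pb e by (intro iffD2[OF exp_le_cancel_iff] mult_right_mono) auto
        also have "\<dots> = ?c d" using e by (simp add: exp_of_nat_mult)
        finally show "real d ^ 4 \<le> ?c d" .
      qed
      ultimately show ?case by blast
    qed
  qed
qed

text \<open>Markov's inequality for the square: the second moment is of order d^(4 - 1/4), while the
  squared threshold is of order d^4.\<close>

lemma cheb_avg_whp:
  assumes ds: "\<forall>\<^sub>F d in sequentially. real d powr (3/2) \<le> real (s d)" and m: "1 \<le> m" and e: "0 < \<eta>"
  shows "whp s (\<lambda>d x. \<bar>avg (cheb m) (centered_spec d (s d) x)\<bar> \<le> \<eta>)"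
proof -
  define F where "F = (fact (2 * m) :: real)"
  have F: "0 < F" by (simp add: F_def)
  let ?u = "\<lambda>d x. (cheb_sum d (s d) m x)\<^sup>2"
  let ?c = "\<lambda>d::nat. (real d * real d * \<eta>)\<^sup>2"
  let ?f = "\<lambda>d. F * real d powr (4 - 1/4) / ?c d"
  show ?thesis
  proof (rule whp_markov[where u = ?u and c = ?c and f = ?f])
    show "0 \<le> ?u d x" for d x by simp
    show "?f \<longlonglongrightarrow> 0" using F e by real_asymp
    show c: "\<forall>\<^sub>F d in sequentially. 0 < ?c d" using eventually_gt_at_top[of 0] by eventually_elim (use e in simp)
    show "\<forall>\<^sub>F d in sequentially. \<forall>x. ?u d x < ?c d \<longrightarrow> \<bar>avg (cheb m) (centered_spec d (s d) x)\<bar> \<le> \<eta>"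
      using eventually_gt_at_top[of 0]
    proof eventually_elim
      case (elim d)
      show ?case
      proof (intro allI impI)
        fix x assume u: "?u d x < ?c d"
        have "\<bar>cheb_sum d (s d) m x\<bar> \<le> \<bar>real d * real d * \<eta>\<bar>"
          using u unfolding abs_le_square_iff by simp
        then have "\<bar>cheb_sum d (s d) m x\<bar> \<le> real d * real d * \<eta>" using e by (simp add: abs_mult)
        then have "\<bar>cheb_sum d (s d) m x\<bar> / (real d * real d) \<le> \<eta>" using elim by (simp add: field_simps)
        then show "\<bar>avg (cheb m) (centered_spec d (s d) x)\<bar> \<le> \<eta>"
          unfolding avg_def centered_spec_props cheb_sum_def[symmetric] by (simp add: abs_divide)
      qed
    qed
    show "\<forall>\<^sub>F d in sequentially. \<exists>m. has_bochner_integral (gauss_dim d (s d)) (?u d) m \<and> m / ?c d \<le> ?f d"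
      using ds eventually_ge_at_top[of 1]
    proof eventually_elim
      case (elim d)
      obtain m1 m2 where m: "has_bochner_integral (gauss_dim d (s d)) (cheb_sum d (s d) m) m1"
        "m1 \<le> real d powr (2 - 11/96) * (1 + (real m + 1) * real d powr (-1/96)) ^ m"
        "has_bochner_integral (gauss_dim d (s d)) (\<lambda>x. (cheb_sum d (s d) m x)\<^sup>2) m2"
        "m2 \<le> fact (2 * m) * real d powr (4 - 1/4)"
        by (rule cheb_sum_moments[OF m elim(2) elim(1)])
      have "m2 / ?c d \<le> ?f d" using m(4) by (intro divide_right_mono) (simp_all add: F_def)
      then show ?case using m(3) by blast
    qed
  qed
qed

lemma radial_whp:
  assumes ds: "\<forall>\<^sub>F d in sequentially. 1 \<le> s d" and e: "0 < \<eta>" "\<eta> \<le> 1"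
  shows "whp s (\<lambda>d x. \<bar>radial_factor d (s d) x - 1\<bar> \<le> \<eta>)"
proof -
  let ?N = "\<lambda>d. real (d * d * s d)"
  let ?u = "\<lambda>d x. ((norm_idx (idx (d * d) (s d)) x)\<^sup>2 - ?N d)\<^sup>2"
  \<comment> \<open>Half of \<eta> suffices for |x|^2 and is needed for its reciprocal: the
    deviation is divided by |x|^2, which is only known to be at least half of its mean.\<close>
  let ?c = "\<lambda>d. (?N d * (\<eta> / 2))\<^sup>2"
  let ?f = "\<lambda>d::nat. 4 / (real d * \<eta>\<^sup>2)"
  have N: "\<forall>\<^sub>F d in sequentially. 0 < real d \<and> real d \<le> ?N d"
    using ds eventually_gt_at_top[of 0]
  proof eventually_elim
    case (elim d)
    have "d * 1 * 1 \<le> d * d * s d" using elim by (intro mult_le_mono) auto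
    then have "real d \<le> ?N d" by (simp only: mult_1_right of_nat_le_iff)
    then show ?case using elim by simp
  qed
  show ?thesis
  proof (rule whp_markov[where u = ?u and c = ?c and f = ?f])
    show "0 \<le> ?u d x" for d x by simp
    show "?f \<longlonglongrightarrow> 0" using e(1) by real_asymp
    show "\<forall>\<^sub>F d in sequentially. 0 < ?c d" using N
    proof eventually_elim
      case (elim d)
      then have "0 < ?N d * (\<eta> / 2)" using e by (intro mult_pos_pos) linarith+
      then show ?case by (rule zero_less_power)
    qed
    show "\<forall>\<^sub>F d in sequentially. \<forall>x. ?u d x < ?c d \<longrightarrow> \<bar>radial_factor d (s d) x - 1\<bar> \<le> \<eta>" using N
    proof eventually_elim
      case (elim d)
      show ?case
      proof (intro allI impI)
        fix x assume u: "?u d x < ?c d"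
        define S where "S = (norm_idx (idx (d * d) (s d)) x)\<^sup>2"
        define n where "n = ?N d"
        have n: "0 < n" using elim unfolding n_def by linarith
        have "\<bar>S - n\<bar> \<le> \<bar>n * (\<eta> / 2)\<bar>"
          using u unfolding S_def[symmetric] n_def[symmetric] abs_le_square_iff by simp
        then have a: "\<bar>S - n\<bar> \<le> n * (\<eta> / 2)" using n e by simp
        have "n * (\<eta> / 2) \<le> n * (1 / 2)" using n e by (intro mult_left_mono) auto
        then have S: "n / 2 \<le> S" using a by linarith
        have "\<bar>S - n\<bar> \<le> \<eta> * (n / 2)" using a by (simp add: mult_ac)
        also have "\<dots> \<le> \<eta> * S" using S e by (intro mult_left_mono) auto
        finally have "\<bar>S - n\<bar> / S \<le> \<eta>" using S n by (simp add: field_simps)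
        moreover have "n / S - 1 = (n - S) / S" using S n by (simp add: field_simps)
        ultimately have "\<bar>n / S - 1\<bar> \<le> \<eta>" using S n by (simp add: abs_divide abs_minus_commute)
        then show "\<bar>radial_factor d (s d) x - 1\<bar> \<le> \<eta>" unfolding radial_factor_def S_def n_def .
      qed
    qed
    show "\<forall>\<^sub>F d in sequentially. \<exists>m. has_bochner_integral (gauss_dim d (s d)) (?u d) m \<and> m / ?c d \<le> ?f d" using N
    proof eventually_elim
      case (elim d)
      have "card (idx (d * d) (s d)) = d * d * s d" by (simp add: idx_def card_cartesian_product)
      then have "has_bochner_integral (gauss_dim d (s d)) (?u d) (?N d)" using norm_idx_variance[OF finite_idx[of "d * d" "s d"]] by (simp only:)
      moreover have "?N d / ?c d \<le> ?f d"
      proof -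
        define n where "n = ?N d"
        have n: "0 < real d" "real d \<le> n" using elim unfolding n_def by auto
        have "n / (n * (\<eta> / 2))\<^sup>2 = 4 / (n * \<eta>\<^sup>2)" using n e by (simp add: power2_eq_square field_simps)
        also have "\<dots> \<le> 4 / (real d * \<eta>\<^sup>2)" using n e by (intro divide_left_mono mult_right_mono mult_pos_pos) auto
        finally show ?thesis unfolding n_def .
      qed
      ultimately show ?case by blast
    qed
  qed
qed

lemma environment_dim:
  assumes a: "0 < \<alpha>" and s_def: "\<And>d::nat. s d = nat \<lfloor>\<alpha> * real (d * d)\<rfloor>"
  shows "\<forall>\<^sub>F d in sequentially. real d powr (3/2) \<le> real (s d)"
    and "\<forall>\<^sub>F d in sequentially. 1 \<le> s d"
    and "(\<lambda>d. sqrt (real (d * d) / real (s d))) \<longlonglongrightarrow> 1 / sqrt \<alpha>"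
proof -
  have s: "\<alpha> * real (d * d) - 1 \<le> real (s d)" "real (s d) \<le> \<alpha> * real (d * d)" for d
  proof -
    have "0 \<le> \<alpha> * real (d * d)" using a by simp
    then show "\<alpha> * real (d * d) - 1 \<le> real (s d)" "real (s d) \<le> \<alpha> * real (d * d)" unfolding s_def by linarith+
  qed
  have "\<forall>\<^sub>F d::nat in sequentially. real d powr (3/2) \<le> \<alpha> * (real d * real d) - 1" using a by real_asymp
  then show A: "\<forall>\<^sub>F d in sequentially. real d powr (3/2) \<le> real (s d)"
    by eventually_elim (use s in \<open>fastforce intro: order_trans\<close>)
  have "\<forall>\<^sub>F d::nat in sequentially. 2 \<le> \<alpha> * (real d * real d)" using a by real_asymp
  then show B: "\<forall>\<^sub>F d in sequentially. 1 \<le> s d"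
  proof eventually_elim
    case (elim d)
    then have "1 \<le> real (s d)" using s(1)[of d] by simp
    then show ?case by simp
  qed
  have "(\<lambda>d. real (d * d) / real (s d)) \<longlonglongrightarrow> 1 / \<alpha>"
  proof (rule tendsto_sandwich)
    show "(\<lambda>_. 1 / \<alpha>) \<longlonglongrightarrow> 1 / \<alpha>" by simp
    show "(\<lambda>d::nat. (real d * real d) / (\<alpha> * (real d * real d) - 1)) \<longlonglongrightarrow> 1 / \<alpha>" using a unfolding inverse_eq_divide[symmetric] by real_asymp
    show "\<forall>\<^sub>F d in sequentially. 1 / \<alpha> \<le> real (d * d) / real (s d)" using B
    proof eventually_elim
      case (elim d)
      then show ?case using s(2)[of d] a by (simp add: field_simps)
    qed
    have "\<forall>\<^sub>F d::nat in sequentially. 0 < \<alpha> * (real d * real d) - 1" using a by real_asymp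
    then show "\<forall>\<^sub>F d in sequentially. real (d * d) / real (s d) \<le> (real d * real d) / (\<alpha> * (real d * real d) - 1)"
    proof eventually_elim
      case (elim d)
      then show ?case using s(1)[of d] by (intro frac_le) simp_all
    qed
  qed
  then have "(\<lambda>d. sqrt (real (d * d) / real (s d))) \<longlonglongrightarrow> sqrt (1 / \<alpha>)" by (rule tendsto_real_sqrt)
  then show "(\<lambda>d. sqrt (real (d * d) / real (s d))) \<longlonglongrightarrow> 1 / sqrt \<alpha>" by (simp add: real_sqrt_divide)
qed

lemma near_edge_whp:
  assumes a: "0 < \<alpha>" and e: "0 < \<eta>" "\<eta> \<le> 1" and s_def: "\<And>d::nat. s d = nat \<lfloor>\<alpha> * real (d * d)\<rfloor>"
  shows "whp s (\<lambda>d x. near_edge_data (1 / sqrt \<alpha>) \<eta> M (centered_spec d (s d) x) (radial_factor d (s d) x) (sqrt (real (d * d) / real (s d)))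
    \<and> (\<forall>y\<in>set (centered_spec d (s d) x). \<bar>y\<bar> \<le> 2 + \<eta>))"
proof -
  note ed = environment_dim[OF a s_def]
  have "whp s (\<lambda>d x. \<forall>m\<in>{1..M}. \<bar>avg (cheb m) (centered_spec d (s d) x)\<bar> \<le> \<eta>)"
    by (rule whp_ball) (auto intro: cheb_avg_whp[OF ed(1) _ e(1)])
  then have W: "whp s (\<lambda>d x. (\<forall>m\<in>{1..M}. \<bar>avg (cheb m) (centered_spec d (s d) x)\<bar> \<le> \<eta>) \<and>
     \<bar>radial_factor d (s d) x - 1\<bar> \<le> \<eta> \<and> (\<forall>y\<in>set (centered_spec d (s d) x). \<bar>y\<bar> \<le> 2 + \<eta>))"
    by (intro whp_conj radial_whp[OF ed(2) e] outliers_whp[OF ed(1) e(1)])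
  have ev: "\<forall>\<^sub>F d in sequentially. \<bar>sqrt (real (d * d) / real (s d)) - 1 / sqrt \<alpha>\<bar> \<le> \<eta>"
    using tendstoD[OF ed(3) e(1)] by eventually_elim (simp add: dist_real_def)
  show ?thesis
  proof (rule whp_mono[OF W])
    show "\<forall>\<^sub>F d in sequentially. \<forall>x. (\<forall>m\<in>{1..M}. \<bar>avg (cheb m) (centered_spec d (s d) x)\<bar> \<le> \<eta>) \<and>
         \<bar>radial_factor d (s d) x - 1\<bar> \<le> \<eta> \<and> (\<forall>y\<in>set (centered_spec d (s d) x). \<bar>y\<bar> \<le> 2 + \<eta>) \<longrightarrow>
       near_edge_data (1 / sqrt \<alpha>) \<eta> M (centered_spec d (s d) x) (radial_factor d (s d) x) (sqrt (real (d * d) / real (s d)))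
        \<and> (\<forall>y\<in>set (centered_spec d (s d) x). \<bar>y\<bar> \<le> 2 + \<eta>)"
      using ev eventually_gt_at_top[of 0]
    proof eventually_elim
    case (elim d)
    show ?case
    proof (intro allI impI)
      fix x assume g: "(\<forall>m\<in>{1..M}. \<bar>avg (cheb m) (centered_spec d (s d) x)\<bar> \<le> \<eta>) \<and>
         \<bar>radial_factor d (s d) x - 1\<bar> \<le> \<eta> \<and> (\<forall>y\<in>set (centered_spec d (s d) x). \<bar>y\<bar> \<le> 2 + \<eta>)"
      have "\<bar>y\<bar> \<le> 3" if "y \<in> set (centered_spec d (s d) x)" for y
      proof -
        have "\<bar>y\<bar> \<le> 2 + \<eta>" using g that by blast
        then show ?thesis using e by linarith
      qed
      then show "near_edge_data (1 / sqrt \<alpha>) \<eta> M (centered_spec d (s d) x) (radial_factor d (s d) x) (sqrt (real (d * d) / real (s d)))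
        \<and> (\<forall>y\<in>set (centered_spec d (s d) x). \<bar>y\<bar> \<le> 2 + \<eta>)"
        unfolding near_edge_data_def using g elim(1) centered_spec_props(2)[OF elim(2)] by blast
    qed
    qed
  qed
qed

subsection \<open>Convergence in probability\<close>

text \<open>The probability of a deviation on the sphere equals that of its preimage under
  normalization, which lies in the exceptional set of the Gaussian space.\<close>

lemma conv_in_prob_sphereI:
  assumes m: "\<And>d. 2 \<le> d \<Longrightarrow> X d \<in> borel_measurable (leb_idx (idx (d * d) (s d)))"
    and w: "\<And>e. 0 < e \<Longrightarrow> whp s (\<lambda>d x. \<bar>X d (normalize_idx (idx (d * d) (s d)) x) - c\<bar> \<le> e)"
  shows "conv_in_prob (\<lambda>d. sphere_measure (d * d) (s d)) X c"
  unfolding conv_in_prob_def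
proof (intro conjI allI impI)
  let ?A = "\<lambda>e d. {w \<in> space (sphere_measure (d * d) (s d)). e < \<bar>X d w - c\<bar>}"
  have S: "?A e d \<in> sets (sphere_measure (d * d) (s d))" if "2 \<le> d" for d e
    unfolding space_sphere sets_sphere using m[OF that] by measurable
  then show "?A e d \<in> sets (sphere_measure (d * d) (s d))" if "2 \<le> d" for d e using that by blast
  fix e :: real assume e: "0 < e"
  show "(\<lambda>d. measure (sphere_measure (d * d) (s d)) (?A e d)) \<longlonglongrightarrow> 0"
  proof (rule tendstoI)
    fix \<epsilon> :: real assume eps: "0 < \<epsilon>"
    then have h: "0 < \<epsilon> / 2" by simp
    from whpD[OF w[OF e] h] eventually_ge_at_top[of 2]
    show "\<forall>\<^sub>F d in sequentially. dist (measure (sphere_measure (d * d) (s d)) (?A e d)) 0 < \<epsilon>"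
    proof eventually_elim
      case (elim d)
      interpret prob_space "gauss_dim d (s d)" by (rule prob_space_gauss_space)
      obtain B where B: "B \<in> sets (gauss_dim d (s d))" "measure (gauss_dim d (s d)) B \<le> \<epsilon> / 2"
        "\<forall>x\<in>space (gauss_dim d (s d)) - B. \<bar>X d (normalize_idx (idx (d * d) (s d)) x) - c\<bar> \<le> e"
        using elim(1) by blast
      have "measure (sphere_measure (d * d) (s d)) (?A e d) \<le> measure (gauss_dim d (s d)) B"
        unfolding sphere_measure_gauss[OF S[OF elim(2)]]
      proof (rule finite_measure_mono[OF subsetI B(1)], rule ccontr)
        fix x assume "x \<in> {x \<in> space (leb_idx (idx (d * d) (s d))). normalize_idx (idx (d * d) (s d)) x \<in> ?A e d}" and "x \<notin> B"
        then show False using B(3)[rule_format, of x] by (simp add: space_gauss_leb)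
      qed
      then show ?case using B(2) eps by simp
    qed
  qed
qed

lemma interval_scale_borel:
  assumes I: "is_interval (I :: real set)"
  shows "(\<lambda>x. x / k) ` I \<in> sets borel"
proof -
  have "convex ((\<lambda>x. (1 / k) *\<^sub>R x) ` I)" using I by (intro convex_scaling) (simp add: is_interval_convex_1)
  then show ?thesis by (intro real_interval_borel_measurable) (simp add: is_interval_convex_1)
qed

lemma avg_indicator_witness:
  assumes "0 < avg (\<lambda>x. indicator I (f x)) xs"
  shows "\<exists>x\<in>set xs. f x \<in> I"
proof (rule ccontr)
  assume n: "\<not> ?thesis"
  have "avg (\<lambda>x. indicator I (f x)) xs \<le> avg (\<lambda>_. 0) xs" by (rule avg_mono) (use n in simp)
  then show False using assms by (simp add: avg_def sum_list_triv)
qed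

text \<open>Since \<eta>^2 <= \<eta>, the product (1 + \<eta>)(r + \<eta>)(2 + \<eta>) is at most 2
  r + \<eta> (4 r + 6), and \<kappa> - 1 contributes one more \<eta>.\<close>

lemma edge_bound:
  fixes r \<eta> e \<kappa> \<tau> y :: real
  assumes r: "0 < r" and h: "0 < \<eta>" "\<eta> \<le> 1" "\<eta> * (4 * r + 7) \<le> e"
    and k: "\<bar>\<kappa> - 1\<bar> \<le> \<eta>" and t: "\<bar>\<tau> - r\<bar> \<le> \<eta>" and y: "\<bar>y\<bar> \<le> 2 + \<eta>"
  shows "\<bar>\<kappa> * (1 + \<tau> * y) - 1\<bar> \<le> 2 * r + e"
proof -
  have "\<bar>\<kappa> * (1 + \<tau> * y) - 1\<bar> = \<bar>(\<kappa> - 1) + \<kappa> * \<tau> * y\<bar>" by (simp add: algebra_simps)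
  also have "\<dots> \<le> \<bar>\<kappa> - 1\<bar> + \<bar>\<kappa>\<bar> * \<bar>\<tau>\<bar> * \<bar>y\<bar>" unfolding abs_mult[symmetric] by (rule abs_triangle_ineq)
  also have "\<dots> \<le> \<eta> + (1 + \<eta>) * (r + \<eta>) * (2 + \<eta>)"
    using r h k t y by (intro add_mono mult_mono) auto
  also have "\<dots> \<le> 2 * r + \<eta> * (4 * r + 7)"
  proof -
    have q: "\<eta> * \<eta> \<le> \<eta>" using mult_left_mono[OF h(2), of \<eta>] h(1) by simp
    have "(1 + \<eta>) * (r + \<eta>) * (2 + \<eta>) = (r + \<eta>) * (2 + 3 * \<eta> + \<eta> * \<eta>)" by (simp add: algebra_simps)
    also have "\<dots> \<le> (r + \<eta>) * (2 + 4 * \<eta>)" using r h q by (intro mult_left_mono) auto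
    also have "\<dots> = 2 * r + 4 * (\<eta> * r) + 2 * \<eta> + 4 * (\<eta> * \<eta>)" by (simp add: algebra_simps)
    also have "\<dots> \<le> 2 * r + 4 * (\<eta> * r) + 6 * \<eta>" using q by linarith
    finally show ?thesis by (simp add: algebra_simps)
  qed
  finally show ?thesis using h by linarith
qed

text \<open>The absence of outliers keeps all eigenvalues between the edges up to \<open>e\<close>.
  Conversely a window at either edge has positive semicircular mass, and a proportion of eigenvalues
  within half of that mass cannot be zero.\<close>

lemma edges_whp:
  assumes a: "0 < \<alpha>" and e: "0 < e" and s_def: "\<And>d::nat. s d = nat \<lfloor>\<alpha> * real (d * d)\<rfloor>"
  shows "whp s (\<lambda>d x. (\<forall>y\<in>set (centered_spec d (s d) x). \<bar>radial_factor d (s d) x * (1 + sqrt (real (d * d) / real (s d)) * y) - 1\<bar> \<le> 2 * (1 / sqrt \<alpha>) + e)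
    \<and> (\<exists>y\<in>set (centered_spec d (s d) x). 1 + 2 * (1 / sqrt \<alpha>) - e < radial_factor d (s d) x * (1 + sqrt (real (d * d) / real (s d)) * y))
    \<and> (\<exists>y\<in>set (centered_spec d (s d) x). radial_factor d (s d) x * (1 + sqrt (real (d * d) / real (s d)) * y) < 1 - 2 * (1 / sqrt \<alpha>) + e))"
proof -
  define r where "r = 1 / sqrt \<alpha>"
  have r: "0 < r" using a by (simp add: r_def)
  \<comment> \<open>Capping at \<open>r\<close> keeps both windows inside the support, where the
    mass is positive.\<close>
  define e' where "e' = min e r"
  have e': "0 < e'" "e' \<le> e" "e' \<le> r" using e r by (auto simp: e'_def)
  let ?U = "{1 + 2 * r - e'<..}" and ?L = "{..<1 - 2 * r + e'}"
  have pU: "0 < measure (semicircle 1 (r\<^sup>2)) ?U"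
    by (rule semicircle_interval_pos[OF r, of "1 + 2 * r - e'" "1 + 2 * r"]) (use e' r in auto)
  have pL: "0 < measure (semicircle 1 (r\<^sup>2)) ?L"
    by (rule semicircle_interval_pos[OF r, of "1 - 2 * r" "1 - 2 * r + e'"]) (use e' r in auto)
  have iU: "is_interval ?U" and iL: "is_interval ?L" by (simp_all add: is_interval_convex_1)
  obtain \<eta>1 M1 where 1: "0 < \<eta>1" "\<And>xs \<kappa> \<tau>. near_edge_data r \<eta>1 M1 xs \<kappa> \<tau> \<Longrightarrow>
    \<bar>avg (\<lambda>x. indicator ?U (\<kappa> * (1 + \<tau> * x))) xs - measure (semicircle 1 (r\<^sup>2)) ?U\<bar> \<le> measure (semicircle 1 (r\<^sup>2)) ?U / 2"
    by (rule avg_indicator_close[OF r iU half_gt_zero[OF pU]]) blast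
  obtain \<eta>2 M2 where 2: "0 < \<eta>2" "\<And>xs \<kappa> \<tau>. near_edge_data r \<eta>2 M2 xs \<kappa> \<tau> \<Longrightarrow>
    \<bar>avg (\<lambda>x. indicator ?L (\<kappa> * (1 + \<tau> * x))) xs - measure (semicircle 1 (r\<^sup>2)) ?L\<bar> \<le> measure (semicircle 1 (r\<^sup>2)) ?L / 2"
    by (rule avg_indicator_close[OF r iL half_gt_zero[OF pL]]) blast
  define \<eta> where "\<eta> = min (min \<eta>1 \<eta>2) (min 1 (e / (4 * r + 7)))"
  have h: "0 < \<eta>" "\<eta> \<le> 1" "\<eta> \<le> \<eta>1" "\<eta> \<le> \<eta>2" "\<eta> \<le> e / (4 * r + 7)"
    using 1(1) 2(1) e r by (auto simp: \<eta>_def)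
  have h': "\<eta> * (4 * r + 7) \<le> e" using h(5) r by (simp add: pos_le_divide_eq)
  show ?thesis
  proof (rule whp_mono[OF near_edge_whp[OF a h(1,2) s_def, where M = "max M1 M2"]], intro always_eventually allI impI)
    fix d x
    let ?cs = "centered_spec d (s d) x" and ?\<kappa> = "radial_factor d (s d) x" and ?\<tau> = "sqrt (real (d * d) / real (s d))"
    assume "near_edge_data (1 / sqrt \<alpha>) \<eta> (max M1 M2) ?cs ?\<kappa> ?\<tau> \<and> (\<forall>y\<in>set ?cs. \<bar>y\<bar> \<le> 2 + \<eta>)"
    then have g: "near_edge_data r \<eta> (max M1 M2) ?cs ?\<kappa> ?\<tau>" "\<forall>y\<in>set ?cs. \<bar>y\<bar> \<le> 2 + \<eta>" unfolding r_def by blast+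
    have kt: "\<bar>?\<kappa> - 1\<bar> \<le> \<eta>" "\<bar>?\<tau> - r\<bar> \<le> \<eta>" using g(1) unfolding near_edge_data_def by blast+
    have "\<forall>y\<in>set ?cs. \<bar>?\<kappa> * (1 + ?\<tau> * y) - 1\<bar> \<le> 2 * r + e"
      using edge_bound[OF r h(1,2) h' kt] g(2) by blast
    moreover have "\<exists>y\<in>set ?cs. ?\<kappa> * (1 + ?\<tau> * y) \<in> ?U"
    proof (rule avg_indicator_witness)
      have "near_edge_data r \<eta>1 M1 ?cs ?\<kappa> ?\<tau>" by (rule near_edge_data_mono[OF g(1) h(3)]) simp
      from 1(2)[OF this] show "0 < avg (\<lambda>x. indicator ?U (?\<kappa> * (1 + ?\<tau> * x))) ?cs" using pU by linarith
    qed
    moreover have "\<exists>y\<in>set ?cs. ?\<kappa> * (1 + ?\<tau> * y) \<in> ?L"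
    proof (rule avg_indicator_witness)
      have "near_edge_data r \<eta>2 M2 ?cs ?\<kappa> ?\<tau>" by (rule near_edge_data_mono[OF g(1) h(4)]) simp
      from 2(2)[OF this] show "0 < avg (\<lambda>x. indicator ?L (?\<kappa> * (1 + ?\<tau> * x))) ?cs" using pL by linarith
    qed
    ultimately show "(\<forall>y\<in>set ?cs. \<bar>?\<kappa> * (1 + ?\<tau> * y) - 1\<bar> \<le> 2 * (1 / sqrt \<alpha>) + e)
      \<and> (\<exists>y\<in>set ?cs. 1 + 2 * (1 / sqrt \<alpha>) - e < ?\<kappa> * (1 + ?\<tau> * y)) \<and> (\<exists>y\<in>set ?cs. ?\<kappa> * (1 + ?\<tau> * y) < 1 - 2 * (1 / sqrt \<alpha>) + e)"
      unfolding r_def[symmetric] greaterThan_iff lessThan_iff using e'(2) by (meson diff_left_mono add_left_mono order_le_less_trans order_less_le_trans)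
  qed
qed

lemma normalized_vals:
  assumes d: "0 < d"
  shows "map (\<lambda>e. real (d * d) * e) (map (\<lambda>y. \<kappa> * (1 + \<tau> * y) / real (d * d)) xs) = map (\<lambda>y. \<kappa> * (1 + \<tau> * y)) xs"
  using d by simp

lemma interval_proportion:
  assumes a: "0 < \<alpha>" and s_def: "\<And>d::nat. s d = nat \<lfloor>\<alpha> * real (d * d)\<rfloor>" and I: "is_interval I"
  shows "conv_in_prob (\<lambda>d. sphere_measure (d * d) (s d))
    (\<lambda>d x. real (eig_count (pt_state d (s d) x) ((\<lambda>x. x / real (d * d)) ` I)) / real (d * d))
    (measure (semicircle 1 (1 / \<alpha>)) I)"
proof (rule conv_in_prob_sphereI)
  fix d :: nat
  show "(\<lambda>x. real (eig_count (pt_state d (s d) x) ((\<lambda>x. x / real (d * d)) ` I)) / real (d * d)) \<in> borel_measurable (leb_idx (idx (d * d) (s d)))"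
    by (intro borel_measurable_divide eig_count_measurable borel_measurable_const interval_scale_borel[OF I])
next
  fix e :: real assume e: "0 < e"
  define r where "r = 1 / sqrt \<alpha>"
  have r: "0 < r" "r\<^sup>2 = 1 / \<alpha>" using a by (simp_all add: r_def power_divide)
  obtain \<eta>1 M where 1: "0 < \<eta>1" "\<And>xs \<kappa> \<tau>. near_edge_data r \<eta>1 M xs \<kappa> \<tau> \<Longrightarrow>
    \<bar>avg (\<lambda>x. indicator I (\<kappa> * (1 + \<tau> * x))) xs - measure (semicircle 1 (r\<^sup>2)) I\<bar> \<le> e"
    by (rule avg_indicator_close[OF r(1) I e]) blast
  define \<eta> where "\<eta> = min \<eta>1 1"
  have h: "0 < \<eta>" "\<eta> \<le> 1" "\<eta> \<le> \<eta>1" using 1(1) by (auto simp: \<eta>_def)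
  let ?J = "\<lambda>d::nat. (\<lambda>x. x / real (d * d)) ` I"
  have "\<forall>\<^sub>F d in sequentially. \<forall>x. near_edge_data (1 / sqrt \<alpha>) \<eta> M (centered_spec d (s d) x) (radial_factor d (s d) x) (sqrt (real (d * d) / real (s d)))
      \<and> (\<forall>y\<in>set (centered_spec d (s d) x). \<bar>y\<bar> \<le> 2 + \<eta>) \<longrightarrow>
    \<bar>real (eig_count (pt_state d (s d) (normalize_idx (idx (d * d) (s d)) x)) (?J d)) / real (d * d) - measure (semicircle 1 (1 / \<alpha>)) I\<bar> \<le> e"
    using environment_dim(2)[OF a s_def] eventually_gt_at_top[of 0]
  proof eventually_elim
    case (elim d)
    show ?case
    proof (intro allI impI)
      fix x
      let ?cs = "centered_spec d (s d) x" and ?\<kappa> = "radial_factor d (s d) x" and ?\<tau> = "sqrt (real (d * d) / real (s d))"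
      assume "near_edge_data (1 / sqrt \<alpha>) \<eta> M ?cs ?\<kappa> ?\<tau> \<and> (\<forall>y\<in>set ?cs. \<bar>y\<bar> \<le> 2 + \<eta>)"
      then have "near_edge_data r \<eta> M ?cs ?\<kappa> ?\<tau>" unfolding r_def by blast
      then have "near_edge_data r \<eta>1 M ?cs ?\<kappa> ?\<tau>" by (rule near_edge_data_mono[OF _ h(3)]) simp
      from 1(2)[OF this] have c: "\<bar>avg (\<lambda>y. indicator I (?\<kappa> * (1 + ?\<tau> * y))) ?cs - measure (semicircle 1 (1 / \<alpha>)) I\<bar> \<le> e"
        unfolding r(2) .
      have s0: "0 < s d" using elim by simp
      have n: "real (d * d) \<noteq> 0" using elim by simp
      have ind: "indicator (?J d) (z / real (d * d)) = (indicator I z :: real)" for z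
      proof -
        have "z / real (d * d) \<in> ?J d \<longleftrightarrow> z \<in> I" using n by auto
        then show ?thesis by (simp add: indicator_def)
      qed
      have "real (eig_count (pt_state d (s d) (normalize_idx (idx (d * d) (s d)) x)) (?J d)) =
        (\<Sum>y\<leftarrow>?cs. indicator (?J d) (?\<kappa> * (1 + ?\<tau> * y) / real (d * d)))"
        unfolding eig_count_spectrum[OF pt_state_carrier normalized_spectrum[OF elim(2) s0]] length_filter_indicator map_map o_def ..
      also have "\<dots> = (\<Sum>y\<leftarrow>?cs. indicator I (?\<kappa> * (1 + ?\<tau> * y)))" by (simp only: ind)
      finally have "real (eig_count (pt_state d (s d) (normalize_idx (idx (d * d) (s d)) x)) (?J d)) / real (d * d) =
        avg (\<lambda>y. indicator I (?\<kappa> * (1 + ?\<tau> * y))) ?cs"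
        unfolding avg_def centered_spec_props by (simp only:)
      with c show "\<bar>real (eig_count (pt_state d (s d) (normalize_idx (idx (d * d) (s d)) x)) (?J d)) / real (d * d) - measure (semicircle 1 (1 / \<alpha>)) I\<bar> \<le> e"
        by (simp only:)
    qed
  qed
  then show "whp s (\<lambda>d x. \<bar>real (eig_count (pt_state d (s d) (normalize_idx (idx (d * d) (s d)) x)) (?J d)) / real (d * d) - measure (semicircle 1 (1 / \<alpha>)) I\<bar> \<le> e)"
    by (rule whp_mono[OF near_edge_whp[OF a h(1,2) s_def]])
qed

lemma extreme_eigenvalues:
  assumes a: "0 < \<alpha>" and s_def: "\<And>d::nat. s d = nat \<lfloor>\<alpha> * real (d * d)\<rfloor>"
  shows "conv_in_prob (\<lambda>d. sphere_measure (d * d) (s d))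
      (\<lambda>d x. lambda_max (of_nat (d * d) \<cdot>\<^sub>m pt_state d (s d) x)) (1 + 2 / sqrt \<alpha>)"
    and "conv_in_prob (\<lambda>d. sphere_measure (d * d) (s d))
      (\<lambda>d x. lambda_min (of_nat (d * d) \<cdot>\<^sub>m pt_state d (s d) x)) (1 - 2 / sqrt \<alpha>)"
proof -
  have W: "whp s (\<lambda>d x. \<bar>lambda_max (of_nat (d * d) \<cdot>\<^sub>m pt_state d (s d) (normalize_idx (idx (d * d) (s d)) x)) - (1 + 2 / sqrt \<alpha>)\<bar> \<le> e
     \<and> \<bar>lambda_min (of_nat (d * d) \<cdot>\<^sub>m pt_state d (s d) (normalize_idx (idx (d * d) (s d)) x)) - (1 - 2 / sqrt \<alpha>)\<bar> \<le> e)"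
    if e: "0 < e" for e
  proof (rule whp_mono[OF edges_whp[OF a e s_def]])
    show "\<forall>\<^sub>F d in sequentially. \<forall>x. (\<forall>y\<in>set (centered_spec d (s d) x). \<bar>radial_factor d (s d) x * (1 + sqrt (real (d * d) / real (s d)) * y) - 1\<bar> \<le> 2 * (1 / sqrt \<alpha>) + e)
        \<and> (\<exists>y\<in>set (centered_spec d (s d) x). 1 + 2 * (1 / sqrt \<alpha>) - e < radial_factor d (s d) x * (1 + sqrt (real (d * d) / real (s d)) * y))
        \<and> (\<exists>y\<in>set (centered_spec d (s d) x). radial_factor d (s d) x * (1 + sqrt (real (d * d) / real (s d)) * y) < 1 - 2 * (1 / sqrt \<alpha>) + e)
      \<longrightarrow> \<bar>lambda_max (of_nat (d * d) \<cdot>\<^sub>m pt_state d (s d) (normalize_idx (idx (d * d) (s d)) x)) - (1 + 2 / sqrt \<alpha>)\<bar> \<le> e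
     \<and> \<bar>lambda_min (of_nat (d * d) \<cdot>\<^sub>m pt_state d (s d) (normalize_idx (idx (d * d) (s d)) x)) - (1 - 2 / sqrt \<alpha>)\<bar> \<le> e"
      using environment_dim(2)[OF a s_def] eventually_gt_at_top[of 0]
    proof eventually_elim
      case (elim d)
      have s0: "0 < s d" using elim by simp
      show ?case
      proof (intro allI impI)
        fix x
        let ?cs = "centered_spec d (s d) x" and ?\<kappa> = "radial_factor d (s d) x" and ?\<tau> = "sqrt (real (d * d) / real (s d))"
        assume g: "(\<forall>y\<in>set ?cs. \<bar>?\<kappa> * (1 + ?\<tau> * y) - 1\<bar> \<le> 2 * (1 / sqrt \<alpha>) + e)
          \<and> (\<exists>y\<in>set ?cs. 1 + 2 * (1 / sqrt \<alpha>) - e < ?\<kappa> * (1 + ?\<tau> * y)) \<and> (\<exists>y\<in>set ?cs. ?\<kappa> * (1 + ?\<tau> * y) < 1 - 2 * (1 / sqrt \<alpha>) + e)"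
        define V where "V = set (map (\<lambda>y. ?\<kappa> * (1 + ?\<tau> * y)) ?cs)"
        define r where "r = 1 / sqrt \<alpha>"
        have V: "finite V" "V \<noteq> {}" using centered_spec_props(2)[OF elim(2)] by (simp_all add: V_def)
        have b: "\<bar>v - 1\<bar> \<le> 2 * r + e" if "v \<in> V" for v using g that unfolding V_def set_map r_def by blast
        obtain v w where vw: "v \<in> V" "1 + 2 * r - e < v" "w \<in> V" "w < 1 - 2 * r + e" using g unfolding V_def set_map r_def by blast
        let ?A = "pt_state d (s d) (normalize_idx (idx (d * d) (s d)) x)"
        have ne: "map (\<lambda>y. ?\<kappa> * (1 + ?\<tau> * y) / real (d * d)) ?cs \<noteq> []" using centered_spec_props(2)[OF elim(2)] by simp
        note l = lambda_scaled[OF elim(2) pt_state_carrier normalized_spectrum[OF elim(2) s0] ne, unfolded normalized_vals[OF elim(2)], folded V_def]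
        have "Max V \<in> V" "Min V \<in> V" "v \<le> Max V" "Min V \<le> w" using V vw by simp_all
        then have "\<bar>Max V - (1 + 2 * r)\<bar> \<le> e" "\<bar>Min V - (1 - 2 * r)\<bar> \<le> e" using b[of "Max V"] b[of "Min V"] vw by linarith+
        then show "\<bar>lambda_max (of_nat (d * d) \<cdot>\<^sub>m ?A) - (1 + 2 / sqrt \<alpha>)\<bar> \<le> e \<and> \<bar>lambda_min (of_nat (d * d) \<cdot>\<^sub>m ?A) - (1 - 2 / sqrt \<alpha>)\<bar> \<le> e"
          unfolding l r_def by simp
      qed
    qed
  qed
  show "conv_in_prob (\<lambda>d. sphere_measure (d * d) (s d))
      (\<lambda>d x. lambda_max (of_nat (d * d) \<cdot>\<^sub>m pt_state d (s d) x)) (1 + 2 / sqrt \<alpha>)"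
    by (rule conv_in_prob_sphereI, rule lambda_measurable, simp, rule whp_mono[OF W]) (auto intro: always_eventually)
  show "conv_in_prob (\<lambda>d. sphere_measure (d * d) (s d))
      (\<lambda>d x. lambda_min (of_nat (d * d) \<cdot>\<^sub>m pt_state d (s d) x)) (1 - 2 / sqrt \<alpha>)"
    by (rule conv_in_prob_sphereI, rule lambda_measurable, simp, rule whp_mono[OF W]) (auto intro: always_eventually)
qed

theorem theorem3:
  fixes \<alpha> :: real
  assumes "\<alpha> > 0"
  defines "s \<equiv> \<lambda>d::nat. nat \<lfloor>\<alpha> * real (d * d)\<rfloor>"
  defines "M \<equiv> \<lambda>d::nat. sphere_measure (d * d) (s d)"
  defines "G \<equiv> \<lambda>d::nat. \<lambda>psi. partial_transpose d (reduced_state (d * d) (s d) psi)"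
  shows "(\<forall>I :: real set. is_interval I \<longrightarrow>
            conv_in_prob M
              (\<lambda>d psi. real (eig_count (G d psi) ((\<lambda>x. x / real (d * d)) ` I)) / real (d * d))
              (measure (semicircle 1 (1 / \<alpha>)) I))
       \<and> conv_in_prob M (\<lambda>d psi. lambda_max (smult_mat (of_nat (d * d)) (G d psi))) (1 + 2 / sqrt \<alpha>)
       \<and> conv_in_prob M (\<lambda>d psi. lambda_min (smult_mat (of_nat (d * d)) (G d psi))) (1 - 2 / sqrt \<alpha>)"
proof -
  have s: "s d = nat \<lfloor>\<alpha> * real (d * d)\<rfloor>" for d by (simp add: s_def)
  have G: "G d psi = pt_state d (s d) psi" for d psi by (simp add: G_def pt_state_def)
  show ?thesis unfolding G M_def
    using interval_proportion[OF assms(1) s] extreme_eigenvalues[OF assms(1) s] by blast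
qed

end
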